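(* Let $a=(a_n)_{n\in\mathbb{Z}}$ be periodic with $a_n>0$ for every $n$. For generic $b \in \mathrm{LP}$ (i.e. for all $b$ in a dense $G_\delta$ subset of $\mathrm{LP}$), $\sigma(J_{a,b})$ is a Cantor set of zero Lebesgue measure, and the spectral type of $J_{a,b}$ is purely singular continuous.
   Context: $\mathrm{LP}\subset\ell^\infty(\mathbb{Z})$ denotes the set of real limit-periodic sequences, i.e. the closure in $\ell^\infty(\mathbb{Z})$ (sup norm) of the set of periodic real sequences. For $a_n>0$ and $b_n\in\mathbb{R}$ bounded, $J_{a,b}$ acts on $\ell^2(\mathbb{Z})$ by $[J_{a,b}u]_n = a_{n-1}u_{n-1} + b_n u_n + a_n u_{n+1}$. A Cantor set is a compact subset of $\mathbb{R}$ with empty interior and no isolated points. The spectral type is purely singular continuous if every spectral measure $\mu_\psi$, $\psi\in\ell^2(\mathbb{Z})$, is supported on a Lebesgue-null set and has no atoms. *)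

theory Defs
  imports "HOL-Analysis.Analysis" "HOL-Probability.Probability"
begin

definition l2Z :: "(int \<Rightarrow> complex) set" where
  "l2Z = {u. (\<lambda>n. (cmod (u n))\<^sup>2) summable_on UNIV}"

definition l2_norm :: "(int \<Rightarrow> complex) \<Rightarrow> real" where
  "l2_norm u = sqrt (\<Sum>\<^sub>\<infinity>n. (cmod (u n))\<^sup>2)"

definition l2_inner :: "(int \<Rightarrow> complex) \<Rightarrow> (int \<Rightarrow> complex) \<Rightarrow> complex" where
  "l2_inner u v = (\<Sum>\<^sub>\<infinity>n. cnj (u n) * v n)"

definition jacobi :: "(int \<Rightarrow> real) \<Rightarrow> (int \<Rightarrow> real) \<Rightarrow> (int \<Rightarrow> complex) \<Rightarrow> (int \<Rightarrow> complex)" where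
  "jacobi a b u = (\<lambda>n. of_real (a (n - 1)) * u (n - 1) + of_real (b n) * u n
                       + of_real (a n) * u (n + 1))"

definition in_resolvent_set :: "((int \<Rightarrow> complex) \<Rightarrow> (int \<Rightarrow> complex)) \<Rightarrow> complex \<Rightarrow> bool" where
  "in_resolvent_set T z \<longleftrightarrow>
     (\<forall>\<psi>\<in>l2Z. \<exists>!\<phi>. \<phi> \<in> l2Z \<and> (\<lambda>n. T \<phi> n - z * \<phi> n) = \<psi>) \<and>
     (\<exists>C. \<forall>\<phi>\<in>l2Z. l2_norm \<phi> \<le> C * l2_norm (\<lambda>n. T \<phi> n - z * \<phi> n))"

definition op_spectrum :: "((int \<Rightarrow> complex) \<Rightarrow> (int \<Rightarrow> complex)) \<Rightarrow> complex set" where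
  "op_spectrum T = {z. \<not> in_resolvent_set T z}"

definition real_spectrum :: "((int \<Rightarrow> complex) \<Rightarrow> (int \<Rightarrow> complex)) \<Rightarrow> real set" where
  "real_spectrum T = {x. complex_of_real x \<in> op_spectrum T}"

text \<open>mu is the spectral measure of psi for T: a finite Borel measure on R with
  <psi, (T - z)^{-1} psi> = integral of 1/(x - z) dmu(x) for all non-real z.\<close>
definition is_spectral_measure ::
  "((int \<Rightarrow> complex) \<Rightarrow> (int \<Rightarrow> complex)) \<Rightarrow> (int \<Rightarrow> complex) \<Rightarrow> real measure \<Rightarrow> bool" where
  "is_spectral_measure T \<psi> \<mu> \<longleftrightarrow>
     finite_measure \<mu> \<and> sets \<mu> = sets borel \<and>
     (\<forall>z. Im z \<noteq> 0 \<longrightarrow>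
        (\<forall>\<phi>\<in>l2Z. (\<lambda>n. T \<phi> n - z * \<phi> n) = \<psi> \<longrightarrow>
           l2_inner \<psi> \<phi> = (\<integral>x. 1 / (complex_of_real x - z) \<partial>\<mu>)))"

definition singular_continuous_measure :: "real measure \<Rightarrow> bool" where
  "singular_continuous_measure \<mu> \<longleftrightarrow>
     (\<exists>N. N \<in> null_sets lborel \<and> emeasure \<mu> (UNIV - N) = 0) \<and>
     (\<forall>x. emeasure \<mu> {x} = 0)"

definition purely_singular_continuous ::
  "((int \<Rightarrow> complex) \<Rightarrow> (int \<Rightarrow> complex)) \<Rightarrow> bool" where
  "purely_singular_continuous T \<longleftrightarrow>
     (\<forall>\<psi>\<in>l2Z. \<forall>\<mu>. is_spectral_measure T \<psi> \<mu> \<longrightarrow> singular_continuous_measure \<mu>)"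

definition cantor_set :: "real set \<Rightarrow> bool" where
  "cantor_set S \<longleftrightarrow> compact S \<and> interior S = {} \<and> (\<forall>x\<in>S. x islimpt S)"

definition periodic_seq :: "(int \<Rightarrow> 'a) \<Rightarrow> bool" where
  "periodic_seq f \<longleftrightarrow> (\<exists>p>0. \<forall>n. f (n + p) = f n)"

text \<open>Bounded real sequences with the sup norm are the type int =>C real
  (int carries the discrete topology). LP is the sup-norm closure of the periodic ones.\<close>
definition LP :: "(int \<Rightarrow>\<^sub>C real) set" where
  "LP = closure {b. periodic_seq (apply_bcontfun b)}"

end

theory Submission
  imports Defs "HOL-Computational_Algebra.Polynomial" "HOL-Analysis.Kronecker_Approximation_Theorem"
begin

text \<open>For periodic data every energy can be moved into a gap by an arbitrarily small periodic perturbation.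
  By compactness finitely many such perturbations serve all energies of a bounded range; repeating each of them
  many times yields a periodic potential whose transfer matrices are exponentially large somewhere in the
  period. The derivative of the rotation number is bounded below by these norms, so the bands are exponentially
  short while their number grows only linearly, and the spectrum has small measure. Small measure is stable under
  perturbation, and super-exponentially good periodic approximation (Gordon) excludes eigenvalues; both conditions
  define dense open sets. Zero measure gives singularity and empty interior, while a spectrum without eigenvalues
  has no isolated points and spectral measures without atoms.\<close>

section \<open>Square-summable sequences\<close>

text \<open>All spectral statements are turned into lower bounds
  \<open>c * norm x \<le> norm (H z x)\<close>: such a bound decides membership in the resolvent
  set, survives small changes of energy and potential, and comes out of periodic data with explicit
  constants. Spectral measures are reached through the imaginary part of their Cauchy transform,
  which is \<open>Im z\<close> times the squared norm of the resolvent vector. The lower bound on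
  the derivative of the rotation number rests on conjugacy. Monodromy matrices based at two sites
  are conjugate by the transfer matrix between them; if that conjugator is large while the energy is
  elliptic, the monodromy matrices must have large off-diagonal entries. These entries have one sign
  along the period, so they add up without cancellation to the derivative of the discriminant. One
  periodic potential serves both generic conditions, since any multiple of its period may be used as
  the scale in Gordon's condition.\<close>

lemma l2Z_inner_summable:
  assumes "u \<in> l2Z" "v \<in> l2Z"
  shows "(\<lambda>n. inner (u n) (v n)) summable_on UNIV"
proof -
  have s: "(\<lambda>n. (cmod (u n))\<^sup>2 + (cmod (v n))\<^sup>2) summable_on UNIV"
    using assms by (auto simp: l2Z_def intro!: summable_on_add)
  have "norm (inner (u n) (v n)) \<le> (cmod (u n))\<^sup>2 + (cmod (v n))\<^sup>2" for n
  proof -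
    have "norm (inner (u n) (v n)) \<le> cmod (u n) * cmod (v n)"
      by (rule Cauchy_Schwarz_ineq2[folded real_norm_def])
    moreover have "2 * (cmod (u n) * cmod (v n)) \<le> (cmod (u n))\<^sup>2 + (cmod (v n))\<^sup>2"
      using sum_squares_bound[of "cmod (u n)" "cmod (v n)"] by simp
    moreover have "0 \<le> cmod (u n) * cmod (v n)" by simp
    ultimately show ?thesis by linarith
  qed
  then have "(\<lambda>n. norm (inner (u n) (v n))) summable_on UNIV"
    by (intro summable_on_comparison_test[OF s]) auto
  then show ?thesis by (rule abs_summable_summable)
qed

lemma l2Z_comparison:
  assumes "u \<in> l2Z" "\<And>n. cmod (v n) \<le> C * cmod (u n)"
  shows "v \<in> l2Z"
proof -
  have s: "(\<lambda>n. C\<^sup>2 * (cmod (u n))\<^sup>2) summable_on UNIV"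
    using assms by (auto simp: l2Z_def intro!: summable_on_cmult_right)
  have "(cmod (v n))\<^sup>2 \<le> C\<^sup>2 * (cmod (u n))\<^sup>2" for n
    using power_mono[OF assms(2)[of n], of 2] by (simp add: power_mult_distrib)
  then show ?thesis unfolding l2Z_def
    by (auto intro!: summable_on_comparison_test[OF s])
qed

lemma l2Z_add:
  assumes "u \<in> l2Z" "v \<in> l2Z"
  shows "(\<lambda>n. u n + v n) \<in> l2Z"
proof -
  have s: "(\<lambda>n. 2 * (cmod (u n))\<^sup>2 + 2 * (cmod (v n))\<^sup>2) summable_on UNIV"
    using assms by (auto simp: l2Z_def intro!: summable_on_add summable_on_cmult_right)
  have "(cmod (u n + v n))\<^sup>2 \<le> 2 * (cmod (u n))\<^sup>2 + 2 * (cmod (v n))\<^sup>2" for n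
  proof -
    have "(cmod (u n + v n))\<^sup>2 \<le> (cmod (u n) + cmod (v n))\<^sup>2"
      by (intro power_mono norm_triangle_ineq) auto
    also have "\<dots> \<le> 2 * (cmod (u n))\<^sup>2 + 2 * (cmod (v n))\<^sup>2"
      using sum_squares_bound[of "cmod (u n)" "cmod (v n)"] by (simp add: power2_sum)
    finally show ?thesis .
  qed
  then show ?thesis unfolding l2Z_def
    by (auto intro!: summable_on_comparison_test[OF s])
qed

text \<open>Made a real inner product space: the inner product is the real part of the complex one,
  the norm is unchanged, and complex scalars come back as the operators
  \<open>cscale\<close>.\<close>

typedef ell2 = l2Z
  morphisms ell2_seq Abs_ell2
proof
  show "(\<lambda>_. 0) \<in> l2Z" by (simp add: l2Z_def)
qed

setup_lifting type_definition_ell2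

instantiation ell2 :: real_inner
begin

lift_definition zero_ell2 :: ell2 is "\<lambda>_. 0" by (simp add: l2Z_def)
lift_definition plus_ell2 :: "ell2 \<Rightarrow> ell2 \<Rightarrow> ell2" is "\<lambda>u v n. u n + v n"
  by (rule l2Z_add)
lift_definition uminus_ell2 :: "ell2 \<Rightarrow> ell2" is "\<lambda>u n. - u n"
  by (simp add: l2Z_def)
lift_definition minus_ell2 :: "ell2 \<Rightarrow> ell2 \<Rightarrow> ell2" is "\<lambda>u v n. u n - v n"
proof -
  fix u v :: "int \<Rightarrow> complex" assume "u \<in> l2Z" "v \<in> l2Z"
  then show "(\<lambda>n. u n - v n) \<in> l2Z"
    using l2Z_add[of u "\<lambda>n. - v n"] by (simp add: l2Z_def)
qed
lift_definition scaleR_ell2 :: "real \<Rightarrow> ell2 \<Rightarrow> ell2" is "\<lambda>r u n. r *\<^sub>R u n"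
  by (rule l2Z_comparison[where C = "\<bar>r\<bar>" for r]) auto
definition inner_ell2 :: "ell2 \<Rightarrow> ell2 \<Rightarrow> real" where
  "inner x y = (\<Sum>\<^sub>\<infinity>n. inner (ell2_seq x n) (ell2_seq y n))"
definition norm_ell2 :: "ell2 \<Rightarrow> real" where "norm (x::ell2) = sqrt (inner x x)"
definition sgn_ell2 :: "ell2 \<Rightarrow> ell2" where "sgn (x::ell2) = inverse (norm x) *\<^sub>R x"
definition dist_ell2 :: "ell2 \<Rightarrow> ell2 \<Rightarrow> real" where "dist (x::ell2) y = norm (x - y)"
definition uniformity_ell2 :: "(ell2 \<times> ell2) filter" where
  "uniformity_ell2 = (INF e\<in>{0 <..}. principal {(x, y). dist x y < e})"
definition open_ell2 :: "ell2 set \<Rightarrow> bool" where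
  "open (U::ell2 set) = (\<forall>x\<in>U. eventually (\<lambda>(x', y). x' = x \<longrightarrow> y \<in> U) uniformity)"

instance
proof
  fix x y z :: ell2 and r s :: real
  show "x + y + z = x + (y + z)" "x + y = y + x" "0 + x = x" "- x + x = 0" "x - y = x + - y"
    "r *\<^sub>R (x + y) = r *\<^sub>R x + r *\<^sub>R y" "(r + s) *\<^sub>R x = r *\<^sub>R x + s *\<^sub>R x"
    "r *\<^sub>R s *\<^sub>R x = (r * s) *\<^sub>R x" "1 *\<^sub>R x = x"
    by (transfer, simp add: algebra_simps)+
  show "dist x y = norm (x - y)" by (rule dist_ell2_def)
  show "sgn x = inverse (norm x) *\<^sub>R x" by (rule sgn_ell2_def)
  show "norm x = sqrt (inner x x)" by (rule norm_ell2_def)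
  show "uniformity = (INF e\<in>{0 <..}. principal {(x::ell2, y). dist x y < e})"
    by (rule uniformity_ell2_def)
  show "open U = (\<forall>x\<in>U. eventually (\<lambda>(x', y). x' = x \<longrightarrow> y \<in> U) uniformity)" for U :: "ell2 set"
    by (rule open_ell2_def)
  show "inner x y = inner y x" by (simp add: inner_ell2_def inner_commute)
  show "inner (x + y) z = inner x z + inner y z"
    unfolding inner_ell2_def plus_ell2.rep_eq inner_add_left
    by (intro infsum_add l2Z_inner_summable ell2_seq)
  show "inner (r *\<^sub>R x) y = r * inner x y"
    unfolding inner_ell2_def scaleR_ell2.rep_eq inner_scaleR_left
    by (rule infsum_cmult_right')
  show "0 \<le> inner x x" unfolding inner_ell2_def by (intro infsum_nonneg) auto
  show "(inner x x = 0) = (x = 0)"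
  proof
    assume "inner x x = 0"
    then have "inner (ell2_seq x n) (ell2_seq x n) = 0" for n
      using nonneg_infsum_le_0D[of "\<lambda>n. inner (ell2_seq x n) (ell2_seq x n)" UNIV n]
        l2Z_inner_summable[OF ell2_seq ell2_seq] by (simp add: inner_ell2_def)
    then show "x = 0" by transfer auto
  next
    assume "x = 0" then show "inner x x = 0" by (simp add: inner_ell2_def zero_ell2.rep_eq)
  qed
qed

end

lemma l2_norm_ell2: "l2_norm (ell2_seq x) = norm x"
  by (simp add: l2_norm_def norm_ell2_def inner_ell2_def power2_norm_eq_inner)

lemma ell2_finite_sum_le:
  assumes "finite F"
  shows "(\<Sum>n\<in>F. (cmod (ell2_seq x n))\<^sup>2) \<le> (norm x)\<^sup>2"
  unfolding power2_norm_eq_inner inner_ell2_def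
  using assms by (intro finite_sum_le_infsum l2Z_inner_summable ell2_seq) auto

lemma ell2_seq_le_norm: "cmod (ell2_seq x n) \<le> norm x"
  using ell2_finite_sum_le[of "{n}" x] power2_le_imp_le[OF _ norm_ge_zero] by simp

text \<open>Bounds on finite partial sums give membership and norm at once; multiplications, shifts
  and weak limits are all controlled this way.\<close>

lemma l2ZI_bounded:
  assumes "\<And>F. finite F \<Longrightarrow> (\<Sum>n\<in>F. (cmod (u n))\<^sup>2) \<le> B\<^sup>2" and "B \<ge> 0"
  shows "u \<in> l2Z" "norm (Abs_ell2 u) \<le> B"
proof -
  have bd: "bdd_above (sum (\<lambda>n. (cmod (u n))\<^sup>2) ` {F. F \<subseteq> UNIV \<and> finite F})"
    using assms(1) by (auto intro!: bdd_aboveI2)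
  show *: "u \<in> l2Z" unfolding l2Z_def
    using nonneg_bdd_above_summable_on[OF _ bd] by auto
  have "(\<Sum>\<^sub>\<infinity>n. (cmod (u n))\<^sup>2) \<le> B\<^sup>2"
    using * assms by (intro infsum_le_finite_sums) (auto simp: l2Z_def)
  then have "(norm (Abs_ell2 u))\<^sup>2 \<le> B\<^sup>2"
    unfolding power2_norm_eq_inner inner_ell2_def Abs_ell2_inverse[OF *] .
  then show "norm (Abs_ell2 u) \<le> B" using assms(2) by (rule power2_le_imp_le)
qed

section \<open>Weak convergence of bounded sequences, tested on coordinates\<close>

lemma ell2_pointwise_limit_bounded:
  assumes "\<And>k. norm (x k) \<le> B" "\<And>n. (\<lambda>k. ell2_seq (x k) n) \<longlonglongrightarrow> u n"
  shows "u \<in> l2Z" "norm (Abs_ell2 u) \<le> B"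
proof -
  have B: "B \<ge> 0" using assms(1)[of 0] norm_ge_zero order_trans by blast
  have "(\<Sum>n\<in>F. (cmod (u n))\<^sup>2) \<le> B\<^sup>2" if "finite F" for F
  proof (rule LIMSEQ_le_const2)
    show "(\<lambda>k. \<Sum>n\<in>F. (cmod (ell2_seq (x k) n))\<^sup>2) \<longlonglongrightarrow> (\<Sum>n\<in>F. (cmod (u n))\<^sup>2)"
      by (intro tendsto_intros assms)
    show "\<exists>N. \<forall>k\<ge>N. (\<Sum>n\<in>F. (cmod (ell2_seq (x k) n))\<^sup>2) \<le> B\<^sup>2"
      using order_trans[OF ell2_finite_sum_le[OF that] power_mono[OF assms(1) norm_ge_zero]] by blast
  qed
  then show "u \<in> l2Z" "norm (Abs_ell2 u) \<le> B" using l2ZI_bounded[of u B] B by auto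
qed

text \<open>Tychonoff for a product of discs: the product over the integers is metrizable, so
  compactness yields convergent subsequences, and the norm bound passes to coordinatewise
  limits.\<close>

lemma ell2_weak_compact:
  fixes x :: "nat \<Rightarrow> ell2"
  assumes "\<And>k. norm (x k) \<le> B"
  obtains r y where "strict_mono (r :: nat \<Rightarrow> nat)" "norm y \<le> B"
    "\<And>n. (\<lambda>k. ell2_seq (x (r k)) n) \<longlonglongrightarrow> ell2_seq y n"
proof -
  have "compactin (product_topology (\<lambda>_. euclidean) UNIV) (PiE UNIV (\<lambda>_::int. cball (0::complex) B))"
    by (simp add: compactin_PiE)
  then have "compact (PiE UNIV (\<lambda>_::int. cball (0::complex) B))"
    by (simp add: euclidean_product_topology)
  then have sc: "seq_compact (PiE UNIV (\<lambda>_::int. cball (0::complex) B))"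
    by (simp add: compact_eq_seq_compact_metric)
  have "\<forall>k. ell2_seq (x k) \<in> PiE UNIV (\<lambda>_::int. cball (0::complex) B)"
    using order_trans[OF ell2_seq_le_norm assms] by (simp add: PiE_iff)
  with sc[unfolded seq_compact_def, THEN spec[of _ "\<lambda>k. ell2_seq (x k)"]]
  obtain l r where r: "strict_mono r" "((\<lambda>k. ell2_seq (x k)) \<circ> r) \<longlonglongrightarrow> l"
    by metis
  have lim: "(\<lambda>k. ell2_seq (x (r k)) n) \<longlonglongrightarrow> l n" for n
    using continuous_on_tendsto_compose[OF continuous_on_product_coordinates[of n] r(2)]
    by (simp add: o_def)
  have "l \<in> l2Z" "norm (Abs_ell2 l) \<le> B"
    using ell2_pointwise_limit_bounded[of "x \<circ> r" B l] assms lim by (auto simp: o_def)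
  then show thesis using that[of r "Abs_ell2 l"] r lim by (simp add: Abs_ell2_inverse)
qed

text \<open>Splits \<open>y\<close> into a finitely supported part, on which coordinatewise
  convergence suffices, and a tail of norm at most \<open>d\<close>; the choice of \<open>d\<close>
  keeps the contribution of the tail below \<open>e / 2\<close>.\<close>

lemma ell2_weak_null:
  assumes "\<And>k. norm (x k) \<le> B" "\<And>n. (\<lambda>k. ell2_seq (x k) n) \<longlonglongrightarrow> 0"
  shows "(\<lambda>k. inner y (x k)) \<longlonglongrightarrow> 0"
proof (rule LIMSEQ_I)
  fix e :: real assume "e > 0"
  define d where "d = e / (2 * (\<bar>B\<bar> + 1))"
  have d: "d > 0" using \<open>e > 0\<close> by (simp add: d_def)
  have s: "((\<lambda>n. (cmod (ell2_seq y n))\<^sup>2) has_sum (norm y)\<^sup>2) UNIV"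
    using ell2_seq[of y] unfolding power2_norm_eq_inner inner_ell2_def l2Z_def by auto
  obtain F where F: "finite F" "dist (\<Sum>n\<in>F. (cmod (ell2_seq y n))\<^sup>2) ((norm y)\<^sup>2) \<le> d\<^sup>2"
    using has_sum_finite_approximation[OF s, of "d\<^sup>2"] d by auto
  define v where "v = (\<lambda>n. if n \<in> F then 0 else ell2_seq y n)"
  have "(\<Sum>n\<in>G. (cmod (v n))\<^sup>2) \<le> d\<^sup>2" if "finite G" for G
  proof -
    have "(\<Sum>n\<in>G. (cmod (v n))\<^sup>2) = (\<Sum>n\<in>G - F. (cmod (ell2_seq y n))\<^sup>2)"
      using that by (intro sum.mono_neutral_cong_right) (auto simp: v_def)
    moreover have "(\<Sum>n\<in>(G - F) \<union> F. (cmod (ell2_seq y n))\<^sup>2) =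
        (\<Sum>n\<in>G - F. (cmod (ell2_seq y n))\<^sup>2) + (\<Sum>n\<in>F. (cmod (ell2_seq y n))\<^sup>2)"
      using that F by (intro sum.union_disjoint) auto
    moreover have "(\<Sum>n\<in>(G - F) \<union> F. (cmod (ell2_seq y n))\<^sup>2) \<le> (norm y)\<^sup>2"
      using that F by (intro ell2_finite_sum_le) auto
    ultimately show ?thesis using F(2) by (simp add: dist_real_def)
  qed
  then have v: "v \<in> l2Z" "norm (Abs_ell2 v) \<le> d" using l2ZI_bounded[of v d] d by auto
  define w where "w = y - Abs_ell2 v"
  have w: "ell2_seq w n = (if n \<in> F then ell2_seq y n else 0)" for n
    by (simp add: w_def minus_ell2.rep_eq Abs_ell2_inverse[OF v(1)]) (simp add: v_def)
  have iw: "inner w (x k) = (\<Sum>n\<in>F. inner (ell2_seq y n) (ell2_seq (x k) n))" for k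
  proof -
    have "inner w (x k) = (\<Sum>\<^sub>\<infinity>n\<in>F. inner (ell2_seq y n) (ell2_seq (x k) n))"
      unfolding inner_ell2_def by (rule infsum_cong_neutral) (auto simp: w)
    then show ?thesis using F by simp
  qed
  have "(\<lambda>k. inner w (x k)) \<longlonglongrightarrow> (\<Sum>n\<in>F. inner (ell2_seq y n) 0)"
    unfolding iw by (intro tendsto_intros assms)
  then obtain N where N: "\<And>k. k \<ge> N \<Longrightarrow> \<bar>inner w (x k)\<bar> < e / 2"
    using \<open>e > 0\<close> LIMSEQ_D[of _ 0 "e/2"] by force
  have "norm (inner y (x k) - 0) < e" if "k \<ge> N" for k
  proof -
    have "inner y (x k) = inner w (x k) + inner (Abs_ell2 v) (x k)"
      by (simp add: w_def inner_diff_left)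
    moreover have "\<bar>inner (Abs_ell2 v) (x k)\<bar> \<le> d * \<bar>B\<bar>"
      using Cauchy_Schwarz_ineq2[of "Abs_ell2 v" "x k"] v(2) assms(1)[of k] d
      by (smt (verit) mult_mono norm_ge_zero)
    moreover have "d * \<bar>B\<bar> \<le> e / 2" using \<open>e > 0\<close> by (simp add: d_def field_simps)
    ultimately show ?thesis using N[OF that] by simp
  qed
  then show "\<exists>N. \<forall>k\<ge>N. norm (inner y (x k) - 0) < e" by blast
qed

section \<open>Bounded Jacobi operators\<close>

lemma ell2_eqI: "(\<And>n. ell2_seq x n = ell2_seq y n) \<Longrightarrow> x = y"
  by (metis ell2_seq_inject ext)

definition ell2_mult :: "(int \<Rightarrow> complex) \<Rightarrow> ell2 \<Rightarrow> ell2" where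
  "ell2_mult c x = Abs_ell2 (\<lambda>n. c n * ell2_seq x n)"

definition ell2_shift :: "int \<Rightarrow> ell2 \<Rightarrow> ell2" where
  "ell2_shift k x = Abs_ell2 (\<lambda>n. ell2_seq x (n + k))"

lemma ell2_mult:
  assumes "\<And>n. cmod (c n) \<le> C"
  shows ell2_seq_mult: "ell2_seq (ell2_mult c x) n = c n * ell2_seq x n"
    and norm_ell2_mult: "norm (ell2_mult c x) \<le> C * norm x"
proof -
  have C: "C \<ge> 0" using assms[of 0] norm_ge_zero order_trans by blast
  have "(\<Sum>n\<in>F. (cmod (c n * ell2_seq x n))\<^sup>2) \<le> (C * norm x)\<^sup>2" if "finite F" for F
  proof -
    have "(\<Sum>n\<in>F. (cmod (c n * ell2_seq x n))\<^sup>2) \<le> (\<Sum>n\<in>F. C\<^sup>2 * (cmod (ell2_seq x n))\<^sup>2)"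
      unfolding norm_mult power_mult_distrib
      by (intro sum_mono mult_right_mono power_mono assms) auto
    also have "\<dots> \<le> C\<^sup>2 * (norm x)\<^sup>2"
      unfolding sum_distrib_left[symmetric]
      by (intro mult_left_mono ell2_finite_sum_le that) auto
    finally show ?thesis by (simp add: power_mult_distrib)
  qed
  note * = l2ZI_bounded[OF this, simplified]
  show "ell2_seq (ell2_mult c x) n = c n * ell2_seq x n"
    using * C by (simp add: ell2_mult_def Abs_ell2_inverse)
  show "norm (ell2_mult c x) \<le> C * norm x"
    using * C by (simp add: ell2_mult_def)
qed

lemma ell2_seq_shift: "ell2_seq (ell2_shift k x) n = ell2_seq x (n + k)"
  and norm_ell2_shift: "norm (ell2_shift k x) \<le> norm x"
proof -
  have "(\<Sum>n\<in>F. (cmod (ell2_seq x (n + k)))\<^sup>2) \<le> (norm x)\<^sup>2" if "finite F" for F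
  proof -
    have "(\<Sum>n\<in>F. (cmod (ell2_seq x (n + k)))\<^sup>2) = (\<Sum>n\<in>(\<lambda>n. n + k) ` F. (cmod (ell2_seq x n))\<^sup>2)"
      by (subst sum.reindex) auto
    then show ?thesis using ell2_finite_sum_le that by simp
  qed
  note * = l2ZI_bounded[OF this norm_ge_zero]
  show "ell2_seq (ell2_shift k x) n = ell2_seq x (n + k)" "norm (ell2_shift k x) \<le> norm x"
    using * by (simp_all add: ell2_shift_def Abs_ell2_inverse)
qed

lemma inner_ell2_mult:
  assumes "\<And>n. cmod (c n) \<le> C"
  shows "inner (ell2_mult c x) y = inner x (ell2_mult (\<lambda>n. cnj (c n)) y)"
proof -
  have *: "\<And>n. cmod (cnj (c n)) \<le> C" using assms by simp
  show ?thesis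
    unfolding inner_ell2_def ell2_seq_mult[OF assms] ell2_seq_mult[of "\<lambda>n. cnj (c n)", OF *]
    by (rule infsum_cong) (simp add: inner_complex_def algebra_simps)
qed

lemma inner_ell2_shift: "inner (ell2_shift k x) y = inner x (ell2_shift (- k) y)"
proof -
  have "(\<Sum>\<^sub>\<infinity>n. inner (ell2_seq x (n + k)) (ell2_seq y (n + k - k))) =
        (\<Sum>\<^sub>\<infinity>n. inner (ell2_seq x n) (ell2_seq y (n - k)))"
    by (rule infsum_reindex_bij_betw[where g = "\<lambda>n. n + k" and f = "\<lambda>n. inner (ell2_seq x n) (ell2_seq y (n - k))"])
      (rule bij_betwI[of _ _ _ "\<lambda>n. n - k"], auto)
  then show ?thesis by (simp add: inner_ell2_def ell2_seq_shift)
qed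

abbreviation cscale :: "complex \<Rightarrow> ell2 \<Rightarrow> ell2" where
  "cscale z \<equiv> ell2_mult (\<lambda>_. z)"

lemma ell2_seq_cscale: "ell2_seq (cscale z x) n = z * ell2_seq x n"
  by (rule ell2_seq_mult[of _ "cmod z"]) simp

lemma inner_cscale: "inner (cscale z x) y = inner x (cscale (cnj z) y)"
  by (rule inner_ell2_mult[of _ "cmod z"]) simp

lemmas ell2_seq_simps = plus_ell2.rep_eq minus_ell2.rep_eq uminus_ell2.rep_eq scaleR_ell2.rep_eq
  zero_ell2.rep_eq ell2_seq_cscale ell2_seq_shift

lemma norm_cscale [simp]: "norm (cscale z x) = cmod z * norm x"
proof -
  have "inner (cscale z x) (cscale z x) = inner x (((cmod z)\<^sup>2) *\<^sub>R x)"
    unfolding inner_cscale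
    by (rule arg_cong[of _ _ "inner x"], rule ell2_eqI)
      (use complex_norm_square[of z] in \<open>simp add: ell2_seq_simps scaleR_conv_of_real mult_ac\<close>)
  then have "(norm (cscale z x))\<^sup>2 = (cmod z * norm x)\<^sup>2"
    by (simp add: power2_norm_eq_inner power_mult_distrib)
  then show ?thesis by (simp add: power2_eq_iff_nonneg)
qed

locale bounded_jacobi =
  fixes a b :: "int \<Rightarrow> real" and A B :: real
  assumes a_bound: "\<And>n. \<bar>a n\<bar> \<le> A" and b_bound: "\<And>n. \<bar>b n\<bar> \<le> B"
begin

text \<open>The operator minus \<open>z\<close>. The off-diagonal terms are written as
  multiplication after shift and shift after multiplication, so that each is visibly the adjoint of
  the other.\<close>

definition H :: "complex \<Rightarrow> ell2 \<Rightarrow> ell2" where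
  "H z x = ell2_mult (\<lambda>n. of_real (a n)) (ell2_shift 1 x) + ell2_shift (-1) (ell2_mult (\<lambda>n. of_real (a n)) x)
     + ell2_mult (\<lambda>n. of_real (b n)) x - cscale z x"

lemma a_bound': "cmod (of_real (a n)) \<le> A" and b_bound': "cmod (of_real (b n)) \<le> B"
  using a_bound b_bound by auto

lemmas mult_a = ell2_seq_mult[of "\<lambda>n. of_real (a n)", OF a_bound']
lemmas mult_b = ell2_seq_mult[of "\<lambda>n. of_real (b n)", OF b_bound']

lemma H_seq: "ell2_seq (H z x) n = jacobi a b (ell2_seq x) n - z * ell2_seq x n"
  by (simp add: H_def ell2_seq_simps mult_a mult_b jacobi_def)

lemma seq_H: "ell2_seq (H z x) = (\<lambda>n. jacobi a b (ell2_seq x) n - z * ell2_seq x n)"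
  by (rule ext) (rule H_seq)

lemma H_add: "H z (x + y) = H z x + H z y"
  by (rule ell2_eqI) (simp add: H_seq ell2_seq_simps jacobi_def algebra_simps)

lemma H_scaleR: "H z (r *\<^sub>R x) = r *\<^sub>R H z x"
  by (rule ell2_eqI) (simp add: H_seq ell2_seq_simps jacobi_def scaleR_conv_of_real algebra_simps)

lemma H_diff: "H z (x - y) = H z x - H z y"
  by (rule ell2_eqI) (simp add: H_seq ell2_seq_simps jacobi_def algebra_simps)

lemma H_cscale: "H z (cscale w x) = cscale w (H z x)"
  by (rule ell2_eqI) (simp add: H_seq ell2_seq_simps jacobi_def algebra_simps)

lemma H_shift_point: "H z x = H w x - cscale (z - w) x"
  by (rule ell2_eqI) (simp add: H_seq ell2_seq_simps jacobi_def algebra_simps)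

lemma H_commute: "H z (H w x) = H w (H z x)"
  by (rule ell2_eqI) (simp add: H_seq jacobi_def algebra_simps)

lemma H_norm: "norm (H z x) \<le> (2 * A + B + cmod z) * norm x"
proof -
  have A: "A \<ge> 0" using a_bound[of 0] by linarith
  have 1: "norm (ell2_mult (\<lambda>n. of_real (a n)) (ell2_shift 1 x)) \<le> A * norm x"
    by (rule order_trans[OF norm_ell2_mult[of "\<lambda>n. of_real (a n)", OF a_bound']])
      (intro mult_left_mono norm_ell2_shift A)
  have 2: "norm (ell2_shift (-1) (ell2_mult (\<lambda>n. of_real (a n)) x)) \<le> A * norm x"
    by (rule order_trans[OF norm_ell2_shift norm_ell2_mult[of "\<lambda>n. of_real (a n)", OF a_bound']])
  have 3: "norm (ell2_mult (\<lambda>n. of_real (b n)) x) \<le> B * norm x"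
    by (rule norm_ell2_mult[of "\<lambda>n. of_real (b n)", OF b_bound'])
  have 4: "norm (cscale z x) \<le> cmod z * norm x" by simp
  show ?thesis
    unfolding H_def using 1 2 3 4
    by (smt (verit) norm_triangle_ineq norm_triangle_ineq4 distrib_right)
qed

lemma H_adjoint: "inner (H z x) y = inner x (H (cnj z) y)"
  unfolding H_def
  by (simp add: inner_add_left inner_add_right inner_diff_left inner_diff_right
      inner_ell2_mult[of "\<lambda>n. of_real (a n)", OF a_bound'] inner_ell2_mult[of "\<lambda>n. of_real (b n)", OF b_bound']
      inner_ell2_shift inner_cscale)

lemma H_adjoint_real: "inner (H (of_real s) x) y = inner x (H (of_real s) y)"
  using H_adjoint[of "of_real s"] by simp

section \<open>Normality, lower bounds and the resolvent set\<close>

lemma norm_H_cnj: "norm (H (cnj z) x) = norm (H z x)"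
proof -
  have "inner (H (cnj z) x) (H (cnj z) x) = inner (H z x) (H z x)"
    by (metis H_adjoint H_commute complex_cnj_cnj)
  then show ?thesis by (simp add: norm_eq_sqrt_inner)
qed

text \<open>A symmetric operator has a real quadratic form, so \<open>H s x\<close> is orthogonal,
  in the real inner product, to imaginary multiples of \<open>x\<close>.\<close>

lemma inner_H_imag: "inner (H (of_real s) x) (cscale (\<i> * of_real t) x) = 0"
proof -
  have "inner (H (of_real s) x) (cscale (\<i> * of_real t) x) = inner x (cscale (\<i> * of_real t) (H (of_real s) x))"
    by (simp add: H_adjoint_real H_cscale)
  also have "\<dots> = inner (cscale (- (\<i> * of_real t)) x) (H (of_real s) x)"
    by (simp add: inner_cscale)
  also have "cscale (- (\<i> * of_real t)) x = - cscale (\<i> * of_real t) x"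
    by (rule ell2_eqI) (simp add: ell2_seq_simps)
  finally show ?thesis by (simp add: inner_commute)
qed

text \<open>Pythagoras for the splitting of \<open>H z\<close> into its symmetric part at
  \<open>Re z\<close> and an imaginary multiple of the identity.\<close>

lemma norm_H_square: "(norm (H z x))\<^sup>2 = (norm (H (of_real (Re z)) x))\<^sup>2 + (Im z)\<^sup>2 * (norm x)\<^sup>2"
proof -
  have z: "H z x = H (of_real (Re z)) x - cscale (\<i> * of_real (Im z)) x"
  proof -
    have "z - of_real (Re z) = \<i> * of_real (Im z)" by (simp add: complex_eq_iff)
    then show ?thesis using H_shift_point[of z x "of_real (Re z)"] by metis
  qed
  show ?thesis
    using inner_H_imag[of "Re z" x "Im z"] dot_norm_neg[of "H (of_real (Re z)) x" "cscale (\<i> * of_real (Im z)) x"]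
    by (simp add: z norm_mult power_mult_distrib)
qed

lemma H_lower_imag: "\<bar>Im z\<bar> * norm x \<le> norm (H z x)"
  and H_lower_real: "norm (H (of_real (Re z)) x) \<le> norm (H z x)"
proof -
  have "(\<bar>Im z\<bar> * norm x)\<^sup>2 \<le> (norm (H z x))\<^sup>2"
    using norm_H_square[of z x] by (simp add: power_mult_distrib)
  then show "\<bar>Im z\<bar> * norm x \<le> norm (H z x)" by (rule power2_le_imp_le) simp
  have "(norm (H (of_real (Re z)) x))\<^sup>2 \<le> (norm (H z x))\<^sup>2"
    using norm_H_square[of z x] by simp
  then show "norm (H (of_real (Re z)) x) \<le> norm (H z x)" by (rule power2_le_imp_le) simp
qed

lemma H_weak:
  assumes "\<And>n. (\<lambda>k. ell2_seq (x k) n) \<longlonglongrightarrow> ell2_seq y n"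
  shows "(\<lambda>k. ell2_seq (H z (x k)) n) \<longlonglongrightarrow> ell2_seq (H z y) n"
  unfolding H_seq jacobi_def by (intro tendsto_intros assms)

text \<open>Bounded approximate solutions have a weak limit point, which solves the equation exactly
  because \<open>H\<close> acts locally. This takes the place of a completeness argument.\<close>

lemma H_solution_weak:
  assumes "\<And>k. norm (x k) \<le> C" "(\<lambda>k. norm (H z (x k) - p)) \<longlonglongrightarrow> 0"
  shows "\<exists>y. H z y = p"
proof -
  obtain r y where r: "strict_mono (r :: nat \<Rightarrow> nat)"
    "\<And>n. (\<lambda>k. ell2_seq (x (r k)) n) \<longlonglongrightarrow> ell2_seq y n"
    using ell2_weak_compact[of x C] assms(1) by metis
  have "ell2_seq (H z y) n = ell2_seq p n" for n
  proof (rule LIMSEQ_unique[OF H_weak[OF r(2)]])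
    have "(\<lambda>k. ell2_seq (H z (x (r k)) - p) n) \<longlonglongrightarrow> 0"
      by (rule tendsto_0_le[OF LIMSEQ_subseq_LIMSEQ[OF assms(2) r(1)], of _ 1])
        (simp add: o_def ell2_seq_le_norm)
    then have "(\<lambda>k. ell2_seq (H z (x (r k)) - p) n + ell2_seq p n) \<longlonglongrightarrow> 0 + ell2_seq p n"
      by (intro tendsto_intros)
    then show "(\<lambda>k. ell2_seq (H z (x (r k))) n) \<longlonglongrightarrow> ell2_seq p n"
      by (simp add: minus_ell2.rep_eq)
  qed
  then show ?thesis using ell2_eqI by blast
qed

text \<open>Richardson iteration for the positive operator H z H(cnj z), whose residuals decay geometrically.\<close>

lemma H_surj:
  assumes c: "c > 0" and lower: "\<And>x. c * norm x \<le> norm (H z x)"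
  shows "\<exists>y. H z y = p"
proof -
  define T where "T x = H z (H (cnj z) x)" for x
  \<comment> \<open>The summand \<open>c\<^sup>2\<close> is there to give
    \<open>c\<^sup>2 \<le> L\<close>, hence \<open>\<rho> \<ge> 0\<close> below.\<close>
  define L where "L = (2 * A + B + cmod z)\<^sup>2 + c\<^sup>2"
  have K: "2 * A + B + cmod z \<ge> 0"
    using a_bound[of 0] b_bound[of 0] norm_ge_zero[of z] by linarith
  have Tin: "inner (T x) x = (norm (H (cnj z) x))\<^sup>2" for x
    unfolding T_def H_adjoint[of z] by (simp add: power2_norm_eq_inner)
  have Tlow: "c\<^sup>2 * (norm x)\<^sup>2 \<le> inner (T x) x" for x
    unfolding Tin norm_H_cnj power_mult_distrib[symmetric]
    using lower[of x] c by (intro power_mono) auto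
  have Tup: "norm (T x) \<le> L * norm x" for x
  proof -
    have "norm (T x) \<le> (2 * A + B + cmod z) * norm (H (cnj z) x)"
      unfolding T_def by (rule H_norm)
    also have "\<dots> \<le> (2 * A + B + cmod z) * ((2 * A + B + cmod z) * norm x)"
      using H_norm[of "cnj z" x] K by (intro mult_left_mono) auto
    also have "\<dots> = (2 * A + B + cmod z)\<^sup>2 * norm x" by (simp add: power2_eq_square mult.assoc)
    also have "\<dots> \<le> L * norm x" by (intro mult_right_mono) (auto simp: L_def)
    finally show ?thesis .
  qed
  have L: "L > 0" "c\<^sup>2 \<le> L" using c by (auto simp: L_def add_nonneg_pos)
  \<comment> \<open>Minimises
    \<open>1 - 2 * \<tau> * c\<^sup>2 + \<tau>\<^sup>2 * L\<^sup>2\<close>, the factor in the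
    estimate of the squared residual; the minimum is \<open>\<rho>\<close>.\<close>
  define \<tau> where "\<tau> = c\<^sup>2 / L\<^sup>2"
  have tau: "\<tau> * L\<^sup>2 = c\<^sup>2" "\<tau> > 0" using L c by (auto simp: \<tau>_def)
  define x where "x = rec_nat 0 (\<lambda>_ y. y + \<tau> *\<^sub>R (p - T y))"
  have x: "x 0 = 0" "x (Suc k) = x k + \<tau> *\<^sub>R (p - T (x k))" for k by (auto simp: x_def)
  define r where "r k = p - T (x k)" for k
  have r: "r 0 = p" "r (Suc k) = r k - \<tau> *\<^sub>R T (r k)" for k
  proof -
    have "T 0 = 0" using Tup[of 0] by simp
    then show "r 0 = p" by (simp add: r_def x)
    show "r (Suc k) = r k - \<tau> *\<^sub>R T (r k)"
      by (simp add: r_def x T_def H_add H_scaleR)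
  qed
  define \<rho> where "\<rho> = 1 - \<tau> * c\<^sup>2"
  have rho: "0 \<le> \<rho>" "\<rho> < 1"
  proof -
    have "(c\<^sup>2)\<^sup>2 \<le> L\<^sup>2" using L by (intro power_mono) auto
    then show "0 \<le> \<rho>" using L by (simp add: \<rho>_def \<tau>_def field_simps power2_eq_square[of "c\<^sup>2"])
    show "\<rho> < 1" using tau c by (simp add: \<rho>_def)
  qed
  have step: "(norm (r (Suc k)))\<^sup>2 \<le> \<rho> * (norm (r k))\<^sup>2" for k
  proof -
    have "(norm (r (Suc k)))\<^sup>2 = (norm (r k))\<^sup>2 - 2 * \<tau> * inner (T (r k)) (r k) + \<tau>\<^sup>2 * (norm (T (r k)))\<^sup>2"
      unfolding r power2_norm_eq_inner
      by (simp add: inner_diff_left inner_diff_right inner_commute power2_eq_square algebra_simps)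
    also have "\<dots> \<le> (norm (r k))\<^sup>2 - 2 * \<tau> * (c\<^sup>2 * (norm (r k))\<^sup>2) + \<tau>\<^sup>2 * (L * norm (r k))\<^sup>2"
      using Tlow[of "r k"] Tup[of "r k"] tau
      by (intro add_mono diff_mono mult_left_mono power_mono) auto
    also have "\<tau>\<^sup>2 * (L * norm (r k))\<^sup>2 = \<tau> * c\<^sup>2 * (norm (r k))\<^sup>2"
      using tau(1) by (simp add: power2_eq_square algebra_simps)
    finally show ?thesis by (simp add: \<rho>_def algebra_simps)
  qed
  have rk: "(norm (r k))\<^sup>2 \<le> \<rho> ^ k * (norm p)\<^sup>2" for k
  proof (induction k)
    case (Suc k)
    then show ?case using step[of k] rho mult_left_mono[OF Suc rho(1)] by (simp add: mult.assoc)
  qed (simp add: r)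
  have r0: "(\<lambda>k. norm (r k)) \<longlonglongrightarrow> 0"
  proof -
    have "(\<lambda>k. \<rho> ^ k * (norm p)\<^sup>2) \<longlonglongrightarrow> 0"
      using rho by (intro tendsto_mult_left_zero LIMSEQ_power_zero) auto
    then have "(\<lambda>k. (norm (r k))\<^sup>2) \<longlonglongrightarrow> 0"
      by (rule Lim_null_comparison[rotated]) (use rk in auto)
    then show ?thesis using tendsto_real_sqrt[of _ 0] by force
  qed
  \<comment> \<open>A weak limit needs bounded approximants as well as small residuals; coercivity
    of \<open>T\<close> turns the bound on \<open>T (x k)\<close> into one on
    \<open>x k\<close>.\<close>
  have bounded: "norm (H (cnj z) (x k)) \<le> (2 * A + B + cmod z) * (2 * norm p / c\<^sup>2)" for k
  proof -
    have "norm (r k) \<le> norm p"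
    proof (rule power2_le_imp_le)
      show "(norm (r k))\<^sup>2 \<le> (norm p)\<^sup>2"
        using rk[of k] mult_right_mono[OF power_le_one[OF rho(1) less_imp_le[OF rho(2)], of k] zero_le_power2[of "norm p"]]
        by linarith
    qed auto
    then have "norm (T (x k)) \<le> 2 * norm p"
      using norm_triangle_ineq4[of p "r k"] by (simp add: r_def)
    moreover have "c\<^sup>2 * (norm (x k))\<^sup>2 \<le> norm (T (x k)) * norm (x k)"
      using Tlow[of "x k"] Cauchy_Schwarz_ineq2[of "T (x k)" "x k"] by linarith
    ultimately have "c\<^sup>2 * (norm (x k))\<^sup>2 \<le> 2 * norm p * norm (x k)"
      by (meson mult_right_mono norm_ge_zero order_trans)
    then have "c\<^sup>2 * norm (x k) \<le> 2 * norm p"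
      using mult_right_le_imp_le[of "c\<^sup>2 * norm (x k)" "norm (x k)" "2 * norm p"]
      by (cases "x k = 0") (auto simp: power2_eq_square mult.assoc)
    then have "norm (x k) \<le> 2 * norm p / c\<^sup>2" using c by (simp add: field_simps)
    then show ?thesis using H_norm[of "cnj z" "x k"] K
      by (smt (verit) complex_mod_cnj mult_left_mono)
  qed
  show ?thesis
  proof (rule H_solution_weak[of "\<lambda>k. H (cnj z) (x k)"])
    show "(\<lambda>k. norm (H z (H (cnj z) (x k)) - p)) \<longlonglongrightarrow> 0"
      using r0 by (simp add: r_def T_def norm_minus_commute)
  qed (rule bounded)
qed

text \<open>A lower bound gives injectivity and a bounded inverse; by normality
  \<open>H_surj\<close> draws surjectivity from the same bound.\<close>

lemma resolvent_iff:
  "in_resolvent_set (jacobi a b) z \<longleftrightarrow> (\<exists>c>0. \<forall>x. c * norm x \<le> norm (H z x))"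
proof
  assume "in_resolvent_set (jacobi a b) z"
  then obtain C where C: "\<And>\<phi>. \<phi> \<in> l2Z \<Longrightarrow> l2_norm \<phi> \<le> C * l2_norm (\<lambda>n. jacobi a b \<phi> n - z * \<phi> n)"
    unfolding in_resolvent_set_def by meson
  have "norm x \<le> C * norm (H z x)" for x
    using C[OF ell2_seq[of x]] unfolding seq_H[symmetric] l2_norm_ell2 .
  then have "norm x \<le> (\<bar>C\<bar> + 1) * norm (H z x)" for x
    by (smt (verit) mult_right_mono norm_ge_zero)
  then have "(1 / (\<bar>C\<bar> + 1)) * norm x \<le> norm (H z x)" for x
    by (simp add: field_simps add_pos_nonneg)
  then show "\<exists>c>0. \<forall>x. c * norm x \<le> norm (H z x)"
    by (intro exI[of _ "1 / (\<bar>C\<bar> + 1)"]) auto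
next
  assume "\<exists>c>0. \<forall>x. c * norm x \<le> norm (H z x)"
  then obtain c where c: "c > 0" "\<And>x. c * norm x \<le> norm (H z x)" by blast
  show "in_resolvent_set (jacobi a b) z"
    unfolding in_resolvent_set_def
  proof (intro conjI ballI exI[of _ "1 / c"])
    fix p assume p: "p \<in> l2Z"
    obtain y where y: "H z y = Abs_ell2 p" using H_surj[OF c] by blast
    show "\<exists>!\<phi>. \<phi> \<in> l2Z \<and> (\<lambda>n. jacobi a b \<phi> n - z * \<phi> n) = p"
    proof (rule ex1I[of _ "ell2_seq y"])
      show "ell2_seq y \<in> l2Z \<and> (\<lambda>n. jacobi a b (ell2_seq y) n - z * ell2_seq y n) = p"
        using y p by (simp add: seq_H[symmetric] Abs_ell2_inverse ell2_seq)
    next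
      fix \<phi> assume *: "\<phi> \<in> l2Z \<and> (\<lambda>n. jacobi a b \<phi> n - z * \<phi> n) = p"
      then have "ell2_seq (H z (Abs_ell2 \<phi>)) = p" by (simp add: seq_H Abs_ell2_inverse)
      then have "H z (Abs_ell2 \<phi> - y) = 0"
        using y ell2_seq_inverse[of "H z (Abs_ell2 \<phi>)"] by (simp add: H_diff)
      then have "Abs_ell2 \<phi> - y = 0" using c(2)[of "Abs_ell2 \<phi> - y"] c(1)
        by (simp add: mult_le_0_iff)
      then show "\<phi> = ell2_seq y" using * Abs_ell2_inverse[of \<phi>] by simp
    qed
  next
    fix \<phi> assume "\<phi> \<in> l2Z"
    then show "l2_norm \<phi> \<le> 1 / c * l2_norm (\<lambda>n. jacobi a b \<phi> n - z * \<phi> n)"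
      using c(2)[of "Abs_ell2 \<phi>"] c(1) l2_norm_ell2[of "H z (Abs_ell2 \<phi>)"] l2_norm_ell2[of "Abs_ell2 \<phi>"]
      by (simp add: seq_H Abs_ell2_inverse field_simps)
  qed
qed

abbreviation "spec \<equiv> real_spectrum (jacobi a b)"

lemma spec_iff: "s \<notin> spec \<longleftrightarrow> (\<exists>c>0. \<forall>x. c * norm x \<le> norm (H (of_real s) x))"
  by (simp add: real_spectrum_def op_spectrum_def resolvent_iff)

lemma H_perturb: "norm (H z x) \<ge> norm (H w x) - cmod (z - w) * norm x"
  unfolding H_shift_point[of z x w] using norm_triangle_ineq2[of "H w x" "cscale (z - w) x"] by simp

lemma spec_bounded: "s \<in> spec \<Longrightarrow> \<bar>s\<bar> \<le> 2 * A + B"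
proof (rule ccontr)
  assume s: "s \<in> spec" "\<not> \<bar>s\<bar> \<le> 2 * A + B"
  have "(\<bar>s\<bar> - (2 * A + B)) * norm x \<le> norm (H (of_real s) x)" for x
  proof -
    have "H (of_real s) x = H 0 x - cscale (of_real s) x"
      using H_shift_point[of "of_real s" x 0] by simp
    then have "norm (H (of_real s) x) \<ge> norm (cscale (of_real s) x) - norm (H 0 x)"
      by (metis norm_minus_commute norm_triangle_ineq2)
    then show ?thesis using H_norm[of 0 x] by (simp add: left_diff_distrib)
  qed
  then have "s \<notin> spec" unfolding spec_iff using s by (intro exI[of _ "\<bar>s\<bar> - (2 * A + B)"]) auto
  then show False using s by simp
qed

lemma compact_spec: "compact spec"
proof (rule compact_eq_bounded_closed[THEN iffD2], intro conjI)
  show "bounded spec" using spec_bounded by (intro boundedI) auto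
  have "open (- spec)"
    unfolding open_dist
  proof
    fix s assume "s \<in> - spec"
    then obtain c where c: "c > 0" "\<And>x. c * norm x \<le> norm (H (of_real s) x)"
      using spec_iff by blast
    show "\<exists>e>0. \<forall>t. dist t s < e \<longrightarrow> t \<in> - spec"
    proof (intro exI[of _ "c / 2"] conjI allI impI)
      fix t assume t: "dist t s < c / 2"
      have "c / 2 * norm x \<le> norm (H (of_real t) x)" for x
      proof -
        have "cmod (of_real t - of_real s) * norm x \<le> c / 2 * norm x"
          using t by (intro mult_right_mono) (auto simp: dist_real_def simp flip: of_real_diff)
        then show ?thesis using H_perturb[of "of_real s" x "of_real t"] c(2)[of x] by linarith
      qed
      then show "t \<in> - spec" using spec_iff c(1) by (metis ComplI half_gt_zero)
    qed (use c in auto)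
  qed
  then show "closed spec" by (simp add: closed_def)
qed

end

section \<open>Spectral measures and isolated points of the spectrum\<close>

text \<open>Positivity of the form tested at \<open>L x - Q x\<close>: for a positive operator
  bounded by \<open>L\<close>, the square of \<open>Q\<close> is at most \<open>L\<close> times
  \<open>Q\<close>.\<close>

lemma symmetric_form_bound:
  fixes Q :: "'a::real_inner \<Rightarrow> 'a"
  assumes add: "\<And>x y. Q (x + y) = Q x + Q y" and scale: "\<And>r x. Q (r *\<^sub>R x) = r *\<^sub>R Q x"
    and sym: "\<And>x y. inner (Q x) y = inner x (Q y)" and pos: "\<And>x. 0 \<le> inner (Q x) x"
    and bound: "\<And>x. norm (Q x) \<le> L * norm x" and L: "L > 0"
  shows "(norm (Q x))\<^sup>2 \<le> L * inner (Q x) x"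
proof -
  have "inner (Q (Q x)) (Q x) \<le> L * (norm (Q x))\<^sup>2"
    using norm_cauchy_schwarz[of "Q (Q x)" "Q x"] mult_right_mono[OF bound[of "Q x"] norm_ge_zero[of "Q x"]]
    by (simp add: power2_eq_square mult.assoc)
  moreover have "0 \<le> inner (Q (L *\<^sub>R x + (- 1) *\<^sub>R Q x)) (L *\<^sub>R x + (- 1) *\<^sub>R Q x)" by (rule pos)
  moreover have "inner (Q (L *\<^sub>R x + (- 1) *\<^sub>R Q x)) (L *\<^sub>R x + (- 1) *\<^sub>R Q x) =
      L\<^sup>2 * inner (Q x) x - 2 * L * (norm (Q x))\<^sup>2 + inner (Q (Q x)) (Q x)"
    unfolding add scale power2_norm_eq_inner using sym[of "Q x" x]
    by (simp add: inner_diff_left inner_diff_right power2_eq_square algebra_simps)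
  ultimately have "L * (norm (Q x))\<^sup>2 \<le> L * (L * inner (Q x) x)"
    by (simp add: power2_eq_square algebra_simps)
  then show ?thesis using L by simp
qed

text \<open>The best lower bound c of a symmetric operator is attained in the spectrum: otherwise
  \<open>B\<^sup>2 - c\<^sup>2\<close> would be positive and bounded below, and the bound could be improved.\<close>

lemma symmetric_lower_bound:
  fixes B :: "'a::real_inner \<Rightarrow> 'a"
  assumes add: "\<And>x y. B (x + y) = B x + B y" and scale: "\<And>r x. B (r *\<^sub>R x) = r *\<^sub>R B x"
    and sym: "\<And>x y. inner (B x) y = inner x (B y)"
    and bound: "\<And>x. norm (B x) \<le> K * norm x"
    and D: "D \<ge> 0"
    and gap: "\<And>c. 0 \<le> c \<Longrightarrow> c < D \<Longrightarrow> \<exists>k>0. \<forall>x. k * norm x \<le> norm (B (B x) - c\<^sup>2 *\<^sub>R x)"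
  shows "D * norm x \<le> norm (B x)"
proof -
  define C where "C = {c. 0 \<le> c \<and> c \<le> D \<and> (\<forall>x. c * norm x \<le> norm (B x))}"
  have C0: "0 \<in> C" using D by (simp add: C_def)
  have bdd: "bdd_above C" by (rule bdd_aboveI[of _ D]) (simp add: C_def)
  define c where "c = Sup C"
  have c0: "0 \<le> c" unfolding c_def by (rule cSup_upper[OF C0 bdd])
  have cD: "c \<le> D" unfolding c_def using C0 by (intro cSup_least) (auto simp: C_def)
  have cB: "c * norm x \<le> norm (B x)" for x
  proof (cases "x = 0")
    case False
    have "c \<le> norm (B x) / norm x"
      unfolding c_def using C0 False by (intro cSup_least) (auto simp: C_def field_simps)
    then show ?thesis using False by (simp add: field_simps)
  qed simp
  have "\<not> c < D"
  proof
    assume "c < D"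
    then obtain k where k: "k > 0" "\<And>x. k * norm x \<le> norm (B (B x) - c\<^sup>2 *\<^sub>R x)"
      using gap[OF c0] by blast
    \<comment> \<open>Dominates the norm of \<open>B\<^sup>2 - c\<^sup>2\<close>; the summand 1
      makes it positive.\<close>
    define L where "L = K\<^sup>2 + c\<^sup>2 + 1"
    have L: "L > 0" by (simp add: L_def add_nonneg_pos)
    have Qin: "inner (B (B x) - c\<^sup>2 *\<^sub>R x) x = (norm (B x))\<^sup>2 - c\<^sup>2 * (norm x)\<^sup>2" for x
      by (simp add: inner_diff_left sym[of "B x"] power2_norm_eq_inner)
    have Q: "(norm (B (B x) - c\<^sup>2 *\<^sub>R x))\<^sup>2 \<le> L * ((norm (B x))\<^sup>2 - c\<^sup>2 * (norm x)\<^sup>2)" for x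
      unfolding Qin[symmetric]
    proof (rule symmetric_form_bound[where Q = "\<lambda>x. B (B x) - c\<^sup>2 *\<^sub>R x"])
      show "norm (B (B x) - c\<^sup>2 *\<^sub>R x) \<le> L * norm x" for x
      proof (cases "x = 0")
        case True
        have "B 0 = 0" using bound[of 0] by simp
        then show ?thesis using True by simp
      next
        case False
        have "0 \<le> K * norm x" using bound[of x] norm_ge_zero[of "B x"] by linarith
        then have "K \<ge> 0" using False by (simp add: zero_le_mult_iff)
        then have "norm (B (B x)) \<le> K * (K * norm x)"
          using bound[of "B x"] mult_left_mono[OF bound[of x], of K] by linarith
        moreover have "norm (B (B x) - c\<^sup>2 *\<^sub>R x) \<le> norm (B (B x)) + c\<^sup>2 * norm x"
          using norm_triangle_ineq4[of "B (B x)" "c\<^sup>2 *\<^sub>R x"] by simp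
        ultimately have "norm (B (B x) - c\<^sup>2 *\<^sub>R x) \<le> K * (K * norm x) + c\<^sup>2 * norm x + norm x"
          using norm_ge_zero[of x] by linarith
        then show ?thesis
          by (simp add: L_def power2_eq_square distrib_right)
      qed
      show "0 \<le> inner (B (B x) - c\<^sup>2 *\<^sub>R x) x" for x
        unfolding Qin using power_mono[OF cB[of x], of 2] c0 by (simp add: power_mult_distrib)
    qed (simp_all add: add scale sym inner_diff_left inner_diff_right algebra_simps L)
    \<comment> \<open>The improved constant: \<open>k\<^sup>2 * (norm x)\<^sup>2\<close> is at most
      \<open>L\<close> times
      \<open>(norm (B x))\<^sup>2 - c\<^sup>2 * (norm x)\<^sup>2\<close>.\<close>
    define c' where "c' = min D (sqrt (c\<^sup>2 + k\<^sup>2 / L))"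
    have "c = sqrt (c\<^sup>2)" using c0 by simp
    also have "\<dots> < sqrt (c\<^sup>2 + k\<^sup>2 / L)" using k L by (intro real_sqrt_less_mono) simp
    finally have "c < c'" using \<open>c < D\<close> by (simp add: c'_def)
    have "c' * norm x \<le> norm (B x)" for x
    proof -
      have "k\<^sup>2 * (norm x)\<^sup>2 \<le> L * ((norm (B x))\<^sup>2 - c\<^sup>2 * (norm x)\<^sup>2)"
        using power_mono[OF k(2)[of x], of 2] k(1) Q[of x] by (simp add: power_mult_distrib)
      then have "(c\<^sup>2 + k\<^sup>2 / L) * (norm x)\<^sup>2 \<le> (norm (B x))\<^sup>2" using L by (simp add: field_simps)
      then have "sqrt (c\<^sup>2 + k\<^sup>2 / L) * norm x \<le> norm (B x)"
        using L power2_le_imp_le[OF _ norm_ge_zero, of "sqrt (c\<^sup>2 + k\<^sup>2 / L) * norm x" "B x"]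
        by (simp add: power_mult_distrib)
      then show ?thesis
        using mult_right_mono[of c' "sqrt (c\<^sup>2 + k\<^sup>2 / L)" "norm x"] by (simp add: c'_def)
    qed
    moreover have "0 \<le> c'" "c' \<le> D" using \<open>c < c'\<close> c0 by (simp, simp add: c'_def)
    ultimately have "c' \<in> C" by (simp add: C_def)
    then have "c' \<le> c" unfolding c_def using bdd by (rule cSup_upper)
    then show False using \<open>c < c'\<close> by simp
  qed
  then show ?thesis using cB cD by simp
qed

section \<open>Spectral measures seen through resolvent vectors\<close>

lemma Im_l2_inner: "Im (l2_inner (ell2_seq x) (ell2_seq y)) = inner (cscale \<i> x) y"
proof -
  have e: "cnj u * v = of_real (inner u v) + \<i> * of_real (inner (\<i> * u) v)" for u v :: complex
    by (simp add: complex_eq_iff inner_complex_def)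
  have "(\<lambda>n. cnj (ell2_seq x n) * ell2_seq y n) summable_on UNIV"
    unfolding e
    by (intro summable_on_add summable_on_cmult_right summable_on_of_real
        l2Z_inner_summable[OF ell2_seq ell2_seq, of "cscale \<i> x" y, unfolded ell2_seq_cscale]
        l2Z_inner_summable ell2_seq)
  then have "Im (l2_inner (ell2_seq x) (ell2_seq y)) = (\<Sum>\<^sub>\<infinity>n. Im (cnj (ell2_seq x n) * ell2_seq y n))"
    unfolding l2_inner_def by (rule infsum_Im[symmetric])
  then show ?thesis by (simp add: inner_ell2_def ell2_seq_cscale inner_complex_def algebra_simps)
qed

context bounded_jacobi
begin

text \<open>The imaginary part of the resolvent form at \<open>p\<close>, by symmetry of the real
  part of \<open>H z\<close>. It converts integrals against spectral measures into norms of
  \<open>y\<close>.\<close>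

lemma Im_resolvent:
  assumes "H z y = p"
  shows "inner (cscale \<i> p) y = Im z * (norm y)\<^sup>2"
proof -
  have z: "p = H (of_real (Re z)) y - cscale (\<i> * of_real (Im z)) y"
  proof -
    have "z - of_real (Re z) = \<i> * of_real (Im z)" by (simp add: complex_eq_iff)
    then show ?thesis using H_shift_point[of z y "of_real (Re z)"] assms by metis
  qed
  have 1: "cscale \<i> p = H (of_real (Re z)) (cscale \<i> y) + Im z *\<^sub>R y"
    unfolding z
    by (rule ell2_eqI) (simp add: ell2_seq_simps H_seq jacobi_def scaleR_conv_of_real algebra_simps)
  have "inner (H (of_real (Re z)) (cscale \<i> y)) y = 0"
    using inner_H_imag[of "Re z" y 1] unfolding H_adjoint_real[of _ "cscale \<i> y" y] by (simp add: inner_commute)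
  then show ?thesis unfolding 1 by (simp add: inner_add_left power2_norm_eq_inner)
qed

lemma resolvent_exists: "Im z \<noteq> 0 \<Longrightarrow> \<exists>y. H z y = p"
  using H_surj[of "\<bar>Im z\<bar>" z] H_lower_imag by simp

text \<open>The imaginary part of the Cauchy kernel at \<open>t + i e\<close> is the Poisson kernel,
  which is at least \<open>1 / (2 * e)\<close> on the interval and has integral
  \<open>e * (norm y)\<^sup>2\<close>.\<close>

lemma spectral_measure_interval:
  assumes mu: "is_spectral_measure (jacobi a b) (ell2_seq p) \<mu>"
    and e: "e > 0" and y: "H (Complex t e) y = p"
  shows "measure \<mu> {t - e..t + e} \<le> 2 * e\<^sup>2 * (norm y)\<^sup>2"
proof -
  interpret finite_measure \<mu> using mu by (simp add: is_spectral_measure_def)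
  have [measurable_cong, simp]: "sets \<mu> = sets borel" using mu by (simp add: is_spectral_measure_def)
  have sp: "space \<mu> = UNIV" using sets_eq_imp_space_eq[of \<mu> borel] by simp
  define g where "g x = 1 / (complex_of_real x - Complex t e)" for x
  have Img: "Im (g x) = e / ((x - t)\<^sup>2 + e\<^sup>2)" for x
    by (simp add: g_def Im_divide power2_eq_square)
  have "cmod (g x) \<le> 1 / e" for x
  proof -
    have "e \<le> cmod (complex_of_real x - Complex t e)"
      using abs_Im_le_cmod[of "complex_of_real x - Complex t e"] e by simp
    then show ?thesis using e by (simp add: g_def norm_divide frac_le)
  qed
  moreover have "g \<in> borel_measurable \<mu>" unfolding g_def by measurable
  ultimately have ig: "integrable \<mu> g" by (intro integrable_const_bound[of _ "1 / e"]) auto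
  have "l2_inner (ell2_seq p) (ell2_seq y) = (\<integral>x. g x \<partial>\<mu>)"
    using mu y e ell2_seq[of y] seq_H[of "Complex t e" y, symmetric]
    by (auto simp: is_spectral_measure_def g_def)
  then have "Im (\<integral>x. g x \<partial>\<mu>) = e * (norm y)\<^sup>2"
    using Im_l2_inner[of p y] Im_resolvent[OF y] by simp
  then have I: "(\<integral>x. Im (g x) \<partial>\<mu>) = e * (norm y)\<^sup>2" using ig by simp
  have "measure \<mu> {t - e..t + e} * (1 / (2 * e)) = (\<integral>x. indicator {t - e..t + e} x * (1 / (2 * e)) \<partial>\<mu>)"
    by (simp add: sp)
  also have "\<dots> \<le> (\<integral>x. Im (g x) \<partial>\<mu>)"
  proof (rule integral_mono)
    show "indicator {t - e..t + e} x * (1 / (2 * e)) \<le> Im (g x)" for x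
    proof (cases "x \<in> {t - e..t + e}")
      case True
      then have "\<bar>x - t\<bar> \<le> \<bar>e\<bar>" by auto
      then have "(x - t)\<^sup>2 \<le> e\<^sup>2" by (rule abs_le_square_iff[THEN iffD1])
      then have "e / (2 * e\<^sup>2) \<le> e / ((x - t)\<^sup>2 + e\<^sup>2)"
        using e by (intro divide_left_mono) (auto intro!: mult_pos_pos add_nonneg_pos)
      then show ?thesis using True e by (simp add: Img power2_eq_square)
    qed (use e in \<open>simp add: Img\<close>)
    show "integrable \<mu> (\<lambda>x. indicator {t - e..t + e} x * (1 / (2 * e)))"
      by (intro integrable_mult_left integrable_real_indicator) (auto simp: emeasure_eq_measure)
    show "integrable \<mu> (\<lambda>x. Im (g x))" using ig by simp
  qed
  finally show ?thesis using I e by (simp add: field_simps power2_eq_square)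
qed

text \<open>Near a resolvent point the vectors \<open>y\<close> stay bounded up to the real axis, so
  an interval of half-length \<open>e\<close> has measure of order \<open>e\<^sup>2\<close>.
  Covering a fixed interval takes about \<open>1 / e\<close> of them, and the total tends to
  0.\<close>

lemma spectral_measure_null_near:
  assumes mu: "is_spectral_measure (jacobi a b) (ell2_seq p) \<mu>" and s: "s \<notin> spec"
  shows "\<exists>d>0. emeasure \<mu> {s - d<..<s + d} = 0"
proof -
  interpret finite_measure \<mu> using mu by (simp add: is_spectral_measure_def)
  have [measurable_cong, simp]: "sets \<mu> = sets borel" using mu by (simp add: is_spectral_measure_def)
  obtain c where c: "c > 0" "\<And>x. c * norm x \<le> norm (H (of_real s) x)" using s spec_iff by blast
  define d where "d = c / 2"
  have d: "d > 0" using c by (simp add: d_def)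
  define K where "K = 2 * (norm p / d)\<^sup>2"
  have small: "measure \<mu> {t - e..t + e} \<le> K * e\<^sup>2" if t: "\<bar>t - s\<bar> \<le> d" and e: "e > 0" for t e
  proof -
    obtain y where y: "H (Complex t e) y = p" using resolvent_exists[of "Complex t e"] e by auto
    have "cmod (of_real t - of_real s) * norm y \<le> d * norm y"
      using t by (intro mult_right_mono) (auto simp flip: of_real_diff)
    then have "d * norm y \<le> norm (H (of_real t) y)"
      using H_perturb[of "of_real s" y "of_real t"] c(2)[of y] by (simp add: d_def)
    also have "\<dots> \<le> norm p" using H_lower_real[of "Complex t e" y] y by simp
    finally have "norm y \<le> norm p / d" using d by (simp add: field_simps)
    then have "2 * e\<^sup>2 * (norm y)\<^sup>2 \<le> 2 * e\<^sup>2 * (norm p / d)\<^sup>2"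
      by (intro mult_left_mono power_mono) auto
    then show ?thesis using spectral_measure_interval[OF mu e y] by (simp add: K_def algebra_simps)
  qed
  have bound: "measure \<mu> {s - d<..<s + d} \<le> K * d\<^sup>2 * inverse (real (Suc n))" for n
  proof -
    define N where "N = real (Suc n)"
    define e where "e = d / N"
    have N: "N > 0" by (simp add: N_def)
    have e: "e > 0" "N * e = d" using d N by (auto simp: e_def)
    \<comment> \<open>Midpoints of \<open>Suc n\<close> adjacent intervals of half-length
      \<open>e\<close> that tile the interval around \<open>s\<close>.\<close>
    define t where "t j = s - d + (2 * real j + 1) * e" for j :: nat
    have "{s - d<..<s + d} \<subseteq> (\<Union>j<Suc n. {t j - e..t j + e})"
    proof
      fix x assume x: "x \<in> {s - d<..<s + d}"
      define j where "j = nat \<lfloor>(x - (s - d)) / (2 * e)\<rfloor>"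
      have "(x - (s - d)) / (2 * e) \<ge> 0" using x e by simp
      then have j: "real j \<le> (x - (s - d)) / (2 * e)" "(x - (s - d)) / (2 * e) < real j + 1"
        unfolding j_def by linarith+
      have "(x - (s - d)) / (2 * e) < N" using x e by (simp add: field_simps)
      then have "real j < N" using j by linarith
      then have "j < Suc n" by (simp add: N_def)
      moreover have "x \<in> {t j - e..t j + e}" using j e by (auto simp: t_def field_simps)
      ultimately show "x \<in> (\<Union>j<Suc n. {t j - e..t j + e})" by blast
    qed
    then have "measure \<mu> {s - d<..<s + d} \<le> measure \<mu> (\<Union>j<Suc n. {t j - e..t j + e})"
      by (intro finite_measure_mono) auto
    also have "\<dots> \<le> (\<Sum>j<Suc n. measure \<mu> {t j - e..t j + e})"
      by (intro measure_UNION_le) auto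
    also have "\<dots> \<le> (\<Sum>j<Suc n. K * e\<^sup>2)"
    proof (intro sum_mono small)
      fix j assume j: "j \<in> {..<Suc n}"
      have "(2 * real j + 1) * e \<le> 2 * N * e"
        using j e by (intro mult_right_mono) (auto simp: N_def)
      moreover have "0 \<le> (2 * real j + 1) * e" using e by simp
      ultimately show "\<bar>t j - s\<bar> \<le> d" using e(2) by (simp add: t_def abs_le_iff)
    qed (rule e)
    also have "\<dots> = K * d\<^sup>2 * inverse N"
      using N by (simp add: e_def field_simps power2_eq_square del: of_nat_Suc flip: N_def)
    finally show ?thesis by (simp add: N_def)
  qed
  have "(\<lambda>n. K * d\<^sup>2 * inverse (real (Suc n))) \<longlonglongrightarrow> K * d\<^sup>2 * 0"
    by (intro tendsto_intros LIMSEQ_inverse_real_of_nat)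
  then have "measure \<mu> {s - d<..<s + d} \<le> K * d\<^sup>2 * 0"
    by (rule LIMSEQ_le_const) (use bound in blast)
  then have "measure \<mu> {s - d<..<s + d} = 0"
    using measure_nonneg[of \<mu> "{s - d<..<s + d}"] by linarith
  then show ?thesis using d by (intro exI[of _ d]) (simp add: emeasure_eq_measure)
qed

lemma spectral_measure_supported:
  assumes mu: "is_spectral_measure (jacobi a b) (ell2_seq p) \<mu>"
  shows "emeasure \<mu> (UNIV - spec) = 0"
proof -
  have [measurable_cong, simp]: "sets \<mu> = sets borel" using mu by (simp add: is_spectral_measure_def)
  define F where "F = {U. open U \<and> emeasure \<mu> U = 0}"
  obtain F' where F': "F' \<subseteq> F" "countable F'" "\<Union>F' = \<Union>F"
    by (rule Lindelof[of F]) (auto simp: F_def)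
  have "(\<Union>U\<in>F'. U) \<in> null_sets \<mu>"
    using F' by (intro null_sets_UN') (auto simp: F_def null_sets_def)
  moreover have "UNIV - spec \<subseteq> \<Union>F"
  proof
    fix s assume "s \<in> UNIV - spec"
    then obtain d where "d > 0" "emeasure \<mu> {s - d<..<s + d} = 0"
      using spectral_measure_null_near[OF mu] by blast
    then show "s \<in> \<Union>F" by (intro UnionI[of "{s - d<..<s + d}"]) (auto simp: F_def)
  qed
  moreover have "UNIV - spec \<in> sets \<mu>" using compact_imp_closed[OF compact_spec] by simp
  ultimately have "UNIV - spec \<in> null_sets \<mu>"
    using F'(3) null_sets_subset[of "\<Union>F'" \<mu> "UNIV - spec"] by simp
  then show ?thesis by auto
qed

text \<open>The vectors \<open>e k * y k\<close> are bounded and their weak limits lie in the kernel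
  at \<open>s\<close>, hence vanish. \<open>Im_resolvent\<close> equates their squared norms with
  inner products against the fixed vector \<open>cscale \<i> p\<close>, so weak convergence already
  forces norm convergence.\<close>

lemma resolvent_no_eigenvalue:
  assumes ker: "\<And>x. H (of_real s) x = 0 \<Longrightarrow> x = 0"
  obtains e y where "\<And>k::nat. e k > 0" "\<And>k. H (Complex s (e k)) (y k) = p"
    "(\<lambda>k. e k * norm (y k)) \<longlonglongrightarrow> 0"
proof -
  define e where "e k = inverse (real (Suc k))" for k
  have e: "e k > 0" for k by (simp add: e_def)
  have e0: "e \<longlonglongrightarrow> 0" unfolding e_def by (rule LIMSEQ_inverse_real_of_nat)
  have "\<forall>k. \<exists>y. H (Complex s (e k)) y = p" using resolvent_exists e by (metis complex.sel(2) less_irrefl)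
  then obtain y where y: "\<And>k. H (Complex s (e k)) (y k) = p" by metis
  define x where "x k = e k *\<^sub>R y k" for k
  have xb: "norm (x k) \<le> norm p" for k
    using H_lower_imag[of "Complex s (e k)" "y k"] e[of k] y by (simp add: x_def)
  obtain r w where r: "strict_mono (r :: nat \<Rightarrow> nat)" "\<And>n. (\<lambda>k. ell2_seq (x (r k)) n) \<longlonglongrightarrow> ell2_seq w n"
    using ell2_weak_compact[of x "norm p"] xb by metis
  have er: "(\<lambda>k. e (r k)) \<longlonglongrightarrow> 0" using LIMSEQ_subseq_LIMSEQ[OF e0 r(1)] by (simp add: o_def)
  \<comment> \<open>The resolvent equation multiplied by \<open>e k\<close>: the right side tends to
    0 in each coordinate, so every weak limit is in the kernel.\<close>
  have Hx: "ell2_seq (H (of_real s) (x k)) n = of_real (e k) * (ell2_seq p n + \<i> * ell2_seq (x k) n)" for k n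
  proof -
    have "Complex s (e k) = of_real s + \<i> * of_real (e k)" by (simp add: complex_eq_iff)
    then have "ell2_seq p n = ell2_seq (H (of_real s) (y k)) n - \<i> * of_real (e k) * ell2_seq (y k) n"
      using arg_cong[OF y[of k], of "\<lambda>v. ell2_seq v n"] by (simp add: H_seq algebra_simps)
    then show ?thesis
      unfolding x_def H_scaleR ell2_seq_simps scaleR_conv_of_real by (simp add: algebra_simps)
  qed
  have "ell2_seq (H (of_real s) w) n = 0" for n
  proof (rule LIMSEQ_unique[OF H_weak[OF r(2)]])
    have "(\<lambda>k. of_real (e (r k)) * (ell2_seq p n + \<i> * ell2_seq (x (r k)) n)) \<longlonglongrightarrow>
        of_real 0 * (ell2_seq p n + \<i> * ell2_seq w n)"
      by (intro tendsto_intros er r)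
    then show "(\<lambda>k. ell2_seq (H (of_real s) (x (r k))) n) \<longlonglongrightarrow> 0" by (simp add: Hx)
  qed
  then have "w = 0" using ker by (metis ell2_eqI zero_ell2.rep_eq)
  then have "(\<lambda>k. inner (cscale \<i> p) (x (r k))) \<longlonglongrightarrow> 0"
    using ell2_weak_null[of "\<lambda>k. x (r k)" "norm p" "cscale \<i> p"] xb r(2) by (simp add: zero_ell2.rep_eq)
  moreover have "inner (cscale \<i> p) (x k) = (e k * norm (y k))\<^sup>2" for k
    using Im_resolvent[OF y[of k]] by (simp add: x_def power2_eq_square)
  ultimately have "(\<lambda>k. (e (r k) * norm (y (r k)))\<^sup>2) \<longlonglongrightarrow> 0" by simp
  then have "(\<lambda>k. sqrt ((e (r k) * norm (y (r k)))\<^sup>2)) \<longlonglongrightarrow> 0"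
    using tendsto_real_sqrt[of "\<lambda>k. (e (r k) * norm (y (r k)))\<^sup>2" 0] by simp
  moreover have "sqrt ((e k * norm (y k))\<^sup>2) = e k * norm (y k)" for k
    using e[of k] by simp
  ultimately have "(\<lambda>k. e (r k) * norm (y (r k))) \<longlonglongrightarrow> 0" by simp
  then show thesis using that[of "\<lambda>k. e (r k)" "\<lambda>k. y (r k)"] e y by blast
qed

lemma spectral_measure_no_atom:
  assumes mu: "is_spectral_measure (jacobi a b) (ell2_seq p) \<mu>"
    and ker: "\<And>x. H (of_real s) x = 0 \<Longrightarrow> x = 0"
  shows "emeasure \<mu> {s} = 0"
proof -
  interpret finite_measure \<mu> using mu by (simp add: is_spectral_measure_def)
  have [measurable_cong, simp]: "sets \<mu> = sets borel" using mu by (simp add: is_spectral_measure_def)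
  obtain e y where e: "\<And>k::nat. e k > 0" "\<And>k. H (Complex s (e k)) (y k) = p"
    "(\<lambda>k. e k * norm (y k)) \<longlonglongrightarrow> 0"
    using resolvent_no_eigenvalue[OF ker] by blast
  have "measure \<mu> {s} \<le> 2 * (e k * norm (y k))\<^sup>2" for k
  proof -
    have "measure \<mu> {s} \<le> measure \<mu> {s - e k..s + e k}"
      using e(1)[of k] by (intro finite_measure_mono) auto
    then show ?thesis
      using spectral_measure_interval[OF mu e(1,2)[of k]] by (simp add: power_mult_distrib)
  qed
  moreover have "(\<lambda>k. 2 * (e k * norm (y k))\<^sup>2) \<longlonglongrightarrow> 2 * 0\<^sup>2" by (intro tendsto_intros e)
  ultimately have "measure \<mu> {s} \<le> 2 * 0\<^sup>2" by (intro LIMSEQ_le_const[of _ _ "measure \<mu> {s}"]) blast+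
  then show ?thesis by (simp add: emeasure_eq_measure measure_le_0_iff)
qed

text \<open>An isolated point would have to be an eigenvalue. If the rest of the spectrum keeps
  distance \<open>d\<close> from \<open>s\<close>, the operator \<open>S\<close> is bounded below by
  \<open>d\<close> on its range; without a kernel the range is dense, so the bound holds everywhere
  and \<open>s\<close> leaves the spectrum.\<close>

lemma spec_islimpt:
  assumes ker: "\<And>x. H (of_real s) x = 0 \<Longrightarrow> x = 0" and s: "s \<in> spec"
  shows "s islimpt spec"
proof (rule ccontr)
  assume "\<not> s islimpt spec"
  then obtain d where d: "d > 0" "\<And>t. t \<in> spec \<Longrightarrow> t \<noteq> s \<Longrightarrow> d \<le> dist t s"
    unfolding islimpt_approachable by force
  define S where "S = H (of_real s)"
  \<comment> \<open>Centred at the midpoint of the gap between 0 and \<open>d\<^sup>2\<close> in the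
    spectrum of \<open>S\<^sup>2\<close>, so that the expected lower bound for \<open>Q\<close> is
    half the length of the gap.\<close>
  define Q where "Q x = S (S x) - (d\<^sup>2 / 2) *\<^sub>R x" for x
  have low: "\<exists>c>0. \<forall>x. c * norm x \<le> norm (S x - t *\<^sub>R x)" if "0 < \<bar>t\<bar>" "\<bar>t\<bar> < d" for t
  proof -
    have "s + t \<notin> spec" using d(2)[of "s + t"] that by (auto simp: dist_real_def)
    moreover have "H (of_real (s + t)) x = S x - t *\<^sub>R x" for x
      unfolding S_def by (rule ell2_eqI) (simp add: H_seq ell2_seq_simps scaleR_conv_of_real algebra_simps)
    ultimately show ?thesis using spec_iff by metis
  qed
  have factor: "S (S x) - t\<^sup>2 *\<^sub>R x = S (S x - (- t) *\<^sub>R x) - t *\<^sub>R (S x - (- t) *\<^sub>R x)" for t x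
    unfolding S_def by (simp add: H_diff H_scaleR H_add power2_eq_square algebra_simps)
  have low2: "\<exists>k>0. \<forall>x. k * norm x \<le> norm (S (S x) - u *\<^sub>R x)" if u: "0 < u" "u < d\<^sup>2" for u
  proof -
    define t where "t = sqrt u"
    have t: "0 < t" "t < d" "t\<^sup>2 = u" using u d real_sqrt_less_mono[OF u(2)] by (auto simp: t_def)
    obtain k l where k: "k > 0" "\<And>x. k * norm x \<le> norm (S x - t *\<^sub>R x)"
      and l: "l > 0" "\<And>x. l * norm x \<le> norm (S x - (- t) *\<^sub>R x)"
      using low[of t] low[of "- t"] t by auto
    have "k * l * norm x \<le> norm (S (S x) - u *\<^sub>R x)" for x
      unfolding t(3)[symmetric] factor
      using k(2)[of "S x - (- t) *\<^sub>R x"] mult_left_mono[OF l(2)[of x], of k] k(1)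
      by (simp only: mult.assoc) linarith
    then show ?thesis using k(1) l(1) by (intro exI[of _ "k * l"]) auto
  qed
  define K where "K = 2 * A + B + \<bar>s\<bar>"
  have K: "K \<ge> 0" using a_bound[of 0] b_bound[of 0] by (simp add: K_def)
  have S: "S (x + y) = S x + S y" "S (x - y) = S x - S y" "S (r *\<^sub>R x) = r *\<^sub>R S x"
    "inner (S x) y = inner x (S y)" "norm (S x) \<le> K * norm x" for x y r
    using H_norm[of "of_real s" x]
    by (simp_all add: S_def H_add H_diff H_scaleR H_adjoint_real K_def)
  have Q: "d\<^sup>2 / 2 * norm x \<le> norm (Q x)" for x
  proof (rule symmetric_lower_bound)
    show "Q (x + y) = Q x + Q y" "Q (r *\<^sub>R x) = r *\<^sub>R Q x" "inner (Q x) y = inner x (Q y)" for x y r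
      by (simp_all add: Q_def S algebra_simps inner_diff_left inner_diff_right)
    show "norm (Q x) \<le> (K * K + d\<^sup>2 / 2) * norm x" for x
    proof -
      have "norm (S (S x)) \<le> K * (K * norm x)"
        using S(5)[of "S x"] mult_left_mono[OF S(5)[of x] K] by linarith
      then show ?thesis using norm_triangle_ineq4[of "S (S x)" "(d\<^sup>2 / 2) *\<^sub>R x"]
        by (simp add: Q_def distrib_right)
    qed
    show "\<exists>k>0. \<forall>x. k * norm x \<le> norm (Q (Q x) - c\<^sup>2 *\<^sub>R x)" if c: "0 \<le> c" "c < d\<^sup>2 / 2" for c
    proof -
      \<comment> \<open>With these, \<open>Q\<^sup>2 - c\<^sup>2\<close> factors as
        \<open>S\<^sup>2 - u\<close> times \<open>S\<^sup>2 - v\<close>, and both roots lie in the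
        gap.\<close>
      define u v where "u = d\<^sup>2 / 2 + c" and "v = d\<^sup>2 / 2 - c"
      have uv: "0 < u" "u < d\<^sup>2" "0 < v" "v < d\<^sup>2" using c d by (auto simp: u_def v_def)
      obtain k l where k: "k > 0" "\<And>x. k * norm x \<le> norm (S (S x) - u *\<^sub>R x)"
        and l: "l > 0" "\<And>x. l * norm x \<le> norm (S (S x) - v *\<^sub>R x)"
        using low2[of u] low2[of v] uv by auto
      have "k * l * norm x \<le> norm (Q (Q x) - c\<^sup>2 *\<^sub>R x)" for x
      proof -
        have "Q (Q x) - c\<^sup>2 *\<^sub>R x = S (S (S (S x) - v *\<^sub>R x)) - u *\<^sub>R (S (S x) - v *\<^sub>R x)"
          by (simp add: Q_def S u_def v_def power2_eq_square algebra_simps)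
        then show ?thesis
          using k(2)[of "S (S x) - v *\<^sub>R x"] mult_left_mono[OF l(2)[of x], of k] k(1)
          by (simp only: mult.assoc) linarith
      qed
      then show ?thesis using k(1) l(1) by (intro exI[of _ "k * l"]) auto
    qed
  qed simp
  have SS: "d * norm (S x) \<le> norm (S (S x))" for x
  proof (rule power2_le_imp_le)
    have 1: "inner (S (S x)) x = (norm (S x))\<^sup>2"
      using S(4)[of "S x" x] by (simp add: dot_square_norm)
    \<comment> \<open>Once the square is expanded, the terms in \<open>norm x\<close> cancel and
      leave a comparison of \<open>S (S x)\<close> with \<open>S x\<close>.\<close>
    have "(d\<^sup>2 / 2 * norm x)\<^sup>2 \<le> (norm (Q x))\<^sup>2" using Q[of x] by (rule power_mono) simp
    also have "\<dots> = (norm (S (S x)))\<^sup>2 - d\<^sup>2 * (norm (S x))\<^sup>2 + (d\<^sup>2 / 2 * norm x)\<^sup>2"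
      unfolding Q_def power2_norm_eq_inner inner_diff_left inner_diff_right
      using 1 by (simp add: inner_commute[of x "S (S x)"] power_mult_distrib dot_square_norm power2_eq_square)
    finally show "(d * norm (S x))\<^sup>2 \<le> (norm (S (S x)))\<^sup>2" by (simp add: power_mult_distrib)
  qed simp
  \<comment> \<open>Every \<open>p\<close> equals \<open>S (y k)\<close> up to the vector
    \<open>w\<close>, whose norm \<open>e k * norm (y k)\<close> tends to 0.\<close>
  have "d * norm p \<le> norm (S p)" for p
  proof -
    obtain e y where e: "\<And>k::nat. e k > 0" "\<And>k. H (Complex s (e k)) (y k) = p"
      "(\<lambda>k. e k * norm (y k)) \<longlonglongrightarrow> 0"
      using resolvent_no_eigenvalue[OF ker] by blast
    have bound: "d * (norm p - e k * norm (y k)) - K * (e k * norm (y k)) \<le> norm (S p)" for k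
    proof -
      define w where "w = cscale (\<i> * of_real (e k)) (y k)"
      have w: "norm w = e k * norm (y k)" using e(1)[of k] by (simp add: w_def norm_mult)
      have "p = S (y k) - w"
      proof -
        have "Complex s (e k) - of_real s = \<i> * of_real (e k)" by (simp add: complex_eq_iff)
        then show ?thesis
          unfolding w_def S_def using H_shift_point[of "Complex s (e k)" "y k" "of_real s"] e(2)[of k] by metis
      qed
      then have Sy: "S (y k) = p + w" by simp
      have "S p = S (S (y k)) - S w" by (simp add: Sy S)
      then have "norm (S (S (y k))) - norm (S w) \<le> norm (S p)" by (simp add: norm_triangle_ineq2)
      moreover have "d * (norm p - norm w) \<le> d * norm (S (y k))"
        unfolding Sy using d norm_diff_ineq[of p w] by simp
      ultimately show ?thesis using SS[of "y k"] S(5)[of w] unfolding w by linarith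
    qed
    have "(\<lambda>k. d * (norm p - e k * norm (y k)) - K * (e k * norm (y k))) \<longlonglongrightarrow> d * (norm p - 0) - K * 0"
      by (intro tendsto_intros e)
    then have "d * (norm p - 0) - K * 0 \<le> norm (S p)"
      by (rule LIMSEQ_le_const2) (use bound in blast)
    then show ?thesis by simp
  qed
  then have "s \<notin> spec" using spec_iff d(1) S_def by blast
  then show False using s by simp
qed

end

section \<open>Transfer matrices and bands of periodic operators\<close>

datatype mat2 = M2 (e11: real) (e12: real) (e21: real) (e22: real)

lemma mat2_eq_iff: "M = N \<longleftrightarrow> e11 M = e11 N \<and> e12 M = e12 N \<and> e21 M = e21 N \<and> e22 M = e22 N"
  by (cases M; cases N) simp

instantiation mat2 :: ring_1
begin

definition "0 = M2 0 0 0 0"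
definition "1 = M2 1 0 0 1"
definition "M + N = M2 (e11 M + e11 N) (e12 M + e12 N) (e21 M + e21 N) (e22 M + e22 N)"
definition "M - N = M2 (e11 M - e11 N) (e12 M - e12 N) (e21 M - e21 N) (e22 M - e22 N)"
definition "- M = M2 (- e11 M) (- e12 M) (- e21 M) (- e22 M)"
definition "M * N = M2 (e11 M * e11 N + e12 M * e21 N) (e11 M * e12 N + e12 M * e22 N)
  (e21 M * e11 N + e22 M * e21 N) (e21 M * e12 N + e22 M * e22 N)"

instance
  by standard (simp_all add: zero_mat2_def one_mat2_def plus_mat2_def minus_mat2_def uminus_mat2_def
      times_mat2_def mat2_eq_iff algebra_simps)

end

lemma mat2_sel [simp]:
  "e11 (0::mat2) = 0" "e12 (0::mat2) = 0" "e21 (0::mat2) = 0" "e22 (0::mat2) = 0"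
  "e11 (1::mat2) = 1" "e12 (1::mat2) = 0" "e21 (1::mat2) = 0" "e22 (1::mat2) = 1"
  "e11 (M + N) = e11 M + e11 N" "e12 (M + N) = e12 M + e12 N"
  "e21 (M + N) = e21 M + e21 N" "e22 (M + N) = e22 M + e22 N"
  "e11 (M - N) = e11 M - e11 N" "e12 (M - N) = e12 M - e12 N"
  "e21 (M - N) = e21 M - e21 N" "e22 (M - N) = e22 M - e22 N"
  "e11 (- M) = - e11 M" "e12 (- M) = - e12 M" "e21 (- M) = - e21 M" "e22 (- M) = - e22 M"
  "e11 (M * N) = e11 M * e11 N + e12 M * e21 N" "e12 (M * N) = e11 M * e12 N + e12 M * e22 N"
  "e21 (M * N) = e21 M * e11 N + e22 M * e21 N" "e22 (M * N) = e21 M * e12 N + e22 M * e22 N"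
  by (simp_all add: zero_mat2_def one_mat2_def plus_mat2_def minus_mat2_def uminus_mat2_def times_mat2_def)

definition tr2 :: "mat2 \<Rightarrow> real" where "tr2 M = e11 M + e22 M"
definition det2 :: "mat2 \<Rightarrow> real" where "det2 M = e11 M * e22 M - e12 M * e21 M"
definition norm2 :: "mat2 \<Rightarrow> real" where "norm2 M = \<bar>e11 M\<bar> + \<bar>e12 M\<bar> + \<bar>e21 M\<bar> + \<bar>e22 M\<bar>"
definition adj2 :: "mat2 \<Rightarrow> mat2" where "adj2 M = M2 (e22 M) (- e12 M) (- e21 M) (e11 M)"

lemma tr2_commute: "tr2 (M * N) = tr2 (N * M)"
  by (simp add: tr2_def algebra_simps)

lemma tr2_linear: "tr2 (M + N) = tr2 M + tr2 N" "tr2 (- M) = - tr2 M" "tr2 0 = 0" "tr2 1 = 2"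
  by (simp_all add: tr2_def)

lemma tr2_sum: "tr2 (\<Sum>i\<in>I. f i) = (\<Sum>i\<in>I. tr2 (f i))"
  by (induction I rule: infinite_finite_induct) (simp_all add: tr2_linear)

lemma det2_mult: "det2 (M * N) = det2 M * det2 N"
  by (simp add: det2_def algebra_simps)

lemma det2_one [simp]: "det2 1 = 1"
  by (simp add: det2_def)

lemma adj2_mult: "det2 M = 1 \<Longrightarrow> adj2 M * M = 1" "det2 M = 1 \<Longrightarrow> M * adj2 M = 1"
  by (simp_all add: mat2_eq_iff adj2_def det2_def algebra_simps)

lemma norm2_mult: "norm2 (M * N) \<le> norm2 M * norm2 N"
proof -
  have "\<bar>x * y + z * w\<bar> \<le> \<bar>x\<bar> * \<bar>y\<bar> + \<bar>z\<bar> * \<bar>w\<bar>" for x y z w :: real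
    using abs_triangle_ineq[of "x * y" "z * w"] by (simp add: abs_mult)
  then have "norm2 (M * N) \<le>
      (\<bar>e11 M\<bar> * \<bar>e11 N\<bar> + \<bar>e12 M\<bar> * \<bar>e21 N\<bar>) + (\<bar>e11 M\<bar> * \<bar>e12 N\<bar> + \<bar>e12 M\<bar> * \<bar>e22 N\<bar>)
      + (\<bar>e21 M\<bar> * \<bar>e11 N\<bar> + \<bar>e22 M\<bar> * \<bar>e21 N\<bar>) + (\<bar>e21 M\<bar> * \<bar>e12 N\<bar> + \<bar>e22 M\<bar> * \<bar>e22 N\<bar>)"
    unfolding norm2_def mat2_sel by (intro add_mono)
  also have "\<dots> \<le> norm2 M * norm2 N"
  proof -
    have "norm2 M * norm2 N - ((\<bar>e11 M\<bar> * \<bar>e11 N\<bar> + \<bar>e12 M\<bar> * \<bar>e21 N\<bar>) + (\<bar>e11 M\<bar> * \<bar>e12 N\<bar> + \<bar>e12 M\<bar> * \<bar>e22 N\<bar>)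
      + (\<bar>e21 M\<bar> * \<bar>e11 N\<bar> + \<bar>e22 M\<bar> * \<bar>e21 N\<bar>) + (\<bar>e21 M\<bar> * \<bar>e12 N\<bar> + \<bar>e22 M\<bar> * \<bar>e22 N\<bar>)) =
      (\<bar>e11 M\<bar> + \<bar>e21 M\<bar>) * (\<bar>e21 N\<bar> + \<bar>e22 N\<bar>) + (\<bar>e12 M\<bar> + \<bar>e22 M\<bar>) * (\<bar>e11 N\<bar> + \<bar>e12 N\<bar>)"
      by (simp add: norm2_def algebra_simps)
    moreover have "\<dots> \<ge> 0" by (intro add_nonneg_nonneg mult_nonneg_nonneg) auto
    ultimately show ?thesis by linarith
  qed
  finally show ?thesis .
qed

text \<open>The quadratic form \<open>\<omega>(v, M v)\<close>, with \<open>\<omega>\<close> the determinant, has discriminant given by the trace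
  of \<open>M\<close> and is transported by conjugation.\<close>

lemma conjugacy_trace_bound:
  assumes "det2 M = 1" "det2 M' = 1" "det2 P = 1" "M' * P = P * M"
  shows "(4 - (tr2 M)\<^sup>2) * (tr2 P)\<^sup>2 \<le> 8 * ((\<bar>e12 M\<bar> + \<bar>e21 M\<bar>) * (\<bar>e12 M'\<bar> + \<bar>e21 M'\<bar>))"
proof (cases "(tr2 M)\<^sup>2 \<le> 4")
  case False
  then show ?thesis
    by (intro order.trans[OF mult_nonpos_nonneg mult_nonneg_nonneg]) auto
next
  case True
  obtain \<alpha> \<beta> \<gamma> \<delta> where M': "M' = M2 \<alpha> \<beta> \<gamma> \<delta>" by (cases M')
  obtain p q r s where P: "P = M2 p q r s" by (cases P)
  have M: "M = adj2 P * M' * P"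
  proof -
    have "adj2 P * M' * P = (adj2 P * P) * M" by (simp only: mult.assoc assms(4))
    then show ?thesis using adj2_mult(1)[OF assms(3)] by simp
  qed
  have dP: "p * s - q * r = 1" using assms(3) by (simp add: det2_def P)
  have dM: "\<alpha> * \<delta> - \<beta> * \<gamma> = 1" using assms(2) by (simp add: det2_def M')
  define Q where "Q x y = \<gamma> * x\<^sup>2 + (\<delta> - \<alpha>) * x * y - \<beta> * y\<^sup>2" for x y
  \<comment> \<open>The form of \<open>M\<close> at the unit vectors is the form of
    \<open>M'\<close> at the columns of \<open>P\<close>.\<close>
  have Q1: "e21 M = Q p r" and Q2: "- e12 M = Q q s"
    unfolding M by (simp_all add: adj2_def M' P Q_def power2_eq_square algebra_simps)
  have "tr2 M = tr2 (M' * (P * adj2 P))"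
    unfolding M mult.assoc[of "adj2 P"] by (subst tr2_commute) (simp add: mult.assoc)
  then have tr: "tr2 M = \<alpha> + \<delta>" using adj2_mult(2)[OF assms(3)] by (simp add: tr2_def M')
  define S where "S = (4 - (tr2 M)\<^sup>2) / 4"
  have S: "S = - \<beta> * \<gamma> - ((\<delta> - \<alpha>) / 2)\<^sup>2"
    using dM by (simp add: S_def tr power2_eq_square field_simps)
  \<comment> \<open>Cayley-Hamilton for the symmetric matrix of \<open>Q\<close>, with trace
    \<open>\<gamma> - \<beta>\<close> and determinant \<open>S\<close>: trace times form minus
    determinant times squared length is the squared length of the image vector.\<close>
  have QS: "(\<gamma> - \<beta>) * Q x y \<ge> S * (x\<^sup>2 + y\<^sup>2)" for x y
  proof -
    have "(\<gamma> - \<beta>) * Q x y - S * (x\<^sup>2 + y\<^sup>2) =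
        (\<gamma> * x + (\<delta> - \<alpha>) / 2 * y)\<^sup>2 + ((\<delta> - \<alpha>) / 2 * x - \<beta> * y)\<^sup>2"
      unfolding S Q_def by (simp add: power2_eq_square field_simps)
    then show ?thesis by (smt (verit) zero_le_power2)
  qed
  have "(\<gamma> - \<beta>) * (e21 M - e12 M) = (\<gamma> - \<beta>) * Q p r + (\<gamma> - \<beta>) * Q q s"
    unfolding Q1 Q2[symmetric] by (simp add: algebra_simps)
  then have "S * ((p\<^sup>2 + r\<^sup>2) + (q\<^sup>2 + s\<^sup>2)) \<le> (\<gamma> - \<beta>) * (e21 M - e12 M)"
    using add_mono[OF QS[of p r] QS[of q s]] by (simp only: distrib_left)
  also have "\<dots> \<le> \<bar>\<gamma> - \<beta>\<bar> * \<bar>e21 M - e12 M\<bar>"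
    by (simp flip: abs_mult)
  also have "\<dots> \<le> (\<bar>e12 M'\<bar> + \<bar>e21 M'\<bar>) * (\<bar>e12 M\<bar> + \<bar>e21 M\<bar>)"
    by (intro mult_mono) (auto simp: M')
  finally have *: "S * ((p\<^sup>2 + r\<^sup>2) + (q\<^sup>2 + s\<^sup>2)) \<le> (\<bar>e12 M'\<bar> + \<bar>e21 M'\<bar>) * (\<bar>e12 M\<bar> + \<bar>e21 M\<bar>)" .
  have "(tr2 P)\<^sup>2 \<le> 2 * ((p\<^sup>2 + r\<^sup>2) + (q\<^sup>2 + s\<^sup>2))"
  proof -
    have "2 * ((p\<^sup>2 + r\<^sup>2) + (q\<^sup>2 + s\<^sup>2)) - (tr2 P)\<^sup>2 = (p - s)\<^sup>2 + 2 * q\<^sup>2 + 2 * r\<^sup>2"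
      by (simp add: tr2_def P power2_eq_square algebra_simps)
    also have "\<dots> \<ge> 0" by simp
    finally show ?thesis by simp
  qed
  then have "S * (tr2 P)\<^sup>2 \<le> S * (2 * ((p\<^sup>2 + r\<^sup>2) + (q\<^sup>2 + s\<^sup>2)))"
    using True by (intro mult_left_mono) (auto simp: S_def)
  then have "S * (tr2 P)\<^sup>2 \<le> 2 * ((\<bar>e12 M\<bar> + \<bar>e21 M\<bar>) * (\<bar>e12 M'\<bar> + \<bar>e21 M'\<bar>))"
    using * unfolding mult.left_commute[of S 2] mult.commute[of "\<bar>e12 M\<bar> + \<bar>e21 M\<bar>"] by linarith
  then show ?thesis by (simp add: S_def)
qed

definition mat2_deriv :: "(real \<Rightarrow> mat2) \<Rightarrow> mat2 \<Rightarrow> real \<Rightarrow> bool" where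
  "mat2_deriv F F' x \<longleftrightarrow>
    ((\<lambda>t. e11 (F t)) has_real_derivative e11 F') (at x) \<and> ((\<lambda>t. e12 (F t)) has_real_derivative e12 F') (at x) \<and>
    ((\<lambda>t. e21 (F t)) has_real_derivative e21 F') (at x) \<and> ((\<lambda>t. e22 (F t)) has_real_derivative e22 F') (at x)"

lemma mat2_deriv_mult:
  assumes "mat2_deriv F F' x" "mat2_deriv G G' x"
  shows "mat2_deriv (\<lambda>t. F t * G t) (F' * G x + F x * G') x"
  using assms unfolding mat2_deriv_def mat2_sel
  by (auto intro!: derivative_eq_intros)

section \<open>Periodic sequences and transfer matrices\<close>

definition per :: "nat \<Rightarrow> (int \<Rightarrow> real) \<Rightarrow> bool" where
  "per q f \<longleftrightarrow> (\<forall>n. f (n + int q) = f n)"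

lemma per_mult: "per q f \<Longrightarrow> f (n + int q * k) = f n"
proof (induction k rule: int_induct[of _ 0])
  case (step1 i)
  then have "f (n + int q * i + int q) = f n" by (simp add: per_def)
  then show ?case by (simp add: algebra_simps)
next
  case (step2 i)
  have "f (n + int q * (i - 1) + int q) = f (n + int q * (i - 1))"
    using step2 by (simp add: per_def del: add.assoc)
  then show ?case using step2 by (simp add: algebra_simps)
qed simp

lemma per_dvd: "per q f \<Longrightarrow> q dvd q' \<Longrightarrow> per q' f"
  unfolding per_def[of q'] by (auto simp: per_mult)

lemma per_bounded:
  assumes "per q f" "q > 0"
  shows "\<exists>C. \<forall>n. \<bar>f n\<bar> \<le> C"
proof (intro exI allI)
  fix n
  have "f n = f (n mod int q)" using per_mult[OF assms(1), of "n mod int q" "n div int q"] by simp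
  also have "\<bar>f (n mod int q)\<bar> \<le> (\<Sum>j\<in>{0..<int q}. \<bar>f j\<bar>)"
    using assms(2) by (intro member_le_sum) auto
  finally show "\<bar>f n\<bar> \<le> (\<Sum>j\<in>{0..<int q}. \<bar>f j\<bar>)" .
qed

locale jacobi_weights =
  fixes a :: "int \<Rightarrow> real"
  assumes a_pos: "\<And>n. a n > 0"
begin

text \<open>Acts on the pairs \<open>(u n, a (n - 1) * u (n - 1))\<close>; carrying the weight in
  the second component makes the determinant 1.\<close>

definition step_mat :: "(int \<Rightarrow> real) \<Rightarrow> real \<Rightarrow> int \<Rightarrow> mat2" where
  "step_mat b E n = M2 ((E - b n) / a n) (- 1 / a n) (a n) 0"

primrec transfer :: "(int \<Rightarrow> real) \<Rightarrow> real \<Rightarrow> int \<Rightarrow> nat \<Rightarrow> mat2" where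
  "transfer b E m 0 = 1"
| "transfer b E m (Suc k) = step_mat b E (m + int k) * transfer b E m k"

text \<open>When \<open>q\<close> is a period of \<open>a\<close> and \<open>b\<close>, this is the
  Floquet discriminant.\<close>

definition disc :: "(int \<Rightarrow> real) \<Rightarrow> nat \<Rightarrow> real \<Rightarrow> real" where
  "disc b q E = tr2 (transfer b E 0 q)"

lemma det_step_mat: "det2 (step_mat b E n) = 1"
  using a_pos[of n] by (simp add: step_mat_def det2_def)

lemma det_transfer: "det2 (transfer b E m k) = 1"
  by (induction k) (simp_all add: det2_mult det_step_mat)

lemma transfer_add: "transfer b E m (j + k) = transfer b E (m + int j) k * transfer b E m j"
  by (induction k) (simp_all add: mult.assoc add.assoc)

lemma transfer_cong: "(\<And>i. i < k \<Longrightarrow> a (m' + int i) = a (m + int i) \<and> b' (m' + int i) = b (m + int i)) \<Longrightarrow>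
    transfer b' E m' k = transfer b E m k"
  by (induction k) (simp_all add: step_mat_def)

lemma transfer_per:
  assumes "per q a" "per q b"
  shows "transfer b E (m + int q * i) k = transfer b E m k"
proof (rule transfer_cong)
  fix j
  have e: "m + int q * i + int j = m + int j + int q * i" by simp
  show "a (m + int q * i + int j) = a (m + int j) \<and> b (m + int q * i + int j) = b (m + int j)"
    unfolding e using per_mult[OF assms(1), of "m + int j" i] per_mult[OF assms(2), of "m + int j" i] by blast
qed

lemma transfer_power:
  assumes "per q a" "per q b"
  shows "transfer b E m (k * q) = transfer b E m q ^ k"
proof (induction k)
  case (Suc k)
  have "transfer b E m (Suc k * q) = transfer b E (m + int q * 1) (k * q) * transfer b E m q"
    using transfer_add[of b E m q "k * q"] by (simp add: add.commute)
  also have "\<dots> = transfer b E m q ^ k * transfer b E m q"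
    unfolding transfer_per[OF assms] Suc ..
  finally show ?case by (simp add: power_commutes)
qed simp

lemma monodromy_conj:
  assumes "per q a" "per q b"
  shows "transfer b E (m + int k) q * transfer b E m k = transfer b E m k * transfer b E m q"
proof -
  have "transfer b E (m + int k) q * transfer b E m k = transfer b E m (q + k)"
    by (simp add: transfer_add[symmetric] add.commute)
  also have "\<dots> = transfer b E (m + int q * 1) k * transfer b E m q" by (simp add: transfer_add)
  finally show ?thesis unfolding transfer_per[OF assms] .
qed

section \<open>The discriminant and its derivative on the bands\<close>

lemma disc_monodromy:
  assumes "per q a" "per q b"
  shows "tr2 (transfer b E m q) = disc b q E"
proof -
  have *: "tr2 (transfer b E (m + int k) q) = tr2 (transfer b E m q)" for m k
  proof -
    have "transfer b E (m + int k) q = transfer b E m k * transfer b E m q * adj2 (transfer b E m k)"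
      by (simp add: monodromy_conj[OF assms, symmetric] mult.assoc adj2_mult(2)[OF det_transfer])
    then have "tr2 (transfer b E (m + int k) q) = tr2 (adj2 (transfer b E m k) * (transfer b E m k * transfer b E m q))"
      by (simp add: tr2_commute)
    then show ?thesis using adj2_mult(1)[OF det_transfer] by (simp add: mult.assoc[symmetric])
  qed
  show ?thesis
  proof (cases "m \<ge> 0")
    case True
    then show ?thesis using *[of 0 "nat m"] by (simp add: disc_def)
  next
    case False
    then show ?thesis using *[of m "nat (- m)"] by (simp add: disc_def)
  qed
qed

text \<open>One entry of the conjugation by a single step. It reduces estimates of both off-diagonal
  entries to the upper right one.\<close>

lemma e21_monodromy_Suc:
  assumes "per q a" "per q b"
  shows "e21 (transfer b E (m + 1) q) = - (a m)\<^sup>2 * e12 (transfer b E m q)"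
proof -
  have c: "transfer b E (m + 1) q * step_mat b E m = step_mat b E m * transfer b E m q"
    using monodromy_conj[OF assms, of E m 1] by simp
  from arg_cong[OF c, of e22] have "e21 (transfer b E (m + 1) q) * (- 1 / a m) = a m * e12 (transfer b E m q)"
    by (simp add: step_mat_def)
  then show ?thesis using a_pos[of m] by (simp add: field_simps power2_eq_square)
qed

text \<open>Inside a band the product of the diagonal entries is at most a quarter of the squared
  trace, hence below 1, and determinant 1 makes the off-diagonal product negative.\<close>

lemma elliptic_e12_e21:
  assumes "per q a" "per q b" "\<bar>disc b q E\<bar> < 2"
  shows "e12 (transfer b E m q) * e21 (transfer b E m q) < 0"
proof -
  have d: "e11 (transfer b E m q) * e22 (transfer b E m q) - e12 (transfer b E m q) * e21 (transfer b E m q) = 1"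
    using det_transfer[of b E m q] by (simp add: det2_def)
  have "(e11 (transfer b E m q) + e22 (transfer b E m q))\<^sup>2 < 2\<^sup>2"
    using disc_monodromy[OF assms(1,2), of E m] assms(3)
    by (intro power2_strict_mono) (auto simp: tr2_def)
  then have "4 * (e11 (transfer b E m q) * e22 (transfer b E m q)) < 4"
    using zero_le_power2[of "e11 (transfer b E m q) - e22 (transfer b E m q)"] by (simp add: power2_sum power2_diff)
  then show ?thesis using d by linarith
qed

text \<open>Excludes cancellation in \<open>disc'\<close>: combined with
  \<open>e21_monodromy_Suc\<close>, the negative product at the next site makes neighbouring
  \<open>e12\<close> entries agree in sign.\<close>

lemma elliptic_e12_sign:
  assumes "per q a" "per q b" "\<bar>disc b q E\<bar> < 2"
  shows "e12 (transfer b E (int k) q) * e12 (transfer b E 0 q) > 0"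
proof (induction k)
  case 0
  show ?case using elliptic_e12_e21[OF assms, of 0] by (auto simp: mult_less_0_iff zero_less_mult_iff)
next
  case (Suc k)
  have "e12 (transfer b E (int k + 1) q) * e12 (transfer b E (int k) q) > 0"
    using elliptic_e12_e21[OF assms, of "int k + 1"] a_pos[of "int k"]
    unfolding e21_monodromy_Suc[OF assms(1,2)]
    by (auto simp: mult_less_0_iff zero_less_mult_iff)
  then show ?case using Suc by (auto simp: zero_less_mult_iff add.commute)
qed

lemma step_mat_deriv: "mat2_deriv (\<lambda>E. step_mat b E n) (- (step_mat b E n * M2 0 0 1 0)) E"
  unfolding mat2_deriv_def step_mat_def mat2.sel mat2_sel
  using a_pos[of n] by (auto intro!: derivative_eq_intros)

lemma transfer_deriv:
  "mat2_deriv (\<lambda>E. transfer b E m k) (- (\<Sum>j<k. transfer b E (m + int j) (k - j) * M2 0 0 1 0 * transfer b E m j)) E"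
proof (induction k)
  case 0
  show ?case by (simp add: mat2_deriv_def)
next
  case (Suc k)
  have *: "step_mat b E (m + int k) * transfer b E (m + int j) (k - j) = transfer b E (m + int j) (Suc k - j)" if "j < k" for j
    using that by (simp add: Suc_diff_le add.assoc)
  have eq: "- (step_mat b E (m + int k) * M2 0 0 1 0) * transfer b E m k
      + step_mat b E (m + int k) * - (\<Sum>j<k. transfer b E (m + int j) (k - j) * M2 0 0 1 0 * transfer b E m j) =
      - (\<Sum>j<Suc k. transfer b E (m + int j) (Suc k - j) * M2 0 0 1 0 * transfer b E m j)"
    by (simp add: sum_distrib_left mult.assoc[symmetric] * cong: sum.cong_simp)
  show ?case unfolding transfer.simps(2) eq[symmetric] by (rule mat2_deriv_mult[OF step_mat_deriv Suc])
qed

definition disc' :: "(int \<Rightarrow> real) \<Rightarrow> nat \<Rightarrow> real \<Rightarrow> real" where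
  "disc' b q E = - (\<Sum>j<q. e12 (transfer b E (int j) q))"

text \<open>Each Leibniz term of the derivative has a rank-one factor between two transfer matrices;
  cyclicity of the trace joins these into a monodromy matrix and picks out its \<open>e12\<close>
  entry.\<close>

lemma disc_deriv:
  assumes "per q a" "per q b"
  shows "(disc b q has_real_derivative disc' b q E) (at E)"
proof -
  have *: "tr2 (transfer b E (int j) (q - j) * M2 0 0 1 0 * transfer b E 0 j) = e12 (transfer b E (int j) q)" if "j < q" for j
  proof -
    have "transfer b E 0 j = transfer b E (int j + int (q - j)) j"
      using transfer_per[OF assms, of E 0 1 j] that by simp
    then have p: "transfer b E 0 j * transfer b E (int j) (q - j) = transfer b E (int j) q"
      using that transfer_add[of b E "int j" "q - j" j] by simp
    have "tr2 (transfer b E (int j) (q - j) * M2 0 0 1 0 * transfer b E 0 j) =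
        tr2 ((transfer b E 0 j * transfer b E (int j) (q - j)) * M2 0 0 1 0)"
      by (subst tr2_commute) (simp only: mult.assoc)
    then show ?thesis unfolding p by (simp add: tr2_def)
  qed
  have "((\<lambda>E. tr2 (transfer b E 0 q)) has_real_derivative
      tr2 (- (\<Sum>j<q. transfer b E (0 + int j) (q - j) * M2 0 0 1 0 * transfer b E 0 j))) (at E)"
    using transfer_deriv[of b 0 q E] unfolding mat2_deriv_def tr2_def by (intro DERIV_add) auto
  then show ?thesis by (simp add: disc_def[abs_def] disc'_def tr2_linear tr2_sum *)
qed

lemma elliptic_e12_le:
  assumes "per q a" "per q b" "\<bar>disc b q E\<bar> < 2" "q > 0"
  shows "\<bar>e12 (transfer b E m q)\<bar> \<le> \<bar>disc' b q E\<bar>"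
proof -
  define s where "s = sgn (e12 (transfer b E 0 q))"
  have abs: "\<bar>e12 (transfer b E (int k) q)\<bar> = s * e12 (transfer b E (int k) q)" for k
    using elliptic_e12_sign[OF assms(1-3), of k] by (auto simp: s_def sgn_if zero_less_mult_iff)
  define k where "k = nat (m mod int q)"
  have k: "k < q" "int k = m mod int q" using assms(4) by (auto simp: k_def nat_less_iff)
  have "transfer b E m q = transfer b E (m mod int q + int q * (m div int q)) q" by simp
  then have "\<bar>e12 (transfer b E m q)\<bar> = \<bar>e12 (transfer b E (int k) q)\<bar>" unfolding transfer_per[OF assms(1,2)] k(2) by simp
  also have "\<dots> \<le> (\<Sum>j<q. \<bar>e12 (transfer b E (int j) q)\<bar>)"
    using k by (intro member_le_sum) auto
  also have "\<dots> = s * (\<Sum>j<q. e12 (transfer b E (int j) q))" by (simp add: abs sum_distrib_left)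
  also have "\<dots> \<le> \<bar>disc' b q E\<bar>" by (auto simp: disc'_def s_def sgn_if)
  finally show ?thesis .
qed

text \<open>\<open>conjugacy_trace_bound\<close> with the transfer matrix over \<open>k\<close>
  sites as conjugator: one large trace anywhere makes \<open>disc'\<close> large compared with
  \<open>sqrt (4 - disc\<^sup>2)\<close>. The factor \<open>1 + A\<^sup>2\<close> pays for replacing
  \<open>e21\<close> by \<open>e12\<close>.\<close>

lemma disc'_lower:
  assumes "per q a" "per q b" "\<bar>disc b q E\<bar> < 2" "q > 0" and A: "\<And>n. a n \<le> A"
  shows "(4 - (disc b q E)\<^sup>2) * (tr2 (transfer b E m k))\<^sup>2 \<le> 8 * ((1 + A\<^sup>2) * disc' b q E)\<^sup>2"
proof -
  have bd: "\<bar>e12 (transfer b E m q)\<bar> + \<bar>e21 (transfer b E m q)\<bar> \<le> (1 + A\<^sup>2) * \<bar>disc' b q E\<bar>" for m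
  proof -
    have "\<bar>e21 (transfer b E m q)\<bar> = (a (m - 1))\<^sup>2 * \<bar>e12 (transfer b E (m - 1) q)\<bar>"
      using e21_monodromy_Suc[OF assms(1,2), of E "m - 1"] by (simp add: abs_mult)
    also have "\<dots> \<le> A\<^sup>2 * \<bar>disc' b q E\<bar>"
      using A[of "m - 1"] a_pos[of "m - 1"] elliptic_e12_le[OF assms(1-4)]
      by (intro mult_mono power_mono) auto
    finally show ?thesis using elliptic_e12_le[OF assms(1-4), of m] by (simp add: distrib_right)
  qed
  have "(4 - (tr2 (transfer b E m q))\<^sup>2) * (tr2 (transfer b E m k))\<^sup>2 \<le> 8 * ((\<bar>e12 (transfer b E m q)\<bar> + \<bar>e21 (transfer b E m q)\<bar>)
      * (\<bar>e12 (transfer b E (m + int k) q)\<bar> + \<bar>e21 (transfer b E (m + int k) q)\<bar>))"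
    by (rule conjugacy_trace_bound[OF det_transfer det_transfer det_transfer monodromy_conj[OF assms(1,2)]])
  also have "\<dots> \<le> 8 * (((1 + A\<^sup>2) * \<bar>disc' b q E\<bar>) * ((1 + A\<^sup>2) * \<bar>disc' b q E\<bar>))"
    by (intro mult_left_mono mult_mono bd) auto
  also have "\<dots> = 8 * ((1 + A\<^sup>2) * disc' b q E)\<^sup>2"
    by (simp add: power2_eq_square abs_mult_self_eq mult.left_commute mult.assoc)
  finally show ?thesis unfolding disc_monodromy[OF assms(1,2)] .
qed

text \<open>Only the \<open>e11\<close> entry reaches degree \<open>k\<close>, so the trace over
  \<open>q > 0\<close> sites has degree exactly \<open>q\<close>, which limits the number of band
  edges. For \<open>k = 0\<close> the matrix is the identity, hence the guard on
  \<open>p22\<close>.\<close>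

lemma transfer_poly:
  "\<exists>p11 p12 p21 p22. (\<forall>E. transfer b E m k = M2 (poly p11 E) (poly p12 E) (poly p21 E) (poly p22 E)) \<and>
     degree p11 \<le> k \<and> degree p12 \<le> k \<and> degree p21 \<le> k \<and> degree p22 \<le> k \<and>
     coeff p11 k \<noteq> 0 \<and> coeff p12 k = 0 \<and> (k > 0 \<longrightarrow> coeff p22 k = 0)"
proof (induction k)
  case 0
  show ?case
    by (rule exI[of _ 1], rule exI[of _ 0], rule exI[of _ 0], rule exI[of _ 1]) (simp add: mat2_eq_iff)
next
  case (Suc k)
  then obtain p11 p12 p21 p22 where p: "\<And>E. transfer b E m k = M2 (poly p11 E) (poly p12 E) (poly p21 E) (poly p22 E)"
    and d: "degree p11 \<le> k" "degree p12 \<le> k" "degree p21 \<le> k" "degree p22 \<le> k"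
    and c: "coeff p11 k \<noteq> 0" "coeff p12 k = 0" by blast
  define n where "n = m + int k"
  define x where "x = [: - b n / a n, 1 / a n :]"
  have x: "poly x E = (E - b n) / a n" for E by (simp add: x_def diff_divide_distrib)
  have cx: "coeff (x * p) (Suc k) = coeff p k / a n" if "degree p \<le> k" for p
    using that by (simp add: x_def coeff_eq_0)
  have dx: "degree (x * p) \<le> Suc k" if "degree p \<le> k" for p
    using that degree_mult_le[of x p] by (simp add: x_def split: if_splits)
  have cs: "coeff p (Suc k) = 0" if "degree p \<le> k" for p :: "real poly"
    using that by (simp add: coeff_eq_0)
  have ds: "degree (smult r p) \<le> Suc k" if "degree p \<le> k" for p and r :: real
    using that degree_smult_le[of r p] by linarith
  show ?case
  proof (intro exI conjI allI impI)
    show "transfer b E m (Suc k) = M2 (poly (x * p11 - smult (1 / a n) p21) E) (poly (x * p12 - smult (1 / a n) p22) E)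
        (poly (smult (a n) p11) E) (poly (smult (a n) p12) E)" for E
      by (simp add: p step_mat_def mat2_eq_iff x n_def[symmetric])
  qed (use a_pos[of n] c d in \<open>simp_all add: cx cs dx ds degree_diff_le\<close>)
qed

lemma disc_poly:
  assumes "q > 0"
  obtains p where "\<And>E. disc b q E = poly p E" "degree p \<le> q" "coeff p q \<noteq> 0"
proof -
  obtain p11 p12 p21 p22 where p: "\<And>E. transfer b E 0 q = M2 (poly p11 E) (poly p12 E) (poly p21 E) (poly p22 E)"
    and d: "degree p11 \<le> q" "degree p22 \<le> q" "coeff p11 q \<noteq> 0" "coeff p22 q = 0"
    using transfer_poly[of b 0 q] assms by blast
  show thesis
    by (rule that[of "p11 + p22"]) (use d in \<open>simp_all add: disc_def tr2_def p degree_add_le\<close>)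
qed

lemma disc_level:
  assumes "q > 0"
  shows "finite {E. disc b q E = c}" "card {E. disc b q E = c} \<le> q"
proof -
  obtain p where p: "\<And>E. disc b q E = poly p E" "degree p \<le> q" "coeff p q \<noteq> 0"
    using disc_poly[OF assms] by blast
  define r where "r = p - [:c:]"
  have "coeff r q \<noteq> 0" using p(3) assms by (cases q) (simp_all add: r_def)
  then have r: "r \<noteq> 0" by auto
  have dr: "degree r \<le> q" using p by (simp add: r_def degree_diff_le)
  have e: "{E. disc b q E = c} = {E. poly r E = 0}" by (simp add: p r_def)
  show "finite {E. disc b q E = c}" unfolding e by (rule poly_roots_finite[OF r])
  show "card {E. disc b q E = c} \<le> q" unfolding e using card_poly_roots_bound[OF r] dr by simp
qed

lemma disc_edges:
  assumes "q > 0"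
  shows "finite {E. (disc b q E)\<^sup>2 = 4}" "card {E. (disc b q E)\<^sup>2 = 4} \<le> 2 * q"
proof -
  have e: "{E. (disc b q E)\<^sup>2 = 4} = {E. disc b q E = 2} \<union> {E. disc b q E = - 2}"
    using power2_eq_iff[of "disc b q _" 2] by auto
  show "finite {E. (disc b q E)\<^sup>2 = 4}" unfolding e using disc_level[OF assms] by simp
  show "card {E. (disc b q E)\<^sup>2 = 4} \<le> 2 * q" unfolding e
    using card_Un_le[of "{E. disc b q E = 2}" "{E. disc b q E = - 2}"]
      disc_level(2)[OF assms, of b 2] disc_level(2)[OF assms, of b "- 2"] by linarith
qed

lemma continuous_disc: "continuous_on S (disc b q)"
proof -
  have "(\<exists>p. \<forall>E. disc b q E = poly p E)"
    using transfer_poly[of b 0 q] unfolding disc_def tr2_def by (metis mat2.sel(1,4) poly_add)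
  then obtain p where "disc b q = poly p" by auto
  then show ?thesis by (simp add: continuous_on_poly continuous_on_id)
qed

text \<open>On a band the rotation number \<open>arccos (disc / 2)\<close> varies by at most \<open>pi\<close>, and has derivative
  \<open>disc' / sqrt (4 - disc^2)\<close> up to sign.\<close>

lemma band_cover:
  assumes per: "per q a" "per q b" and K: "K > 0" "r > pi / K"
    and der: "\<And>E. E0 - r \<le> E \<Longrightarrow> E \<le> E0 \<Longrightarrow> \<bar>disc b q E\<bar> < 2 \<Longrightarrow> K\<^sup>2 * (4 - (disc b q E)\<^sup>2) \<le> (disc' b q E)\<^sup>2"
    and E0: "\<bar>disc b q E0\<bar> \<le> 2"
  shows "\<exists>f. (disc b q f)\<^sup>2 = 4 \<and> E0 \<in> {f..f + r}"
proof (rule ccontr)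
  assume no: "\<not> ?thesis"
  have r: "r > 0" using K pi_gt_zero by (smt (verit) divide_pos_pos)
  have ne: "(disc b q f)\<^sup>2 \<noteq> 4" if "E0 - r \<le> f" "f \<le> E0" for f
    using no that by auto
  \<comment> \<open>With no edge in the window of length \<open>r\<close> to the left of
    \<open>E0\<close>, the discriminant cannot cross modulus 2 there, and \<open>\<theta>\<close> is
    differentiable throughout.\<close>
  have lt: "\<bar>disc b q f\<bar> < 2" if f: "E0 - r \<le> f" "f \<le> E0" for f
  proof (rule ccontr)
    assume "\<not> \<bar>disc b q f\<bar> < 2"
    then have "\<exists>x. f \<le> x \<and> x \<le> E0 \<and> \<bar>disc b q x\<bar> = 2"
      using E0 f by (intro IVT2') (auto intro!: continuous_intros continuous_disc)
    then obtain x where x: "f \<le> x" "x \<le> E0" "\<bar>disc b q x\<bar> = 2" by blast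
    then have "(disc b q x)\<^sup>2 = 2\<^sup>2" by (metis power2_abs)
    then show False using ne[of x] x f by simp
  qed
  define \<theta> where "\<theta> E = arccos (disc b q E / 2)" for E
  define \<theta>' where "\<theta>' E = - inverse (sqrt (1 - (disc b q E / 2)\<^sup>2)) * (disc' b q E / 2)" for E
  have "(\<theta> has_real_derivative \<theta>' E) (at E)" if "E0 - r \<le> E" "E \<le> E0" for E
  proof -
    have "((\<lambda>E. disc b q E / 2) has_real_derivative disc' b q E / 2) (at E)"
      by (intro DERIV_cdivide disc_deriv per)
    from DERIV_chain2[OF _ this, of arccos, OF DERIV_arccos] show ?thesis
      using lt[OF that] by (simp add: \<theta>_def[abs_def] \<theta>'_def)
  qed
  \<comment> \<open>The mean value theorem makes \<open>\<theta>\<close> vary by at least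
    \<open>r * K\<close>, more than its range allows.\<close>
  then obtain x where x: "E0 - r < x" "x < E0" "\<theta> E0 - \<theta> (E0 - r) = (E0 - (E0 - r)) * \<theta>' x"
    using MVT2[of "E0 - r" E0 \<theta> \<theta>'] r by auto
  have D: "1 - (disc b q x / 2)\<^sup>2 > 0"
    using lt[of x] x abs_square_less_1[of "disc b q x / 2"] by simp
  have "K\<^sup>2 \<le> (\<theta>' x)\<^sup>2"
    using der[of x] lt[of x] x D unfolding \<theta>'_def power_mult_distrib power_inverse
    by (simp add: power_mult_distrib power_divide field_simps)
  then have "K \<le> \<bar>\<theta>' x\<bar>" using K by (metis abs_le_square_iff abs_of_pos)
  then have "r * K \<le> \<bar>\<theta> E0 - \<theta> (E0 - r)\<bar>" using x r by (simp add: abs_mult)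
  moreover have "\<bar>\<theta> E0 - \<theta> (E0 - r)\<bar> \<le> pi"
  proof -
    have "0 \<le> \<theta> E \<and> \<theta> E \<le> pi" if "E0 - r \<le> E" "E \<le> E0" for E
      using lt[OF that] arccos_lbound[of "disc b q E / 2"] arccos_ubound[of "disc b q E / 2"] by (simp add: \<theta>_def)
    from this[of E0] this[of "E0 - r"] show ?thesis using r by auto
  qed
  ultimately show False using K by (simp add: field_simps)
qed

text \<open>Each point of the set has an edge at most \<open>r\<close> to its left, and there are at
  most \<open>2 * q\<close> edges. The windows may stick out of the range on the left, so the
  derivative bound is asked down to \<open>- R - r\<close>.\<close>

lemma band_measure:
  assumes per: "per q a" "per q b" and q: "q > 0" and K: "K > 0" "r > pi / K"
    and der: "\<And>E. - R - r \<le> E \<Longrightarrow> E \<le> R \<Longrightarrow> \<bar>disc b q E\<bar> < 2 \<Longrightarrow> K\<^sup>2 * (4 - (disc b q E)\<^sup>2) \<le> (disc' b q E)\<^sup>2"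
  shows "emeasure lborel {E \<in> {- R..R}. \<bar>disc b q E\<bar> \<le> 2} \<le> ennreal (2 * q * r)"
proof -
  define F where "F = {E. (disc b q E)\<^sup>2 = 4}"
  have F: "finite F" "card F \<le> 2 * q" using disc_edges[OF q] by (auto simp: F_def)
  have r: "r > 0" using K pi_gt_zero by (smt (verit) divide_pos_pos)
  have "{E \<in> {- R..R}. \<bar>disc b q E\<bar> \<le> 2} \<subseteq> (\<Union>f\<in>F. {f..f + r})"
  proof
    fix E assume E: "E \<in> {E \<in> {- R..R}. \<bar>disc b q E\<bar> \<le> 2}"
    have "\<exists>f. (disc b q f)\<^sup>2 = 4 \<and> E \<in> {f..f + r}"
      using E by (intro band_cover[OF per K] der) auto
    then show "E \<in> (\<Union>f\<in>F. {f..f + r})" by (auto simp: F_def)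
  qed
  then have 1: "emeasure lborel {E \<in> {- R..R}. \<bar>disc b q E\<bar> \<le> 2} \<le> emeasure lborel (\<Union>f\<in>F. {f..f + r})"
    using F by (intro emeasure_mono) auto
  have 2: "emeasure lborel (\<Union>f\<in>F. {f..f + r}) \<le> (\<Sum>f\<in>F. emeasure lborel {f..f + r})"
    using F by (intro emeasure_subadditive_finite) auto
  have 3: "(\<Sum>f\<in>F. emeasure lborel {f..f + r}) = ennreal (real (card F) * r)"
    using r by (simp add: ennreal_mult ennreal_of_nat_eq_real_of_nat)
  have 4: "ennreal (real (card F) * r) \<le> ennreal (2 * q * r)"
    using F r by (intro ennreal_leI mult_right_mono) auto
  show ?thesis using order_trans[OF order_trans[OF 1 2]] 4 unfolding 3 by simp
qed

end

section \<open>Opening gaps and thin periodic spectra\<close>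

lemma tr2_Cayley_Hamilton: "tr2 (X * (M * M)) = tr2 M * tr2 (X * M) - det2 M * tr2 X"
  by (simp add: tr2_def det2_def algebra_simps)

lemma tr2_power_rec:
  "det2 M = 1 \<Longrightarrow> tr2 (X * M ^ Suc (Suc k)) = tr2 M * tr2 (X * M ^ Suc k) - tr2 (X * M ^ k)"
  using tr2_Cayley_Hamilton[of "X * M ^ k" M] by (simp only: power_Suc2 mult.assoc mult_1_left)

text \<open>Powers of an elliptic matrix through Chebyshev polynomials of the second kind, cleared
  of the denominator \<open>sin \<theta>\<close>. The matrix \<open>X\<close> leaves room for a
  perturbation. The subtraction is taken in the reals because \<open>k = 0\<close> is
  included.\<close>

lemma tr2_power_elliptic:
  assumes "det2 M = 1" "tr2 M = 2 * cos \<theta>"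
  shows "tr2 (X * M ^ k) * sin \<theta> = sin (k * \<theta>) * tr2 (X * M) - sin ((real k - 1) * \<theta>) * tr2 X"
proof (induction k rule: induct_nat_012)
  case (ge2 k)
  have s: "sin (x + \<theta>) = 2 * cos \<theta> * sin x - sin (x - \<theta>)" for x
    by (simp add: sin_add sin_diff)
  have e: "real (Suc (Suc k)) * \<theta> = real (Suc k) * \<theta> + \<theta>" "(real (Suc (Suc k)) - 1) * \<theta> = real k * \<theta> + \<theta>"
    "(real (Suc k) - 1) * \<theta> = real k * \<theta>" "(real k - 1) * \<theta> = real k * \<theta> - \<theta>"
    "real k * \<theta> = real (Suc k) * \<theta> - \<theta>"
    by (simp_all add: algebra_simps)
  have "tr2 (X * M ^ Suc (Suc k)) * sin \<theta> = 2 * cos \<theta> * (tr2 (X * M ^ Suc k) * sin \<theta>) - tr2 (X * M ^ k) * sin \<theta>"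
    unfolding tr2_power_rec[OF assms(1)] assms(2) by (simp add: algebra_simps)
  also have "\<dots> = 2 * cos \<theta> * (sin (real (Suc k) * \<theta>) * tr2 (X * M) - sin (real k * \<theta>) * tr2 X)
      - (sin (real (Suc k) * \<theta> - \<theta>) * tr2 (X * M) - sin (real k * \<theta> - \<theta>) * tr2 X)"
    using ge2 e by simp
  also have "\<dots> = sin (real (Suc k) * \<theta> + \<theta>) * tr2 (X * M) - sin (real k * \<theta> + \<theta>) * tr2 X"
    unfolding s by (simp add: algebra_simps)
  finally show ?case unfolding e(1,2) .
qed (simp_all add: algebra_simps)

text \<open>From the trace recursion: as soon as the moduli do not decrease, one of the two factors
  in \<open>2 * g\<close> outweighs the subtracted term.\<close>

lemma tr2_power_hyperbolic:
  assumes "det2 M = 1" "\<bar>tr2 M\<bar> \<ge> 2 * g" "g \<ge> 1"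
  shows "\<bar>tr2 (M ^ k)\<bar> \<ge> g ^ k"
proof -
  have step: "\<bar>tr2 (M ^ Suc k)\<bar> \<ge> g * \<bar>tr2 (M ^ k)\<bar>" for k
  proof (induction k)
    case 0
    then show ?case using assms by (simp add: tr2_linear)
  next
    case (Suc k)
    have le: "\<bar>tr2 (M ^ k)\<bar> \<le> \<bar>tr2 (M ^ Suc k)\<bar>"
      using Suc mult_right_mono[OF assms(3) abs_ge_zero[of "tr2 (M ^ k)"]] by linarith
    have "2 * g * \<bar>tr2 (M ^ Suc k)\<bar> \<le> \<bar>tr2 M * tr2 (M ^ Suc k)\<bar>"
      unfolding abs_mult using assms(2) by (rule mult_right_mono) simp
    also have "tr2 M * tr2 (M ^ Suc k) = tr2 (M ^ Suc (Suc k)) + tr2 (M ^ k)"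
      using tr2_power_rec[OF assms(1), of 1 k] by simp
    finally have "2 * g * \<bar>tr2 (M ^ Suc k)\<bar> \<le> \<bar>tr2 (M ^ Suc (Suc k))\<bar> + \<bar>tr2 (M ^ Suc k)\<bar>"
      using le by linarith
    moreover have "\<bar>tr2 (M ^ Suc k)\<bar> \<le> g * \<bar>tr2 (M ^ Suc k)\<bar>"
      using mult_right_mono[OF assms(3) abs_ge_zero[of "tr2 (M ^ Suc k)"]] by simp
    ultimately show ?case by linarith
  qed
  show ?thesis
  proof (induction k)
    case 0
    then show ?case by (simp add: tr2_linear)
  next
    case (Suc k)
    have "g ^ Suc k \<le> g * \<bar>tr2 (M ^ k)\<bar>" using mult_left_mono[OF Suc, of g] assms(3) by simp
    then show ?case using step[of k] by linarith
  qed
qed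

lemma abs_sin_diff_le: "\<bar>sin x - sin y\<bar> \<le> \<bar>x - y\<bar>" for x y :: real
proof -
  have "\<bar>sin x - sin y\<bar> = 2 * \<bar>sin ((x - y) / 2)\<bar> * \<bar>cos ((x + y) / 2)\<bar>"
    by (simp add: sin_diff_sin abs_mult)
  also have "\<dots> \<le> 2 * \<bar>(x - y) / 2\<bar> * 1"
    by (intro mult_mono abs_sin_x_le_abs_x) auto
  finally show ?thesis by simp
qed

text \<open>Dirichlet approximation of \<open>\<theta> / (2 * pi)\<close>. The multiple is doubled
  to secure \<open>k \<ge> 2\<close>, which leaves two distinct sites in the long period of
  \<open>open_gap\<close> even for \<open>q = 1\<close>.\<close>

lemma almost_period:
  assumes "d > 0"
  obtains k :: nat and x where "k \<ge> 2" "\<bar>x\<bar> < d" "\<And>y. sin (real k * \<theta> + y) = sin (x + y)"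
proof -
  \<comment> \<open>The constant \<open>4 * pi\<close> is the full turn \<open>2 * pi\<close> times
    the doubling.\<close>
  define N where "N = nat \<lceil>4 * pi / d\<rceil> + 1"
  have N: "N > 0" "4 * pi / d < real N" unfolding N_def by linarith+
  obtain q p where q: "0 < q" and p: "\<And>i. i < (1::nat) \<Longrightarrow> \<bar>of_int q * (\<theta> / (2 * pi)) - of_int (p i)\<bar> < 1 / real N"
    using Dirichlet_approx_simult[OF N(1), of 1 "\<lambda>_. \<theta> / (2 * pi)"] by blast
  define x where "x = 2 * of_int q * \<theta> - of_int (2 * p 0) * (2 * pi)"
  have "\<bar>x\<bar> = 4 * pi * \<bar>of_int q * (\<theta> / (2 * pi)) - of_int (p 0)\<bar>"
  proof -
    have "x = 4 * pi * (of_int q * (\<theta> / (2 * pi)) - of_int (p 0))" by (simp add: x_def field_simps)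
    then show ?thesis by (simp add: abs_mult)
  qed
  also have "\<dots> < 4 * pi * (1 / real N)" by (intro mult_strict_left_mono p) auto
  also have "\<dots> \<le> d" using N assms by (simp add: field_simps)
  finally have xd: "\<bar>x\<bar> < d" .
  have "sin (real (nat (2 * q)) * \<theta> + y) = sin (x + y)" for y
  proof -
    have e: "real (nat (2 * q)) * \<theta> + y = (x + y) + of_int (2 * p 0) * (2 * pi)"
      using q by (simp add: x_def)
    show ?thesis unfolding e using sin.plus_of_int[of "x + y" "2 * p 0"] by (simp add: mult_ac)
  qed
  then show thesis using that[of "nat (2 * q)" x] xd q by auto
qed

context jacobi_weights
begin

lemma disc_shift: "disc (\<lambda>n. b n + t) q E = disc b q (E - t)"
proof -
  have "transfer (\<lambda>n. b n + t) E m k = transfer b (E - t) m k" for m k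
    by (induction k) (simp_all add: step_mat_def diff_diff_eq add.commute)
  then show ?thesis by (simp add: disc_def)
qed

text \<open>Perturbing two neighbouring sites by \<open>t\<close> and \<open>- t\<close> multiplies the monodromy matrix by a hyperbolic
  matrix; over a suitable number of periods the elliptic monodromy matrix is close to the identity.\<close>

lemma open_gap:
  assumes per: "per q a" "per q b" and q: "q > 0" and D: "\<bar>disc b q E\<bar> < 2" and t: "t > 0"
  obtains b' q' where "q' > 0" "per q' a" "per q' b'" "\<And>n. \<bar>b' n - b n\<bar> \<le> t" "\<bar>disc b' q' E\<bar> > 2"
proof -
  define M where "M = transfer b E 0 q"
  define \<theta> where "\<theta> = arccos (disc b q E / 2)"
  have th: "tr2 M = 2 * cos \<theta>" using D by (simp add: M_def \<theta>_def flip: disc_def)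
  have "0 < \<theta>" "\<theta> < pi" unfolding \<theta>_def using D arccos_lt_bounded[of "disc b q E / 2"] by auto
  then have sth: "sin \<theta> > 0" by (rule sin_gt_zero)
  \<comment> \<open>Changing \<open>b\<close> by \<open>t\<close> at one site multiplies the step on
    the right by a shear. Moving the shear at site 1 past the step at site 0 gives \<open>W\<close>;
    thanks to the opposite signs its trace exceeds 2 independently of \<open>E\<close> and
    \<open>b\<close>.\<close>
  define W where "W = adj2 (step_mat b E 0) * M2 1 0 (- t) 1 * step_mat b E 0 * M2 1 0 t 1"
  have trW: "tr2 W = 2 + (t / a 0)\<^sup>2"
    using a_pos[of 0] by (simp add: W_def tr2_def adj2_def step_mat_def field_simps power2_eq_square)
  have trW2: "tr2 W > 2" unfolding trW using t a_pos[of 0] by simp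
  define B where "B = \<bar>tr2 (W * M)\<bar> + \<bar>tr2 W\<bar> + 1"
  have B: "B > 0" by (simp add: B_def add_nonneg_pos)
  \<comment> \<open>Small enough that the deviation of \<open>M ^ k\<close> from the identity, at
    most \<open>\<bar>x\<bar> * B\<close> below, cannot use up the excess of \<open>tr2 W\<close>
    over 2.\<close>
  define d where "d = (tr2 W - 2) * sin \<theta> / B"
  have d: "d > 0" using trW2 sth B by (simp add: d_def)
  obtain k :: nat and x where k: "k \<ge> 2" "\<bar>x\<bar> < d" and sx: "\<And>y. sin (real k * \<theta> + y) = sin (x + y)"
    using almost_period[OF d] by blast
  have s1: "sin (real k * \<theta>) = sin x" and s2: "sin ((real k - 1) * \<theta>) = sin (x - \<theta>)"
    using sx[of 0] sx[of "- \<theta>"] by (simp_all add: algebra_simps)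
  have "\<bar>tr2 (W * M ^ k) * sin \<theta> - tr2 W * sin \<theta>\<bar> = \<bar>sin x * tr2 (W * M) - (sin (x - \<theta>) - sin (- \<theta>)) * tr2 W\<bar>"
    unfolding tr2_power_elliptic[OF det_transfer[of b E 0 q, folded M_def] th] s1 s2 by (simp add: algebra_simps)
  also have "\<dots> \<le> \<bar>sin x * tr2 (W * M)\<bar> + \<bar>(sin (x - \<theta>) - sin (- \<theta>)) * tr2 W\<bar>" by linarith
  also have "\<dots> \<le> \<bar>x\<bar> * \<bar>tr2 (W * M)\<bar> + \<bar>x\<bar> * \<bar>tr2 W\<bar>"
    unfolding abs_mult using abs_sin_diff_le[of "x - \<theta>" "- \<theta>"]
    by (intro add_mono mult_right_mono abs_sin_x_le_abs_x) auto
  also have "\<dots> \<le> \<bar>x\<bar> * B" by (simp add: B_def algebra_simps)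
  also have "\<dots> < d * B" using k B by simp
  also have "\<dots> = (tr2 W - 2) * sin \<theta>" using B by (simp add: d_def)
  finally have "2 * sin \<theta> < tr2 (W * M ^ k) * sin \<theta>" by (simp add: algebra_simps)
  then have big: "tr2 (W * M ^ k) > 2" using sth by simp
  define Q where "Q = k * q"
  have Q: "Q \<ge> 2" using mult_le_mono[of 2 k 1 q] k q by (simp add: Q_def)
  define b' where "b' n = b n + (if n mod int Q = 0 then t else if n mod int Q = 1 then - t else 0)" for n
  have perQ: "per Q a" "per Q b" using per_dvd[OF per(1), of Q] per_dvd[OF per(2), of Q] by (auto simp: Q_def)
  then have per': "per Q b'" by (simp add: per_def b'_def)
  have split: "transfer c E 0 Q = transfer c E 2 (Q - 2) * (step_mat c E 1 * step_mat c E 0)" for c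
  proof -
    have "transfer c E 0 2 = step_mat c E 1 * step_mat c E 0" by (simp add: numeral_2_eq_2)
    moreover have "2 + (Q - 2) = Q" using Q by simp
    ultimately show ?thesis using transfer_add[of c E 0 2 "Q - 2"] by (simp del: transfer.simps)
  qed
  have "transfer b' E 2 (Q - 2) = transfer b E 2 (Q - 2)"
  proof (rule transfer_cong)
    fix i assume "i < Q - 2"
    then have "(2 + int i) mod int Q = 2 + int i" by (intro mod_pos_pos_trivial) auto
    then show "a (2 + int i) = a (2 + int i) \<and> b' (2 + int i) = b (2 + int i)" by (simp add: b'_def)
  qed
  moreover have t0: "step_mat b' E 0 = step_mat b E 0 * M2 1 0 t 1"
    by (simp add: step_mat_def b'_def mat2_eq_iff diff_divide_distrib add_divide_distrib)
  moreover have t1: "step_mat b' E 1 = step_mat b E 1 * M2 1 0 (- t) 1"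
    using Q by (simp add: step_mat_def b'_def mat2_eq_iff diff_divide_distrib add_divide_distrib)
  moreover have "step_mat b E 1 * M2 1 0 (- t) 1 * (step_mat b E 0 * M2 1 0 t 1) = step_mat b E 1 * step_mat b E 0 * W"
  proof -
    have "step_mat b E 1 * step_mat b E 0 * W = step_mat b E 1 * (step_mat b E 0 * adj2 (step_mat b E 0)) * M2 1 0 (- t) 1 * step_mat b E 0 * M2 1 0 t 1"
      by (simp only: W_def mult.assoc)
    then show ?thesis unfolding adj2_mult(2)[OF det_step_mat] by (simp only: mult.assoc mult_1_right)
  qed
  ultimately have "transfer b' E 0 Q = transfer b E 0 Q * W" unfolding split by (simp only: mult.assoc)
  also have "transfer b E 0 Q = M ^ k" unfolding Q_def M_def by (rule transfer_power[OF per])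
  finally have "disc b' Q E = tr2 (W * M ^ k)" by (simp add: disc_def tr2_commute[of _ W])
  then show thesis using that[of Q b'] perQ per' Q big t by (auto simp: b'_def)
qed

text \<open>\<open>open_gap\<close> needs a strictly elliptic energy. A constant shift of the
  potential, avoiding finitely many values, moves \<open>E\<close> off the edges; afterwards it lies
  in a gap already or inside a band. Each change uses at most half of \<open>e\<close>.\<close>

lemma nearby_gap:
  assumes per: "per q a" "per q b" and q: "q > 0" and e: "e > 0"
  obtains b' q' where "q' > 0" "per q' a" "per q' b'" "\<And>n. \<bar>b' n - b n\<bar> \<le> e" "\<bar>disc b' q' E\<bar> > 2"
proof -
  have "infinite {0<..e / 2}" using e by (simp add: infinite_Ioc)
  moreover have "finite ((\<lambda>x. E - x) ` {x. (disc b q x)\<^sup>2 = 4})" using disc_edges[OF q] by simp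
  ultimately obtain s where s: "s \<in> {0<..e / 2}" "s \<notin> (\<lambda>x. E - x) ` {x. (disc b q x)\<^sup>2 = 4}"
    by (meson finite_subset subsetI)
  have s2: "\<bar>disc b q (E - s)\<bar> \<noteq> 2"
  proof
    assume "\<bar>disc b q (E - s)\<bar> = 2"
    then have "(disc b q (E - s))\<^sup>2 = 4" using power2_abs[of "disc b q (E - s)"] by simp
    then show False using s(2) by (auto simp: image_iff)
  qed
  define c where "c n = b n + s" for n
  have perc: "per q c" using per(2) by (simp add: per_def c_def)
  have dc: "disc c q E = disc b q (E - s)" unfolding c_def by (rule disc_shift)
  show thesis
  proof (cases "\<bar>disc c q E\<bar> < 2")
    case True
    obtain b' q' where b': "q' > 0" "per q' a" "per q' b'" "\<And>n. \<bar>b' n - c n\<bar> \<le> e / 2" "\<bar>disc b' q' E\<bar> > 2"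
      by (rule open_gap[OF per(1) perc q True half_gt_zero[OF e]]) (rule that; assumption)
    have "\<bar>b' n - b n\<bar> \<le> e" for n
      using b'(4)[of n] s(1) unfolding c_def greaterThanAtMost_iff by linarith
    then show thesis using b' by (intro that[of q' b'])
  next
    case False
    then show thesis using that[of q c] per(1) perc q s s2 dc by (simp add: c_def)
  qed
qed

text \<open>Concatenating long blocks of finitely many perturbations, one of which is hyperbolic at any given
  energy, yields a period containing a stretch of exponentially large transfer matrices.\<close>

lemma thin_spectrum:
  assumes per: "per q a" "per q b" and q: "q > 0" and e: "e > 0" and \<eta>: "\<eta> > 0" and R: "R > 0"
  obtains b' q' where "q' > 0" "per q' a" "per q' b'" "\<And>n. \<bar>b' n - b n\<bar> \<le> e"
    "emeasure lborel {E \<in> {- R..R}. \<bar>disc b' q' E\<bar> \<le> 2} < ennreal \<eta>"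
proof -
  have "\<exists>v p. p > 0 \<and> per p a \<and> per p v \<and> (\<forall>n. \<bar>v n - b n\<bar> \<le> e) \<and> \<bar>disc v p E\<bar> > 2" for E
    using nearby_gap[OF per q e, of E] by metis
  then obtain v p where vp: "\<And>E. p E > 0" "\<And>E. per (p E) a" "\<And>E. per (p E) (v E)"
    "\<And>E n. \<bar>v E n - b n\<bar> \<le> e" "\<And>E. \<bar>disc (v E) (p E) E\<bar> > 2" by metis
  \<comment> \<open>Half the midpoint between 2 and the modulus of the discriminant, so that both
    inequalities for \<open>\<gamma>\<close> are strict.\<close>
  define \<gamma> where "\<gamma> E = (\<bar>disc (v E) (p E) E\<bar> + 2) / 4" for E
  have \<gamma>: "\<gamma> E > 1" "\<bar>disc (v E) (p E) E\<bar> > 2 * \<gamma> E" for E using vp(5)[of E] by (auto simp: \<gamma>_def)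
  define U where "U E = {x. \<bar>disc (v E) (p E) x\<bar> > 2 * \<gamma> E}" for E
  have oU: "open (U E)" for E
    unfolding U_def by (intro open_Collect_less continuous_intros continuous_disc)
  \<comment> \<open>The extra unit on the left holds the windows of \<open>band_measure\<close>,
    whose length \<open>r\<close> will be below 1.\<close>
  define I where "I = {- R - 1..R}"
  have "compact I" by (simp add: I_def)
  moreover have "I \<subseteq> (\<Union>E\<in>I. U E)" using \<gamma>(2) by (auto simp: U_def)
  ultimately obtain C where C: "C \<subseteq> I" "finite C" "I \<subseteq> (\<Union>E\<in>C. U E)"
    using compactE_image[of I I U] oU by metis
  have "R \<in> I" using R by (simp add: I_def)
  then have Cne: "C \<noteq> {}" using C(3) by auto
  define m where "m = card C"
  have m: "m > 0" using C Cne by (simp add: m_def card_gt_0_iff)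
  obtain h where h: "bij_betw h {0..<m} C" using ex_bij_betw_nat_finite[OF C(2)] by (auto simp: m_def)
  define g where "g = Min (\<gamma> ` C)"
  have g1: "g > 1" unfolding g_def using C Cne \<gamma>(1) by simp
  have g2: "g \<le> \<gamma> E" if "E \<in> C" for E unfolding g_def using C that by simp
  define P where "P = (\<Prod>E\<in>C. p E)"
  have P: "P > 0" unfolding P_def using vp(1) by (simp add: prod_pos)
  have pP: "p E dvd P" if "E \<in> C" for E unfolding P_def using C(2) that by (rule dvd_prodI)
  obtain A where A: "\<And>n. \<bar>a n\<bar> \<le> A" using per_bounded[OF per(1) q] by blast
  then have A: "\<And>n. a n \<le> A" using abs_le_D1 by blast
  \<comment> \<open>The factor 3 comes from raising the 8 of \<open>disc'_lower\<close> to the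
    square 9.\<close>
  define c where "c = 3 * (1 + A\<^sup>2)"
  have c: "c > 0" by (simp add: c_def add_pos_nonneg)
  \<comment> \<open>The first limit makes \<open>r < 1\<close>, the second makes
    \<open>2 * q' * r < \<eta>\<close>; the factor \<open>real N\<close> there is the linear growth
    of the period.\<close>
  have lim1: "(\<lambda>N. 2 * pi * c * (1 / g) ^ N) \<longlonglongrightarrow> 2 * pi * c * 0"
    using g1 by (intro tendsto_intros LIMSEQ_power_zero) auto
  have lim2: "(\<lambda>N. 4 * pi * c * real m * real P * (real N * (1 / g) ^ N)) \<longlonglongrightarrow> 4 * pi * c * real m * real P * 0"
    using g1 by (intro tendsto_intros powser_times_n_limit_0) auto
  have "\<forall>\<^sub>F N in sequentially. N \<ge> 1 \<and> 2 * pi * c * (1 / g) ^ N < 1 \<and>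
      4 * pi * c * real m * real P * (real N * (1 / g) ^ N) < \<eta>"
    using order_tendstoD(2)[OF lim1, of 1] order_tendstoD(2)[OF lim2, of \<eta>] \<eta> eventually_ge_at_top[of 1]
    by (simp add: eventually_conj_iff)
  then obtain N where N: "N \<ge> 1" "2 * pi * c * (1 / g) ^ N < 1"
      "4 * pi * c * real m * real P * (real N * (1 / g) ^ N) < \<eta>"
    by (rule eventually_happens'[OF sequentially_bot, THEN exE]) auto
  define L where "L = N * P"
  have L: "L > 0" using N P by (simp add: L_def)
  define w where "w i = v (h i)" for i
  \<comment> \<open>The block number modulo \<open>m\<close> selects the potential, read off at
    \<open>n\<close> itself: \<open>L\<close> is a multiple of all the periods, so no offset
    arises.\<close>
  define b' where "b' n = w (nat ((n div int L) mod int m)) n" for n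
  have hC: "h i \<in> C" if "i < m" for i using h that by (auto simp: bij_betw_def)
  have idx: "nat (j mod int m) < m" for j using m by (simp add: nat_less_iff)
  have perL: "per L (w i)" if "i < m" for i
    unfolding w_def using hC[OF that] pP by (intro per_dvd[OF vp(3)]) (simp add: L_def)
  define q' where "q' = m * L"
  have q': "q' > 0" using m L by (simp add: q'_def)
  have pera: "per q' a" using hC[OF m] pP by (intro per_dvd[OF vp(2)[of "h 0"]]) (simp add: q'_def L_def)
  have perb: "per q' b'"
    unfolding per_def
  proof
    fix n
    have "(n + int q') div int L = n div int L + int m"
      using L by (simp add: q'_def)
    then have "nat (((n + int q') div int L) mod int m) = nat ((n div int L) mod int m)" by simp
    moreover have "per q' (w (nat ((n div int L) mod int m)))"
      by (intro per_dvd[OF perL[OF idx]]) (simp add: q'_def)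
    ultimately show "b' (n + int q') = b' n" by (simp add: b'_def per_def)
  qed
  have close: "\<bar>b' n - b n\<bar> \<le> e" for n unfolding b'_def w_def by (rule vp(4))
  have stretch: "\<exists>i. \<bar>tr2 (transfer b' E (int i * int L) L)\<bar> \<ge> g ^ N" if EI: "E \<in> I" for E
  proof -
    obtain E1 where E1: "E1 \<in> C" "E \<in> U E1" using C(3) EI by blast
    then obtain i where i: "i < m" "h i = E1" using h by (auto simp: bij_betw_def image_iff)
    obtain r where r: "P = p E1 * r" using pP[OF E1(1)] by (auto elim: dvdE)
    have r0: "r > 0" using P r by (cases r) auto
    have "transfer b' E (int i * int L) L = transfer (w i) E (int i * int L) L"
    proof (rule transfer_cong)
      fix j assume j: "j < L"
      have "(int i * int L + int j) div int L = int i"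
        using j L by (simp add: div_add1_eq)
      then show "a (int i * int L + int j) = a (int i * int L + int j) \<and>
          b' (int i * int L + int j) = w i (int i * int L + int j)"
        using i by (simp add: b'_def)
    qed
    also have "\<dots> = transfer (v E1) E (0 + int (p E1) * (int i * (int N * int r))) L"
      by (simp add: w_def i(2) L_def r mult_ac)
    also have "\<dots> = transfer (v E1) E 0 ((N * r) * p E1)"
      unfolding transfer_per[OF vp(2,3)] by (simp add: L_def r mult_ac)
    also have "\<dots> = transfer (v E1) E 0 (p E1) ^ (N * r)" by (rule transfer_power[OF vp(2,3)])
    finally have eq: "transfer b' E (int i * int L) L = transfer (v E1) E 0 (p E1) ^ (N * r)" .
    have "g ^ N \<le> g ^ (N * r)" using g1 r0 by (intro power_increasing) auto
    also have "\<dots> \<le> \<bar>tr2 (transfer (v E1) E 0 (p E1) ^ (N * r))\<bar>"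
      using E1 g2[OF E1(1)] g1 by (intro tr2_power_hyperbolic det_transfer) (auto simp: U_def disc_def)
    finally show ?thesis unfolding eq[symmetric] by blast
  qed
  define K where "K = g ^ N / c"
  have K: "K > 0" using c g1 by (simp add: K_def)
  \<comment> \<open>Twice the critical length, because \<open>band_measure\<close> requires a strict
    inequality.\<close>
  define r where "r = 2 * pi / K"
  have "pi / K > 0" using K by simp
  then have "r > pi / K" by (simp add: r_def)
  moreover have "r = 2 * pi * c * (1 / g) ^ N" by (simp add: r_def K_def power_divide)
  ultimately have r: "r > pi / K" "r < 1" "r = 2 * pi * c * (1 / g) ^ N" using N(2) by simp_all
  have "K\<^sup>2 * (4 - (disc b' q' E)\<^sup>2) \<le> (disc' b' q' E)\<^sup>2"
    if E: "- R - r \<le> E" "E \<le> R" "\<bar>disc b' q' E\<bar> < 2" for E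
  proof -
    have "E \<in> I" using E r by (simp add: I_def)
    then obtain i where i: "\<bar>tr2 (transfer b' E (int i * int L) L)\<bar> \<ge> g ^ N" using stretch by blast
    have D: "4 - (disc b' q' E)\<^sup>2 \<ge> 0"
      using power_mono[of "\<bar>disc b' q' E\<bar>" 2 2] E(3) by simp
    have "(4 - (disc b' q' E)\<^sup>2) * (g ^ N)\<^sup>2 \<le> (4 - (disc b' q' E)\<^sup>2) * (tr2 (transfer b' E (int i * int L) L))\<^sup>2"
      using i g1 D power_mono[OF i, of 2] by (intro mult_left_mono) auto
    also have "\<dots> \<le> 8 * ((1 + A\<^sup>2) * disc' b' q' E)\<^sup>2"
      by (rule disc'_lower[OF pera perb E(3) q' A])
    also have "\<dots> \<le> 9 * ((1 + A\<^sup>2) * disc' b' q' E)\<^sup>2" by (intro mult_right_mono) auto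
    also have "\<dots> = (c * disc' b' q' E)\<^sup>2" unfolding c_def power_mult_distrib by simp
    finally show ?thesis using c by (simp add: K_def power_divide power_mult_distrib field_simps)
  qed
  then have "emeasure lborel {E \<in> {- R..R}. \<bar>disc b' q' E\<bar> \<le> 2} \<le> ennreal (2 * real q' * r)"
    by (intro band_measure[OF pera perb q' K r(1)])
  also have "\<dots> < ennreal \<eta>"
    using N(3) \<eta> by (intro ennreal_lessI) (auto simp: r(3) q'_def L_def mult_ac)
  finally show thesis by (rule that[OF q' pera perb close])
qed

end

section \<open>Stability of small spectra and absence of eigenvalues\<close>

text \<open>Cauchy-Schwarz over the window costs one factor \<open>N\<close> and summing the shifted
  copies of \<open>y\<close> another, both inside the square.\<close>

lemma ell2_window_bound:
  assumes G: "\<And>n. cmod (ell2_seq g n) \<le> c * (\<Sum>j<N. cmod (ell2_seq y (n + s j)))" and c: "c \<ge> 0"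
  shows "norm g \<le> c * real N * norm y"
proof -
  have "(\<Sum>n\<in>F. (cmod (ell2_seq g n))\<^sup>2) \<le> (c * real N * norm y)\<^sup>2" if F: "finite F" for F
  proof -
    have "(cmod (ell2_seq g n))\<^sup>2 \<le> c\<^sup>2 * real N * (\<Sum>j<N. (cmod (ell2_seq (ell2_shift (s j) y) n))\<^sup>2)" for n
    proof -
      have "(cmod (ell2_seq g n))\<^sup>2 \<le> (c * (\<Sum>j<N. cmod (ell2_seq y (n + s j))))\<^sup>2"
        using G by (rule power_mono) simp
      also have "\<dots> \<le> c\<^sup>2 * ((\<Sum>j<N. (cmod (ell2_seq y (n + s j)))\<^sup>2) * card {..<N})"
        unfolding power_mult_distrib by (intro mult_left_mono sum_squared_le_sum_of_squares) simp
      finally show ?thesis by (simp add: ell2_seq_shift mult_ac)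
    qed
    then have "(\<Sum>n\<in>F. (cmod (ell2_seq g n))\<^sup>2) \<le>
        (\<Sum>n\<in>F. c\<^sup>2 * real N * (\<Sum>j<N. (cmod (ell2_seq (ell2_shift (s j) y) n))\<^sup>2))"
      by (rule sum_mono)
    also have "\<dots> = c\<^sup>2 * real N * (\<Sum>j<N. \<Sum>n\<in>F. (cmod (ell2_seq (ell2_shift (s j) y) n))\<^sup>2)"
      unfolding sum_distrib_left[symmetric] by (subst sum.swap) rule
    also have "\<dots> \<le> c\<^sup>2 * real N * (\<Sum>j<N. (norm y)\<^sup>2)"
    proof (intro mult_left_mono sum_mono)
      fix j
      have "(norm (ell2_shift (s j) y))\<^sup>2 \<le> (norm y)\<^sup>2" by (intro power_mono norm_ell2_shift) simp
      then show "(\<Sum>n\<in>F. (cmod (ell2_seq (ell2_shift (s j) y) n))\<^sup>2) \<le> (norm y)\<^sup>2"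
        using ell2_finite_sum_le[OF F, of "ell2_shift (s j) y"] by linarith
    qed simp
    also have "\<dots> = (c * real N * norm y)\<^sup>2" by (simp add: power2_eq_square)
    finally show ?thesis .
  qed
  from l2ZI_bounded(2)[OF this] c show ?thesis by (simp add: ell2_seq_inverse)
qed

lemma ell2_finite_large:
  assumes "d > 0"
  shows "finite {n. cmod (ell2_seq x n) \<ge> d}"
proof (rule ccontr)
  assume inf: "infinite {n. cmod (ell2_seq x n) \<ge> d}"
  obtain N :: nat where N: "real N > (norm x)\<^sup>2 / d\<^sup>2" using reals_Archimedean2 by blast
  obtain F where F: "finite F" "card F = N" "F \<subseteq> {n. cmod (ell2_seq x n) \<ge> d}"
    using infinite_arbitrarily_large[OF inf] by blast
  have "real N * d\<^sup>2 = (\<Sum>n\<in>F. d\<^sup>2)" using F by simp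
  also have "\<dots> \<le> (\<Sum>n\<in>F. (cmod (ell2_seq x n))\<^sup>2)"
    using F assms by (intro sum_mono power_mono) auto
  also have "\<dots> \<le> (norm x)\<^sup>2" by (rule ell2_finite_sum_le[OF F(1)])
  finally show False using N assms by (simp add: field_simps)
qed

section \<open>Transfer matrices acting on approximate solutions\<close>

definition mat2_act :: "mat2 \<Rightarrow> complex \<times> complex \<Rightarrow> complex \<times> complex" where
  "mat2_act M v = (of_real (e11 M) * fst v + of_real (e12 M) * snd v, of_real (e21 M) * fst v + of_real (e22 M) * snd v)"

definition pnorm :: "complex \<times> complex \<Rightarrow> real" where
  "pnorm v = cmod (fst v) + cmod (snd v)"

lemma mat2_act_one: "mat2_act 1 v = v"
  by (simp add: mat2_act_def)

lemma mat2_act_mult: "mat2_act (M * N) v = mat2_act M (mat2_act N v)"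
  by (simp add: mat2_act_def algebra_simps)

lemma mat2_act_diff: "mat2_act M (v - w) = mat2_act M v - mat2_act M w"
  by (simp add: mat2_act_def algebra_simps)

lemma pnorm_add: "pnorm (v + w) \<le> pnorm v + pnorm w"
  using norm_triangle_ineq[of "fst v" "fst w"] norm_triangle_ineq[of "snd v" "snd w"]
  by (simp add: pnorm_def)

lemma pnorm_act: "pnorm (mat2_act M v) \<le> norm2 M * pnorm v"
proof -
  have "pnorm (mat2_act M v) \<le> (\<bar>e11 M\<bar> * cmod (fst v) + \<bar>e12 M\<bar> * cmod (snd v))
      + (\<bar>e21 M\<bar> * cmod (fst v) + \<bar>e22 M\<bar> * cmod (snd v))"
    unfolding pnorm_def mat2_act_def fst_conv snd_conv
    by (intro add_mono order_trans[OF norm_triangle_ineq]) (simp_all add: norm_mult)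
  also have "\<dots> \<le> (\<bar>e11 M\<bar> * cmod (fst v) + \<bar>e12 M\<bar> * cmod (snd v))
      + (\<bar>e21 M\<bar> * cmod (fst v) + \<bar>e22 M\<bar> * cmod (snd v))
      + (\<bar>e11 M\<bar> * cmod (snd v) + \<bar>e12 M\<bar> * cmod (fst v) + \<bar>e21 M\<bar> * cmod (snd v) + \<bar>e22 M\<bar> * cmod (fst v))"
    by simp
  also have "\<dots> = norm2 M * pnorm v" by (simp add: norm2_def pnorm_def algebra_simps)
  finally show ?thesis .
qed

context jacobi_weights
begin

lemma norm2_step_mat_ge: "1 / a n \<le> norm2 (step_mat b E n)"
  using a_pos[of n] by (simp add: norm2_def step_mat_def)

lemma norm2_transfer:
  assumes "\<And>n. norm2 (step_mat b E n) \<le> K" "K \<ge> 1"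
  shows "norm2 (transfer b E m k) \<le> 2 * K ^ k"
proof (induction k)
  case 0
  then show ?case by (simp add: norm2_def)
next
  case (Suc k)
  have "norm2 (transfer b E m (Suc k)) \<le> norm2 (step_mat b E (m + int k)) * norm2 (transfer b E m k)"
    by (simp add: norm2_mult)
  also have "\<dots> \<le> K * (2 * K ^ k)"
    using assms Suc by (intro mult_mono) (auto simp: norm2_def)
  finally show ?case by simp
qed

definition state :: "(int \<Rightarrow> complex) \<Rightarrow> int \<Rightarrow> complex \<times> complex" where
  "state u n = (u n, of_real (a (n - 1)) * u (n - 1))"

lemma state_step:
  "state u (n + 1) = mat2_act (step_mat b E n) (state u n) + ((jacobi a b u n - of_real E * u n) / of_real (a n), 0)"
  using a_pos[of n] by (simp add: state_def mat2_act_def step_mat_def jacobi_def field_simps)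

text \<open>A discrete Duhamel estimate. The defect at a site enters divided by \<open>a n\<close>,
  and \<open>norm2_step_mat_ge\<close> absorbs this into a power of \<open>K\<close>.\<close>

lemma state_propagation:
  assumes K: "\<And>n. norm2 (step_mat b E n) \<le> K" "K \<ge> 1"
  shows "pnorm (state u (n + int k) - mat2_act (transfer b E n k) (state u n)) \<le>
    K ^ k * (\<Sum>j<k. cmod (jacobi a b u (n + int j) - of_real E * u (n + int j)))"
proof (induction k)
  case 0
  then show ?case by (simp add: mat2_act_one pnorm_def)
next
  case (Suc k)
  define f where "f m = jacobi a b u m - of_real E * u m" for m
  define F where "F = state u (n + int k) - mat2_act (transfer b E n k) (state u n)"
  define w where "w = (f (n + int k) / of_real (a (n + int k)), 0::complex)"
  have "state u (n + int (Suc k)) = mat2_act (step_mat b E (n + int k)) (state u (n + int k)) + w"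
    using state_step[of u "n + int k" b E] by (simp add: w_def f_def add.assoc add.commute[of 1])
  then have "state u (n + int (Suc k)) - mat2_act (transfer b E n (Suc k)) (state u n) = mat2_act (step_mat b E (n + int k)) F + w"
    by (simp add: F_def mat2_act_mult mat2_act_diff)
  then have "pnorm (state u (n + int (Suc k)) - mat2_act (transfer b E n (Suc k)) (state u n))
      \<le> norm2 (step_mat b E (n + int k)) * pnorm F + pnorm w"
    using pnorm_add[of "mat2_act (step_mat b E (n + int k)) F" w] pnorm_act[of "step_mat b E (n + int k)" F] by simp
  also have "\<dots> \<le> K * (K ^ k * (\<Sum>j<k. cmod (f (n + int j)))) + K ^ Suc k * cmod (f (n + int k))"
  proof (intro add_mono mult_mono K)
    show "pnorm F \<le> K ^ k * (\<Sum>j<k. cmod (f (n + int j)))" using Suc by (simp add: F_def f_def)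
    have "pnorm w = cmod (f (n + int k)) * (1 / a (n + int k))"
      using a_pos[of "n + int k"] by (simp add: pnorm_def w_def norm_divide)
    also have "\<dots> \<le> cmod (f (n + int k)) * K"
      using order_trans[OF norm2_step_mat_ge K(1)] by (intro mult_left_mono) auto
    also have "\<dots> \<le> cmod (f (n + int k)) * K ^ Suc k"
      using power_increasing[of 1 "Suc k" K] K(2) by (intro mult_left_mono) auto
    finally show "pnorm w \<le> K ^ Suc k * cmod (f (n + int k))" by (simp add: mult.commute)
  qed (use K in \<open>auto simp: pnorm_def\<close>)
  finally show ?case by (simp add: f_def algebra_simps)
qed

text \<open>By Cayley-Hamilton, exact solutions of the periodic equation satisfy
  \<open>u (n + q) + u (n - q) = disc * u n\<close>.\<close>

lemma three_term_identity:
  assumes per: "per q a" "per q b" and K: "\<And>n. norm2 (step_mat b E n) \<le> K" "K \<ge> 1"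
  shows "cmod (u (n + int q) + u (n - int q) - of_real (disc b q E) * u n) \<le>
    2 * K ^ (2 * q) * (\<Sum>j<2 * q. cmod (jacobi a b u (n + (int j - int q)) - of_real E * u (n + (int j - int q))))"
proof -
  define f where "f m = cmod (jacobi a b u m - of_real E * u m)" for m
  define M where "M = transfer b E n q"
  have M': "transfer b E (n - int q) q = M"
    using transfer_per[OF per, of E n "- 1" q] by (simp add: M_def)
  define F where "F = state u (n + int q) - mat2_act M (state u n)"
  define F' where "F' = state u n - mat2_act M (state u (n - int q))"
  have K0: "0 \<le> K ^ q" "1 \<le> K ^ q" using K(2) by (auto simp: one_le_power)
  have F: "pnorm F \<le> K ^ q * (\<Sum>j<q. f (n + int j))"
    using state_propagation[OF K, of u n q] by (simp add: F_def M_def f_def)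
  have F': "pnorm F' \<le> K ^ q * (\<Sum>j<q. f (n - int q + int j))"
    using state_propagation[OF K, of u "n - int q" q] by (simp add: F'_def M' f_def)
  have D: "disc b q E = e11 M + e22 M"
    using disc_monodromy[OF per, of E n] by (simp add: M_def tr2_def)
  have det: "of_real (e11 M * e22 M - e12 M * e21 M) = (1::complex)"
    using det_transfer[of b E n q] by (simp add: M_def det2_def)
  \<comment> \<open>The first row of \<open>M\<close> steps forward from \<open>n\<close> and that
    of \<open>adj2 M\<close> steps backward; in the sum the second components of the state
    cancel.\<close>
  have "u (n + int q) + u (n - int q) - of_real (disc b q E) * u n =
      fst F + (of_real (e12 M) * snd F' - of_real (e22 M) * fst F')
      + (1 - of_real (e11 M * e22 M - e12 M * e21 M)) * u (n - int q)"
    unfolding D F_def F'_def state_def mat2_act_def by (simp add: algebra_simps)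
  then have "cmod (u (n + int q) + u (n - int q) - of_real (disc b q E) * u n) \<le>
      cmod (fst F) + (cmod (of_real (e12 M) * snd F') + cmod (of_real (e22 M) * fst F'))"
    unfolding det
    using norm_triangle_ineq[of "fst F" "of_real (e12 M) * snd F' - of_real (e22 M) * fst F'"]
      norm_triangle_ineq4[of "of_real (e12 M) * snd F'" "of_real (e22 M) * fst F'"]
    by simp
  also have "\<dots> \<le> pnorm F + norm2 M * pnorm F'"
  proof -
    have "\<bar>e12 M\<bar> * cmod (snd F') \<le> norm2 M * cmod (snd F')" "\<bar>e22 M\<bar> * cmod (fst F') \<le> norm2 M * cmod (fst F')"
      by (intro mult_right_mono; simp add: norm2_def)+
    moreover have "cmod (snd F) \<ge> 0" by simp
    ultimately show ?thesis unfolding pnorm_def norm_mult norm_of_real distrib_left by linarith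
  qed
  also have "\<dots> \<le> K ^ q * (\<Sum>j<q. f (n + int j)) + 2 * K ^ q * (K ^ q * (\<Sum>j<q. f (n - int q + int j)))"
    using norm2_transfer[OF K, of n q] K0 by (intro add_mono mult_mono F F') (auto simp: M_def pnorm_def)
  also have "\<dots> \<le> 2 * K ^ (2 * q) * (\<Sum>j<q. f (n + int j)) + 2 * K ^ (2 * q) * (\<Sum>j<q. f (n - int q + int j))"
  proof -
    have Kq: "K ^ (2 * q) = K ^ q * K ^ q" by (metis mult_2 power_add)
    have "K ^ q * 1 \<le> K ^ q * K ^ q" using K0 by (intro mult_left_mono) auto
    then have "K ^ q \<le> 2 * K ^ (2 * q)" using K0 Kq by simp
    moreover have "0 \<le> (\<Sum>j<q. f (n + int j))" by (intro sum_nonneg) (simp add: f_def)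
    ultimately have "K ^ q * (\<Sum>j<q. f (n + int j)) \<le> 2 * K ^ (2 * q) * (\<Sum>j<q. f (n + int j))"
      by (rule mult_right_mono)
    then show ?thesis unfolding Kq by (simp add: mult.assoc)
  qed
  also have "\<dots> = 2 * K ^ (2 * q) * (\<Sum>j<2 * q. f (n + (int j - int q)))"
  proof -
    have split: "(\<Sum>j<m + k. g j) = (\<Sum>j<m. g j) + (\<Sum>j<k. g (m + j))" for m k and g :: "nat \<Rightarrow> real"
      by (induction k) simp_all
    have "(\<Sum>j<2 * q. f (n + (int j - int q))) = (\<Sum>j<q. f (n - int q + int j)) + (\<Sum>j<q. f (n + int j))"
      unfolding mult_2 split by (simp add: algebra_simps)
    then show ?thesis by (simp add: distrib_left)
  qed
  finally show ?thesis by (simp add: f_def)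
qed

lemma step_mat_bounded:
  assumes "\<And>n. a n \<le> A" "\<And>n. 1 / a n \<le> A'" "\<And>n. \<bar>b n\<bar> \<le> B" "\<bar>E\<bar> \<le> R"
  shows "norm2 (step_mat b E n) \<le> (R + B) * A' + A' + \<bar>A\<bar> + 1"
proof -
  have "\<bar>(E - b n) / a n\<bar> = \<bar>E - b n\<bar> * (1 / a n)" using a_pos[of n] by simp
  also have "\<dots> \<le> (R + B) * A'"
    using assms(3)[of n] assms(4) a_pos[of n] assms(2)[of n] by (intro mult_mono) auto
  finally have "\<bar>(E - b n) / a n\<bar> \<le> (R + B) * A'" .
  then show ?thesis using assms(1,2)[of n] a_pos[of n] by (simp add: norm2_def step_mat_def)
qed

text \<open>The two shifts together have norm at most 2, so a discriminant of larger modulus must be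
  paid for by the defect in the three-term relation. This is a quantitative form of the fact that
  such energies lie in gaps.\<close>

lemma periodic_lower_bound:
  assumes per: "per q a" "per q b" and K: "\<And>n. norm2 (step_mat b E n) \<le> K" "K \<ge> 1"
    and bd: "\<And>n. \<bar>a n\<bar> \<le> A" "\<And>n. \<bar>b n\<bar> \<le> B"
  shows "(\<bar>disc b q E\<bar> - 2) * norm x \<le> 4 * K ^ (2 * q) * real q * norm (bounded_jacobi.H a b (of_real E) x)"
proof -
  interpret J: bounded_jacobi a b A B by standard (rule bd)+
  define g where "g = ell2_shift (int q) x + ell2_shift (- int q) x - disc b q E *\<^sub>R x"
  have "norm g \<le> 2 * K ^ (2 * q) * real (2 * q) * norm (J.H (of_real E) x)"
  proof (rule ell2_window_bound)
    show "cmod (ell2_seq g n) \<le> 2 * K ^ (2 * q) * (\<Sum>j<2 * q. cmod (ell2_seq (J.H (of_real E) x) (n + (int j - int q))))" for n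
      using three_term_identity[OF per K, of "ell2_seq x" n]
      by (simp add: g_def ell2_seq_simps J.H_seq scaleR_conv_of_real)
  qed (use K in simp)
  moreover have "disc b q E *\<^sub>R x = ell2_shift (int q) x + ell2_shift (- int q) x - g" by (simp add: g_def)
  then have "\<bar>disc b q E\<bar> * norm x \<le> norm (ell2_shift (int q) x) + norm (ell2_shift (- int q) x) + norm g"
    using norm_triangle_ineq4[of "ell2_shift (int q) x + ell2_shift (- int q) x" g]
      norm_triangle_ineq[of "ell2_shift (int q) x" "ell2_shift (- int q) x"]
    by (metis (no_types, opaque_lifting) add_mono_thms_linordered_semiring(3) norm_scaleR order_trans)
  ultimately show ?thesis
    using norm_ell2_shift[of "int q" x] norm_ell2_shift[of "- int q" x] by (simp add: left_diff_distrib mult.assoc)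
qed

text \<open>Continuity from above leaves room to relax the bound 2 to \<open>2 + d\<close> without
  losing the measure estimate. Off the relaxed set \<open>periodic_lower_bound\<close> gives the
  uniform constant \<open>d / c\<close>, which tolerates any perturbation of size
  \<open>r < d / c\<close>.\<close>

lemma small_spectrum_stable:
  assumes per: "per q a" "per q p" and q: "q > 0"
    and A: "\<And>n. a n \<le> A" "\<And>n. 1 / a n \<le> A'" and B: "\<And>n. \<bar>p n\<bar> \<le> B"
    and small: "emeasure lborel {E \<in> {- (2 * A + B + 1)..2 * A + B + 1}. \<bar>disc p q E\<bar> \<le> 2} < \<eta>"
  shows "\<exists>r>0. \<forall>b. (\<forall>n. \<bar>b n - p n\<bar> \<le> r) \<longrightarrow>
    (\<exists>S\<in>sets borel. real_spectrum (jacobi a b) \<subseteq> S \<and> emeasure lborel S < \<eta>)"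
proof -
  have A0: "\<And>n. \<bar>a n\<bar> \<le> A" using A(1) a_pos by (simp add: less_imp_le)
  have A0': "A > 0" "A' > 0" using A[of 0] a_pos[of 0] by (auto intro: less_le_trans[of 0 "a 0"] less_le_trans[of 0 "1 / a 0"])
  have B0: "B \<ge> 0" using B[of 0] by linarith
  \<comment> \<open>Bounds the spectra of all perturbations of size at most 1.\<close>
  define R where "R = 2 * A + B + 1"
  define K where "K = (R + B) * A' + A' + \<bar>A\<bar> + 1"
  have K: "norm2 (step_mat p E n) \<le> K" if "\<bar>E\<bar> \<le> R" for E n
    unfolding K_def by (rule step_mat_bounded[OF A B that])
  have K1: "K \<ge> 1" using A0' B0 by (simp add: K_def R_def)
  define c where "c = 4 * K ^ (2 * q) * real q"
  have c: "c > 0" using K1 q by (simp add: c_def)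
  define S where "S i = {E \<in> {- R..R}. \<bar>disc p q E\<bar> \<le> 2 + inverse (real (Suc i))}" for i
  have S_borel: "S i \<in> sets borel" for i
  proof -
    have "closed (S i)"
      unfolding S_def Collect_conj_eq Collect_mem_eq
      by (intro closed_Int closed_real_atLeastAtMost closed_Collect_le continuous_intros continuous_disc)
    then show ?thesis by simp
  qed
  have "(\<lambda>i. emeasure lborel (S i)) \<longlonglongrightarrow> emeasure lborel (\<Inter>i. S i)"
  proof (rule Lim_emeasure_decseq)
    show "range S \<subseteq> sets lborel" using S_borel by auto
    show "decseq S"
    proof (rule decseq_SucI)
      fix i
      have "inverse (real (Suc (Suc i))) \<le> inverse (real (Suc i))" by (intro le_imp_inverse_le) auto
      then show "S (Suc i) \<subseteq> S i" unfolding S_def by (blast intro: order_trans add_left_mono)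
    qed
    show "emeasure lborel (S i) \<noteq> \<infinity>" for i
    proof -
      have "emeasure lborel (S i) \<le> emeasure lborel {- R..R}" by (intro emeasure_mono) (auto simp: S_def)
      also have "\<dots> < \<infinity>" by (simp add: emeasure_lborel_Icc_eq)
      finally show ?thesis by simp
    qed
  qed
  moreover have "(\<Inter>i. S i) = {E \<in> {- R..R}. \<bar>disc p q E\<bar> \<le> 2}"
  proof -
    have "x \<le> 2" if "\<And>i. x \<le> 2 + inverse (real (Suc i))" for x
    proof -
      have "(\<lambda>i. 2 + inverse (real (Suc i))) \<longlonglongrightarrow> 2 + 0"
        by (intro tendsto_intros LIMSEQ_inverse_real_of_nat)
      then show ?thesis using LIMSEQ_le_const[of _ "2 + 0" x] that by simp
    qed
    then have "\<bar>disc p q E\<bar> \<le> 2" if "\<And>i. E \<in> S i" for E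
      using that unfolding S_def by blast
    moreover have "E \<in> S i" if "E \<in> {- R..R}" "\<bar>disc p q E\<bar> \<le> 2" for E i
    proof -
      have "0 \<le> inverse (real (Suc i))" by simp
      then show ?thesis using that unfolding S_def mem_Collect_eq by linarith
    qed
    ultimately show ?thesis unfolding S_def by blast
  qed
  ultimately have "\<forall>\<^sub>F i in sequentially. emeasure lborel (S i) < \<eta>"
    using small by (intro order_tendstoD(2)[where y = "emeasure lborel (\<Inter>i. S i)"]) (simp_all add: R_def)
  then obtain i where i: "emeasure lborel (S i) < \<eta>" by (meson eventually_happens' sequentially_bot)
  define d where "d = inverse (real (Suc i))"
  have d: "d > 0" by (simp add: d_def)
  define r where "r = min 1 (d / (2 * c))"
  have r: "r > 0" "r \<le> 1" "r < d / c"
  proof -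
    show "r > 0" "r \<le> 1" using d c by (auto simp: r_def)
    have "r \<le> d / (2 * c)" by (simp add: r_def)
    also have "\<dots> < d / c" using d c by (simp add: field_simps)
    finally show "r < d / c" .
  qed
  have "real_spectrum (jacobi a b) \<subseteq> S i" if b: "\<And>n. \<bar>b n - p n\<bar> \<le> r" for b
  proof
    have b1: "\<bar>b n\<bar> \<le> B + 1" for n using b[of n] B[of n] r(2) by linarith
    interpret J: bounded_jacobi a b A "B + 1" by standard (rule A0 b1)+
    interpret P: bounded_jacobi a p A B by standard (rule A0 B)+
    fix E assume E: "E \<in> real_spectrum (jacobi a b)"
    have ER: "\<bar>E\<bar> \<le> R" using J.spec_bounded[OF E] by (simp add: R_def)
    show "E \<in> S i"
    proof (rule ccontr)
      assume "E \<notin> S i"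
      then have D: "\<bar>disc p q E\<bar> - 2 > d" using ER by (auto simp: S_def d_def)
      have "(d / c - r) * norm x \<le> norm (J.H (of_real E) x)" for x
      proof -
        have "d * norm x \<le> (\<bar>disc p q E\<bar> - 2) * norm x" using D by (intro mult_right_mono) auto
        also have "\<dots> \<le> c * norm (P.H (of_real E) x)"
          unfolding c_def by (rule periodic_lower_bound[OF per K[OF ER] K1 A0 B])
        finally have 1: "d / c * norm x \<le> norm (P.H (of_real E) x)" using c by (simp add: field_simps)
        define w where "w = ell2_mult (\<lambda>n. of_real (p n) - of_real (b n)) x"
        have bw: "cmod (of_real (p n) - of_real (b n)) \<le> r" for n
          using b[of n] by (simp add: abs_minus_commute flip: of_real_diff)
        have "P.H (of_real E) x = J.H (of_real E) x + w"
          by (rule ell2_eqI) (simp add: w_def plus_ell2.rep_eq P.H_seq J.H_seq jacobi_def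
              ell2_seq_mult[of "\<lambda>n. of_real (p n) - of_real (b n)", OF bw] algebra_simps)
        then have "norm (P.H (of_real E) x) \<le> norm (J.H (of_real E) x) + norm w" by (simp add: norm_triangle_ineq)
        moreover have "norm w \<le> r * norm x"
          unfolding w_def by (rule norm_ell2_mult[of "\<lambda>n. of_real (p n) - of_real (b n)", OF bw])
        ultimately show ?thesis using 1 by (simp add: left_diff_distrib)
      qed
      then have "E \<notin> J.spec" using r(3) J.spec_iff by (meson diff_gt_0_iff_gt)
      then show False using E by simp
    qed
  qed
  then show ?thesis using r(1) i S_borel by blast
qed

text \<open>Gordon's argument, run on the three-term identity instead of on transfer matrices.\<close>

lemma Gordon:
  assumes A: "\<And>n. a n \<le> A" "\<And>n. 1 / a n \<le> A'" and B: "\<And>n. \<bar>b n\<bar> \<le> B"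
    and approx: "\<And>k. \<exists>q p. q \<ge> k \<and> q > 0 \<and> per q a \<and> per q p \<and> (\<forall>n. \<bar>b n - p n\<bar> \<le> (1 / real q) ^ q)"
    and x: "bounded_jacobi.H a b (of_real E) x = 0"
  shows "x = 0"
proof (rule ccontr)
  assume "x \<noteq> 0"
  have A0: "\<And>n. \<bar>a n\<bar> \<le> A" using A(1) a_pos by (simp add: less_imp_le)
  have A0': "A > 0" "A' > 0" using A[of 0] a_pos[of 0] by (auto intro: less_le_trans[of 0 "a 0"] less_le_trans[of 0 "1 / a 0"])
  interpret J: bounded_jacobi a b A B by standard (rule A0 B)+
  define u where "u = ell2_seq x"
  have sol: "jacobi a b u n = of_real E * u n" for n
    using arg_cong[OF x, of "\<lambda>y. ell2_seq y n"] by (simp add: J.H_seq u_def zero_ell2.rep_eq)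
  obtain n where n: "u n \<noteq> 0" using \<open>x \<noteq> 0\<close> ell2_eqI[of x 0] by (auto simp: u_def zero_ell2.rep_eq)
  define c where "c = cmod (u n)"
  have c: "c > 0" using n by (simp add: c_def)
  \<comment> \<open>Both uses below need only that \<open>3 * d\<close> is less than
    \<open>c\<close>.\<close>
  define d where "d = c / 8"
  have d: "d > 0" using c by (simp add: d_def)
  define K where "K = (\<bar>E\<bar> + (B + 1)) * A' + A' + \<bar>A\<bar> + 1"
  have K1: "K \<ge> 1" using A0' B[of 0] by (auto simp: K_def intro!: add_nonneg_nonneg mult_nonneg_nonneg)
  have fin: "finite {m. cmod (u m) \<ge> d}" unfolding u_def by (rule ell2_finite_large[OF d])
  define N where "N = (\<Sum>m\<in>{m. cmod (u m) \<ge> d}. nat \<bar>m\<bar>)"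
  have N: "cmod (u m) < d" if "\<bar>m\<bar> > int N" for m
  proof (rule ccontr)
    assume "\<not> cmod (u m) < d"
    then have "nat \<bar>m\<bar> \<le> N" unfolding N_def using fin by (intro member_le_sum) auto
    then show False using that by linarith
  qed
  have "(\<lambda>q. 4 * norm x * (real q * (1 / 2) ^ q)) \<longlonglongrightarrow> 4 * norm x * 0"
    by (intro tendsto_intros powser_times_n_limit_0) auto
  then have "\<forall>\<^sub>F q in sequentially. 4 * norm x * (real q * (1 / 2) ^ q) < d"
    by (rule order_tendstoD(2)) (use d in simp)
  then obtain k0 where k0: "\<And>q. q \<ge> k0 \<Longrightarrow> 4 * norm x * (real q * (1 / 2) ^ q) < d"
    by (auto simp: eventually_sequentially)
  \<comment> \<open>Large \<open>q\<close> has three effects: the total error is below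
    \<open>d\<close>, translation by \<open>q\<close> or \<open>2 * q\<close> leaves the finite set
    where \<open>u\<close> is large, and \<open>K\<^sup>2 / q \<le> 1 / 2\<close> beats the growth
    of the transfer matrices.\<close>
  define k where "k = max k0 (max (N + nat \<bar>n\<bar> + 1) (nat \<lceil>2 * K\<^sup>2\<rceil>))"
  obtain q p where q: "q \<ge> k" "q > 0" and per: "per q a" "per q p"
    and close: "\<And>n. \<bar>b n - p n\<bar> \<le> (1 / real q) ^ q" using approx by blast
  have qk: "q \<ge> k0" "int q > int N + \<bar>n\<bar>" "real q \<ge> 2 * K\<^sup>2"
  proof -
    show "q \<ge> k0" using q by (simp add: k_def)
    have "N + nat \<bar>n\<bar> + 1 \<le> q" using q by (simp add: k_def)
    then show "int q > int N + \<bar>n\<bar>" by linarith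
    have "nat \<lceil>2 * K\<^sup>2\<rceil> \<le> q" using q by (simp add: k_def)
    then show "real q \<ge> 2 * K\<^sup>2" by linarith
  qed
  have Bp: "\<bar>p m\<bar> \<le> B + 1" for m
  proof -
    have "(1 / real q) ^ q \<le> 1" using q by (intro power_le_one) auto
    then show ?thesis using close[of m] B[of m] by linarith
  qed
  have Kp: "norm2 (step_mat p E m) \<le> K" for m
    unfolding K_def by (rule step_mat_bounded[OF A Bp]) simp
  have f: "cmod (jacobi a p u m - of_real E * u m) \<le> (1 / real q) ^ q * norm x" for m
  proof -
    have "jacobi a p u m - of_real E * u m = of_real (p m - b m) * u m"
      using sol[of m] by (simp add: jacobi_def algebra_simps)
    then have "cmod (jacobi a p u m - of_real E * u m) = \<bar>b m - p m\<bar> * cmod (u m)"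
      by (simp add: norm_mult abs_minus_commute del: of_real_diff)
    also have "\<dots> \<le> (1 / real q) ^ q * norm x"
      unfolding u_def by (intro mult_mono close ell2_seq_le_norm) auto
    finally show ?thesis .
  qed
  define D where "D = disc p q E"
  have err: "cmod (u (m + int q) + u (m - int q) - of_real D * u m) \<le> d" for m
  proof -
    have "cmod (u (m + int q) + u (m - int q) - of_real D * u m) \<le>
        2 * K ^ (2 * q) * (\<Sum>j<2 * q. (1 / real q) ^ q * norm x)"
      unfolding D_def using K1
      by (intro order_trans[OF three_term_identity[OF per Kp K1]] mult_left_mono sum_mono f) auto
    also have "\<dots> = 4 * norm x * (real q * (K\<^sup>2 / real q) ^ q)"
      by (simp add: power_mult power_divide)
    also have "\<dots> \<le> 4 * norm x * (real q * (1 / 2) ^ q)"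
      using qk(3) q by (intro mult_left_mono power_mono) (auto simp: field_simps)
    finally show ?thesis using k0[OF qk(1)] by linarith
  qed
  have far: "cmod (u (n + int q)) < d" "cmod (u (n - int q)) < d" "cmod (u (n + int q + int q)) < d"
    using qk(2) by (auto intro!: N)
  have "\<bar>D\<bar> * c = cmod (of_real D * u n)" by (simp add: norm_mult c_def)
  also have "\<dots> \<le> cmod (u (n + int q)) + cmod (u (n - int q)) + cmod (u (n + int q) + u (n - int q) - of_real D * u n)"
    by (smt (verit) norm_minus_commute norm_triangle_ineq norm_triangle_sub)
  finally have "\<bar>D\<bar> * c \<le> 3 * d" using far err[of n] by linarith
  then have D: "\<bar>D\<bar> \<le> 1" using c by (simp add: d_def)
  \<comment> \<open>The relation centred at \<open>n\<close> bounded \<open>D\<close>; centred at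
    \<open>n + q\<close> it now expresses \<open>u n\<close> through two small values.\<close>
  have "c \<le> cmod (u (n + int q + int q)) + cmod (of_real D * u (n + int q))
      + cmod (u (n + int q + int q) + u (n + int q - int q) - of_real D * u (n + int q))"
    unfolding c_def
    by (smt (verit) add_diff_cancel_right' norm_minus_commute norm_triangle_ineq norm_triangle_sub)
  moreover have "cmod (of_real D * u (n + int q)) \<le> d"
    using mult_mono[OF D less_imp_le[OF far(1)]] by (simp add: norm_mult)
  ultimately have "c \<le> 3 * d" using far(3) err[of "n + int q"] by linarith
  then show False using c by (simp add: d_def)
qed

end

section \<open>Generic potentials\<close>

lemma periodic_seq_per: "periodic_seq f \<longleftrightarrow> (\<exists>q>0. per q f)"
proof
  assume "periodic_seq f"
  then obtain p where "p > 0" "\<And>n. f (n + p) = f n" by (auto simp: periodic_seq_def)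
  then show "\<exists>q>0. per q f" by (intro exI[of _ "nat p"]) (auto simp: per_def)
next
  assume "\<exists>q>0. per q f"
  then obtain q where "q > 0" "per q f" by blast
  then show "periodic_seq f" unfolding periodic_seq_def per_def by (intro exI[of _ "int q"]) auto
qed

text \<open>Baire's theorem inside a closed subset, with the sets \<open>U n\<close> open in the
  ambient space, as they arise from conditions on arbitrary bounded potentials.\<close>

lemma closed_Baire:
  fixes S :: "'a::metric_space set"
  assumes "uniform_space_class.complete (UNIV :: 'a set)" "closed S" "\<And>n::nat. open (U n)" "\<And>n. S \<subseteq> closure (S \<inter> U n)"
  shows "S \<subseteq> closure (S \<inter> (\<Inter>n. U n))"
proof -
  interpret Sub: Submetric UNIV dist S by standard simp
  have top: "Sub.sub.mtopology = top_of_set S"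
    using Sub.mtopology_submetric by simp
  have "Sub.sub.mcomplete"
    using assms(1,2) by (intro Sub.closedin_mcomplete_imp_mcomplete) simp_all
  moreover have "openin Sub.sub.mtopology (S \<inter> U n) \<and> Sub.sub.mtopology closure_of (S \<inter> U n) = S" for n
    using assms(3,4)[of n] unfolding top by (auto simp: closure_of_subtopology openin_open_Int)
  ultimately have "Sub.sub.mtopology closure_of \<Inter>(range (\<lambda>n. S \<inter> U n)) = S"
    by (intro Sub.sub.metric_Baire_category) auto
  then have "S \<inter> closure (S \<inter> (\<Inter>n. S \<inter> U n)) = S"
    unfolding top by (simp add: closure_of_subtopology)
  moreover have "S \<inter> (\<Inter>n. S \<inter> U n) = S \<inter> (\<Inter>n. U n)" by auto
  ultimately show ?thesis by auto
qed

text \<open>The library instance of \<open>complete_space\<close> covers only metric domains, which excludes \<open>int\<close>.\<close>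

lemma complete_bcontfun_int: "uniform_space_class.complete (UNIV :: (int \<Rightarrow>\<^sub>C real) set)"
  unfolding complete_def
proof (intro allI impI)
  fix f :: "nat \<Rightarrow> int \<Rightarrow>\<^sub>C real" assume "(\<forall>n. f n \<in> UNIV) \<and> Cauchy f"
  then have f: "Cauchy f" by simp
  have "convergent (\<lambda>k. apply_bcontfun (f k) n)" for n
  proof (rule real_Cauchy_convergent, rule metric_CauchyI)
    fix e :: real assume "e > 0"
    then obtain N where "\<And>k m. k \<ge> N \<Longrightarrow> m \<ge> N \<Longrightarrow> dist (f k) (f m) < e"
      using metric_CauchyD[OF f] by blast
    then show "\<exists>N. \<forall>k\<ge>N. \<forall>m\<ge>N. dist (apply_bcontfun (f k) n) (apply_bcontfun (f m) n) < e"
      using dist_bounded order.strict_trans1 by blast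
  qed
  then obtain g where g: "\<And>n. (\<lambda>k. apply_bcontfun (f k) n) \<longlonglongrightarrow> g n"
    unfolding convergent_def by metis
  have unif: "\<exists>N. \<forall>k\<ge>N. \<forall>n. dist (apply_bcontfun (f k) n) (g n) \<le> e" if e: "e > 0" for e
  proof -
    obtain N where N: "\<And>k m. k \<ge> N \<Longrightarrow> m \<ge> N \<Longrightarrow> dist (f k) (f m) < e"
      using metric_CauchyD[OF f e] by blast
    have "dist (apply_bcontfun (f k) n) (g n) \<le> e" if "k \<ge> N" for k n
    proof (rule LIMSEQ_le_const2)
      show "(\<lambda>m. dist (apply_bcontfun (f k) n) (apply_bcontfun (f m) n)) \<longlonglongrightarrow> dist (apply_bcontfun (f k) n) (g n)"
        by (intro tendsto_intros g)
      have "dist (apply_bcontfun (f k) n) (apply_bcontfun (f m) n) \<le> e" if "m \<ge> N" for m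
        using dist_bounded[of "f k" n "f m"] N[OF \<open>k \<ge> N\<close> that] by linarith
      then show "\<exists>N. \<forall>m\<ge>N. dist (apply_bcontfun (f k) n) (apply_bcontfun (f m) n) \<le> e" by blast
    qed
    then show ?thesis by blast
  qed
  obtain N where N: "\<And>n. dist (apply_bcontfun (f N) n) (g n) \<le> 1" using unif[of 1] by auto
  have "\<bar>g n\<bar> \<le> norm (f N) + 1" for n
    using N[of n] norm_bounded[of "f N" n] by (simp add: dist_real_def)
  then have "g \<in> bcontfun" by (auto simp: bcontfun_def bounded_iff intro!: exI[of _ "norm (f N) + 1"])
  then have G: "apply_bcontfun (Bcontfun g) = g" by (rule Bcontfun_inverse)
  have "f \<longlonglongrightarrow> Bcontfun g"
  proof (rule metric_LIMSEQ_I)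
    fix e :: real assume e: "e > 0"
    obtain N where N: "\<And>k n. k \<ge> N \<Longrightarrow> dist (apply_bcontfun (f k) n) (g n) \<le> e / 2"
      using unif[OF half_gt_zero[OF e]] by blast
    have "dist (f k) (Bcontfun g) < e" if "k \<ge> N" for k
    proof -
      have "dist (f k) (Bcontfun g) \<le> e / 2" by (rule dist_bound) (use N[OF that] in \<open>simp add: G\<close>)
      then show ?thesis using e by linarith
    qed
    then show "\<exists>N. \<forall>k\<ge>N. dist (f k) (Bcontfun g) < e" by blast
  qed
  then show "\<exists>l\<in>UNIV. f \<longlonglongrightarrow> l" by blast
qed

context jacobi_weights
begin

text \<open>Gordon's approximation at a period beyond \<open>k\<close>, together with a small
  spectrum. Smallness is put as inclusion in a Borel set, the form in which it is stable.\<close>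

definition good :: "nat \<Rightarrow> (int \<Rightarrow> real) \<Rightarrow> bool" where
  "good k b \<longleftrightarrow>
    (\<exists>q p. q \<ge> k \<and> q > 0 \<and> per q a \<and> per q p \<and> (\<forall>n. \<bar>b n - p n\<bar> \<le> (1 / real q) ^ q)) \<and>
    (\<exists>S\<in>sets borel. real_spectrum (jacobi a b) \<subseteq> S \<and> emeasure lborel S < ennreal (inverse (real (Suc k))))"

lemma weights_bounds:
  assumes "per q a" "q > 0"
  obtains A A' where "\<And>n. a n \<le> A" "\<And>n. 1 / a n \<le> A'" "A > 0"
proof -
  have "per q (\<lambda>n. 1 / a n)" using assms(1) by (simp add: per_def)
  then obtain A' where A': "\<And>n. \<bar>1 / a n\<bar> \<le> A'" using per_bounded assms(2) by blast
  obtain A where A: "\<And>n. \<bar>a n\<bar> \<le> A" using per_bounded assms by blast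
  have "A > 0" using A[of 0] a_pos[of 0] by linarith
  then show thesis using that[of A A'] A A' abs_le_D1 by blast
qed

lemma good_near:
  assumes a: "per q a" "q > 0" and b0: "per q0 b0" "q0 > 0" and e: "e > 0"
  shows "\<exists>p r. periodic_seq p \<and> r > 0 \<and> (\<forall>n. \<bar>p n - b0 n\<bar> \<le> e) \<and>
    (\<forall>b. (\<forall>n. \<bar>b n - p n\<bar> \<le> r) \<longrightarrow> good k b)"
proof -
  obtain A A' where A: "\<And>n. a n \<le> A" "\<And>n. 1 / a n \<le> A'" "A > 0"
    using weights_bounds[OF a] by blast
  obtain B where B: "\<And>n. \<bar>b0 n\<bar> \<le> B" using per_bounded[OF b0] by blast
  \<comment> \<open>The range that \<open>small_spectrum_stable\<close> asks for when the potential
    is bounded by \<open>B + 1\<close>, as \<open>p\<close> will be.\<close>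
  define R where "R = 2 * A + (B + 1) + 1"
  have R: "R > 0" using A(3) B[of 0] by (simp add: R_def)
  have perQ: "per (q * q0) a" "per (q * q0) b0"
    using a b0 by (auto intro: per_dvd)
  obtain p q' where p: "q' > 0" "per q' a" "per q' p" "\<And>n. \<bar>p n - b0 n\<bar> \<le> min e 1"
    "emeasure lborel {E \<in> {- R..R}. \<bar>disc p q' E\<bar> \<le> 2} < ennreal (inverse (real (Suc k)))"
  proof (rule thin_spectrum[OF perQ, of "min e 1" "inverse (real (Suc k))" R])
    show "0 < q * q0" using a b0 by simp
    show "0 < min e 1" using e by simp
    show "0 < inverse (real (Suc k))" by simp
  qed (use R that in blast)+
  have Bp: "\<bar>p n\<bar> \<le> B + 1" for n
    using p(4)[of n] B[of n] by linarith
  obtain r1 where r1: "r1 > 0" "\<And>b. (\<forall>n. \<bar>b n - p n\<bar> \<le> r1) \<Longrightarrow>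
      (\<exists>S\<in>sets borel. real_spectrum (jacobi a b) \<subseteq> S \<and> emeasure lborel S < ennreal (inverse (real (Suc k))))"
    using small_spectrum_stable[OF p(2,3,1) A(1,2) Bp p(5)[unfolded R_def]] by blast
  \<comment> \<open>A multiple of the period is again a period, so Gordon's scale can be pushed
    beyond \<open>k\<close> without changing \<open>p\<close>.\<close>
  define Q where "Q = q' * Suc k"
  have Q: "Q \<ge> k" "Q > 0" "per Q a" "per Q p"
  proof -
    have "1 * k \<le> q' * Suc k" using p(1) by (intro mult_le_mono) auto
    then show "Q \<ge> k" by (simp add: Q_def)
    show "per Q a" "per Q p" unfolding Q_def by (rule per_dvd[OF p(2)] per_dvd[OF p(3)], simp)+
  qed (use p(1) in \<open>simp add: Q_def\<close>)
  define r where "r = min r1 ((1 / real Q) ^ Q)"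
  have "r > 0" using r1(1) Q(2) by (simp add: r_def)
  moreover have "good k b" if "\<forall>n. \<bar>b n - p n\<bar> \<le> r" for b
    unfolding good_def
  proof
    show "\<exists>q p. q \<ge> k \<and> q > 0 \<and> per q a \<and> per q p \<and> (\<forall>n. \<bar>b n - p n\<bar> \<le> (1 / real q) ^ q)"
      using Q that by (intro exI[of _ Q] exI[of _ p]) (simp add: r_def)
    show "\<exists>S\<in>sets borel. real_spectrum (jacobi a b) \<subseteq> S \<and> emeasure lborel S < ennreal (inverse (real (Suc k)))"
      using that by (intro r1(2)) (simp add: r_def)
  qed
  moreover have "periodic_seq p" using p(1,3) periodic_seq_per by blast
  moreover have "\<forall>n. \<bar>p n - b0 n\<bar> \<le> e" using p(4) by simp
  ultimately show ?thesis by blast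
qed

lemma good_spectrum:
  assumes a: "per q a" "q > 0" and B: "\<And>n. \<bar>b n\<bar> \<le> B" and good: "\<And>k. good k b"
  shows "cantor_set (real_spectrum (jacobi a b))"
    and "real_spectrum (jacobi a b) \<in> null_sets lebesgue"
    and "purely_singular_continuous (jacobi a b)"
proof -
  obtain A A' where A: "\<And>n. a n \<le> A" "\<And>n. 1 / a n \<le> A'" "A > 0"
    using weights_bounds[OF a] by blast
  have A0: "\<And>n. \<bar>a n\<bar> \<le> A" using A(1) a_pos by (simp add: less_imp_le)
  interpret J: bounded_jacobi a b A B by standard (rule A0 B)+
  have ker: "x = 0" if "J.H (of_real E) x = 0" for E x
    by (rule Gordon[OF A(1,2) B _ that]) (use good in \<open>auto simp: good_def\<close>)
  have spec_borel: "J.spec \<in> sets borel"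
    using compact_imp_closed[OF J.compact_spec] by simp
  have "emeasure lborel J.spec \<le> ennreal (inverse (real (Suc k)))" for k
  proof -
    obtain S where "S \<in> sets borel" "J.spec \<subseteq> S" "emeasure lborel S < ennreal (inverse (real (Suc k)))"
      using good[of k] by (auto simp: good_def)
    then show ?thesis using emeasure_mono[of J.spec S lborel] by (simp add: order.strict_implies_order order_trans)
  qed
  moreover have "(\<lambda>k. ennreal (inverse (real (Suc k)))) \<longlonglongrightarrow> ennreal 0"
    by (intro tendsto_ennrealI LIMSEQ_inverse_real_of_nat)
  ultimately have "emeasure lborel J.spec \<le> ennreal 0"
    by (intro LIMSEQ_le_const[of _ "ennreal 0"]) auto
  then have null: "J.spec \<in> null_sets lborel" using spec_borel by (auto intro!: null_setsI)
  then show leb: "J.spec \<in> null_sets lebesgue" by (rule null_sets_completionI)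
  have "interior J.spec = {}"
  proof (rule ccontr)
    assume "interior J.spec \<noteq> {}"
    then have "\<not> negligible (interior J.spec)" by (intro open_not_negligible) auto
    moreover have "negligible J.spec" using leb by (simp add: negligible_iff_null_sets)
    ultimately show False using negligible_subset interior_subset by blast
  qed
  moreover have "s islimpt J.spec" if "s \<in> J.spec" for s
    using ker by (rule J.spec_islimpt[OF _ that])
  ultimately show "cantor_set J.spec"
    unfolding cantor_set_def using J.compact_spec by blast
  show "purely_singular_continuous (jacobi a b)"
    unfolding purely_singular_continuous_def
  proof (intro ballI allI impI)
    fix \<psi> \<mu> assume "\<psi> \<in> l2Z" "is_spectral_measure (jacobi a b) \<psi> \<mu>"
    then have mu: "is_spectral_measure (jacobi a b) (ell2_seq (Abs_ell2 \<psi>)) \<mu>"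
      by (simp add: Abs_ell2_inverse)
    show "singular_continuous_measure \<mu>"
      unfolding singular_continuous_measure_def
    proof (intro conjI exI[of _ J.spec] allI)
      show "emeasure \<mu> {s} = 0" for s
        using ker by (rule J.spectral_measure_no_atom[OF mu])
    qed (use null J.spectral_measure_supported[OF mu] in auto)
  qed
qed

end

text \<open>Since the right side is closed, it suffices to approximate periodic potentials. The
  approximant is periodic, hence in \<open>LP\<close>, and it is the centre of a ball of good
  potentials, hence in the interior.\<close>

lemma LP_subset_closure_good:
  assumes "jacobi_weights a" "per q a" "q > 0"
  shows "LP \<subseteq> closure (LP \<inter> interior {b. jacobi_weights.good a k (apply_bcontfun b)})" (is "_ \<subseteq> closure (_ \<inter> interior ?G)")
  unfolding LP_def
proof (rule closure_minimal, rule subsetI)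
  interpret jacobi_weights a by fact
  fix b0 :: "int \<Rightarrow>\<^sub>C real" assume "b0 \<in> {b. periodic_seq (apply_bcontfun b)}"
  then obtain q0 where b0: "q0 > 0" "per q0 (apply_bcontfun b0)" by (auto simp: periodic_seq_per)
  have "\<exists>y\<in>closure {b. periodic_seq (apply_bcontfun b)} \<inter> interior ?G. dist y b0 < e" if e: "e > 0" for e
  proof -
    obtain p r where p: "periodic_seq p" "r > 0" "\<And>n. \<bar>p n - apply_bcontfun b0 n\<bar> \<le> e / 2"
      "\<And>b. (\<forall>n. \<bar>b n - p n\<bar> \<le> r) \<Longrightarrow> good k b"
      using good_near[OF assms(2,3) b0(2,1) half_gt_zero[OF e], of k] by blast
    obtain B where "\<And>n. \<bar>p n\<bar> \<le> B" using p(1) per_bounded periodic_seq_per by blast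
    then have "p \<in> bcontfun" by (auto simp: bcontfun_def bounded_iff intro!: exI[of _ B])
    then have P: "apply_bcontfun (Bcontfun p) = p" by (rule Bcontfun_inverse)
    have "dist (Bcontfun p) b0 \<le> e / 2" by (rule dist_bound) (use p(3) in \<open>simp add: P dist_real_def\<close>)
    moreover have "Bcontfun p \<in> closure {b. periodic_seq (apply_bcontfun b)}"
      using p(1) P by (intro closure_subset[THEN subsetD]) simp
    moreover have "ball (Bcontfun p) r \<subseteq> ?G"
    proof
      fix b assume b: "b \<in> ball (Bcontfun p) r"
      have "\<bar>apply_bcontfun b n - p n\<bar> \<le> r" for n
        using dist_bounded[of b n "Bcontfun p"] b P by (simp add: dist_real_def dist_commute)
      then show "b \<in> ?G" using p(4) by simp
    qed
    then have "Bcontfun p \<in> interior ?G" using p(2) by (meson centre_in_ball interior_maximal open_ball subsetD)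
    ultimately show ?thesis using e by (intro bexI[of _ "Bcontfun p"]) auto
  qed
  then show "b0 \<in> closure (closure {b. periodic_seq (apply_bcontfun b)} \<inter> interior ?G)"
    unfolding closure_approachable by blast
qed simp

theorem theorem1p3:
  fixes a :: "int \<Rightarrow> real"
  assumes "periodic_seq a" and "\<And>n. a n > 0"
  shows "\<exists>G. G \<subseteq> LP \<and> gdelta_in (top_of_set LP) G \<and> LP \<subseteq> closure G \<and>
           (\<forall>b\<in>G. cantor_set (real_spectrum (jacobi a (apply_bcontfun b))) \<and>
                   real_spectrum (jacobi a (apply_bcontfun b)) \<in> null_sets lebesgue \<and>
                   purely_singular_continuous (jacobi a (apply_bcontfun b)))"
proof -
  interpret jacobi_weights a by standard (rule assms(2))
  obtain q where q: "q > 0" "per q a" using assms(1) periodic_seq_per by blast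
  define U where "U k = interior {b. good k (apply_bcontfun b)}" for k
  define G where "G = LP \<inter> (\<Inter>k. U k)"
  have "gdelta_in (top_of_set LP) (\<Inter>k. LP \<inter> U k)"
    by (intro gdelta_in_Inter) (auto simp: U_def intro!: open_imp_gdelta_in openin_open_Int)
  moreover have "(\<Inter>k. LP \<inter> U k) = G" by (auto simp: G_def)
  moreover have "LP \<subseteq> closure G"
    unfolding G_def
  proof (rule closed_Baire[OF complete_bcontfun_int])
    show "closed LP" by (simp add: LP_def)
    show "LP \<subseteq> closure (LP \<inter> U k)" for k
      unfolding U_def by (rule LP_subset_closure_good[OF jacobi_weights_axioms q(2,1)])
  qed (simp add: U_def)
  moreover have "cantor_set (real_spectrum (jacobi a (apply_bcontfun b))) \<and>
      real_spectrum (jacobi a (apply_bcontfun b)) \<in> null_sets lebesgue \<and>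
      purely_singular_continuous (jacobi a (apply_bcontfun b))" if "b \<in> G" for b
  proof -
    have good: "good k (apply_bcontfun b)" for k
      using that interior_subset[of "{b. good k (apply_bcontfun b)}"] by (auto simp: G_def U_def)
    have B: "\<bar>apply_bcontfun b n\<bar> \<le> norm b" for n
      using norm_bounded[of b n] by simp
    show ?thesis by (intro conjI good_spectrum[OF q(2,1) B good])
  qed
  moreover have "G \<subseteq> LP" by (simp add: G_def)
  ultimately show ?thesis by (intro exI[of _ G]) simp
qed

end
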